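(* $\gamma(Q_{163})=82$.
   Context: For a positive integer $n$, the queen's graph $Q_n$ is the graph whose vertices are the $n^2$ squares of the $n\times n$ chessboard, two distinct vertices being adjacent when their squares share a row, a column, or a diagonal (in either of the two diagonal directions, of any length). A dominating set of $Q_n$ is a set $D$ of squares such that every square is in $D$ or adjacent to a square of $D$. $\gamma(Q_n)$ denotes the minimum size of a dominating set of $Q_n$. *)

theory Defs
  imports "Graph_Theory.Pair_Digraph"
begin

(* Simple graphs are the finite, loop-free, symmetric digraphs of locale pair_graph. *)

definition squares :: "nat \<Rightarrow> (int \<times> int) set" where
  "squares n = {1..int n} \<times> {1..int n}"

definition queen_attacks :: "int \<times> int \<Rightarrow> int \<times> int \<Rightarrow> bool" where
  "queen_attacks s t \<longleftrightarrow>
     fst s = fst t \<or> snd s = snd t \<or>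
     fst s - snd s = fst t - snd t \<or> fst s + snd s = fst t + snd t"

definition queens_graph :: "nat \<Rightarrow> (int \<times> int) pair_pre_digraph" where
  "queens_graph n =
     \<lparr>pverts = squares n,
      parcs = {(s, t). s \<in> squares n \<and> t \<in> squares n \<and> s \<noteq> t \<and> queen_attacks s t}\<rparr>"

lemma queens_graph_is_graph: "pair_graph (queens_graph n)"
proof -
  have *: "finite (parcs (queens_graph n))"
    by (rule finite_subset[of _ "squares n \<times> squares n"])
      (auto simp: queens_graph_def squares_def)
  show ?thesis
    by (unfold_locales; (rule *)?)
      (auto simp: queens_graph_def squares_def queen_attacks_def symmetric_def arcs_ends_conv
        intro!: symI)
qed

definition dominating_set :: "'a pair_pre_digraph \<Rightarrow> 'a set \<Rightarrow> bool" where
  "dominating_set G D \<longleftrightarrow>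
     D \<subseteq> pverts G \<and> (\<forall>v\<in>pverts G. v \<in> D \<or> (\<exists>u\<in>D. (u, v) \<in> parcs G))"

(* Intended for finite graphs: card is 0 on infinite sets. *)
definition domination_number :: "'a pair_pre_digraph \<Rightarrow> nat" where
  "domination_number G = (LEAST k. \<exists>D. dominating_set G D \<and> card D = k)"

end

theory Submission
  imports Defs
begin

text \<open>Suppose that 81 queens cover the board. The outermost empty columns and rows bound a box.
Spencer's argument counts the squares of the two outermost empty columns, in as many consecutive
rows as these columns are apart: a queen covers two of these squares along its row and at most one
along each of its diagonals, and all rows beyond the box are occupied. For 81 queens on a
board of side 163 this count has no slack at all. Hence the box is a square, every
square on its perimeter is covered exactly once, every queen has both diagonals meeting the box,
and no line carries two queens. A colouring argument shows that the side is an even number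
\<open>2 * h\<close>, and counting the queens beyond the box gives \<open>61 \<le> h \<le> 81\<close>.

In coordinates centred at the box, four sets of integers keep all that is needed: the empty
rows \<open>Er\<close> and columns \<open>Ec\<close>, 82 of each, and the occupied diagonals \<open>D\<close> (values of \<open>y - x\<close>) and
\<open>S\<close> (values of \<open>y + x\<close>), 81 of each. The locale \<open>tight_box\<close> records them. On the right side every
empty row is covered by exactly one diagonal, which splits \<open>Er\<close> into \<open>RD\<close> and \<open>RS\<close>; the other
sides behave alike. The lever is \<open>edge_step\<close>: an empty column at distance \<open>a\<close> from the right side
and an empty row \<open>y\<close> meet in a square which only a diagonal can cover, and following that
diagonal to the right side gives \<open>y + a \<in> RD\<close> or \<open>y - a \<in> RS\<close>.

Take the smallest distance \<open>lam > 0\<close> from an empty line to a parallel side. Apart from the two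
maximal runs of step \<open>lam\<close> that start at the ends \<open>h\<close> and \<open>- h\<close>, the empty rows then fall into pairs
\<open>y \<in> RS\<close>, \<open>y + lam \<in> RD\<close> (\<open>rest_paired\<close>), and as 82 is even, all of \<open>h - lam\<close>, \<open>lam - h\<close> are empty rows and
columns (\<open>mirror_end\<close>). If some line at distance \<open>2 * lam\<close> is empty too, the two runs are everything
(\<open>rest_empty\<close>): \<open>lam\<close> is 1 or 3, or all odd lines of the whole board are empty. If there is none,
the remaining pairs form a single progression, and this fits in one way only, with step 3 and \<open>h = 61\<close>
(\<open>isolated_ends\<close>).

All three possibilities fail on the
parallelogram law \<open>(y - x)\<^sup>2 + (y + x)\<^sup>2 = 2 * (x\<^sup>2 + y\<^sup>2)\<close>: summed over the queens it determines the sum of the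
squares of \<open>D\<close> and \<open>S\<close> from \<open>Er\<close> and \<open>Ec\<close>, because the occupied rows and columns are the complements
of the empty ones. Where the lines form
progressions of step 1 or 3, the squares of the occupied diagonals are too small for that sum; for the odd
lines the two values differ modulo 324.

For the upper bound, 82 queens stand on squares with both coordinates odd, measured from the
centre, one in each odd row and odd column. A square with both coordinates even has \<open>y - x\<close> and
\<open>y + x\<close> congruent modulo 4, and as \<open>\<bar>y - x\<bar> + \<bar>y + x\<bar> \<le> 160\<close> one of its two diagonals is among the
central ones, all of which are occupied.\<close>

section \<open>Square boxes whose sides are covered without waste\<close>

lemma mem_uminus_image: "x \<in> uminus ` A \<longleftrightarrow> - x \<in> A" for x :: int
  by force

lemma card_uminus_image: "card (uminus ` A) = card A" for A :: "int set"
  by (simp add: card_image)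

lemma sum_uminus_image: "(\<Sum>y\<in>uminus ` A. y\<^sup>2) = (\<Sum>y\<in>A. y\<^sup>2)" for A :: "int set"
  by (simp add: sum.reindex)

text \<open>The trace that 81 covering queens leave on the box of the outermost empty lines, in coordinates
centred at the box, whose half side is \<open>h\<close>. The facts \<open>right\<close> to \<open>bottom\<close> say that a perimeter square is covered
exactly once: by an occupied line across the side, or else by one of its two diagonals. The
constant is \<open>721764 = 2 * 360882\<close>, where 360882 is the sum of the squares of 163 consecutive integers
centred at 0; for rows or columns that are not centred at 0 the sum is larger, and \<open>h = 81\<close> leaves no
freedom for the position of the box.\<close>

locale tight_box =
  fixes h :: int and Er Ec D S :: "int set"
  assumes h_ge: "61 \<le> h" and h_le: "h \<le> 81"
    and Er_bound: "y \<in> Er \<Longrightarrow> \<bar>y\<bar> \<le> h" and Ec_bound: "x \<in> Ec \<Longrightarrow> \<bar>x\<bar> \<le> h"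
    and Er_ends: "h \<in> Er" "- h \<in> Er" and Ec_ends: "h \<in> Ec" "- h \<in> Ec"
    and card_Er: "card Er = 82" and card_Ec: "card Ec = 82"
    and D_bound: "d \<in> D \<Longrightarrow> \<bar>d\<bar> \<le> 2 * h" and S_bound: "s \<in> S \<Longrightarrow> \<bar>s\<bar> \<le> 2 * h"
    and card_D: "card D = 81" and card_S: "card S = 81"
    and cover: "x \<in> Ec \<Longrightarrow> y \<in> Er \<Longrightarrow> y - x \<in> D \<or> y + x \<in> S"
    and right: "\<bar>y\<bar> \<le> h \<Longrightarrow> (y \<in> Er \<longleftrightarrow> y - h \<in> D \<or> y + h \<in> S) \<and> \<not> (y - h \<in> D \<and> y + h \<in> S)"
    and left: "\<bar>y\<bar> \<le> h \<Longrightarrow> (y \<in> Er \<longleftrightarrow> y + h \<in> D \<or> y - h \<in> S) \<and> \<not> (y + h \<in> D \<and> y - h \<in> S)"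
    and top: "\<bar>x\<bar> \<le> h \<Longrightarrow> (x \<in> Ec \<longleftrightarrow> h - x \<in> D \<or> h + x \<in> S) \<and> \<not> (h - x \<in> D \<and> h + x \<in> S)"
    and bottom: "\<bar>x\<bar> \<le> h \<Longrightarrow> (x \<in> Ec \<longleftrightarrow> - h - x \<in> D \<or> - h + x \<in> S) \<and> \<not> (- h - x \<in> D \<and> - h + x \<in> S)"
    and moment_ge: "(\<Sum>d\<in>D. d\<^sup>2) + (\<Sum>s\<in>S. s\<^sup>2) \<ge> 2 * (721764 - (\<Sum>y\<in>Er. y\<^sup>2) - (\<Sum>x\<in>Ec. x\<^sup>2))"
    and moment_eq: "h = 81 \<Longrightarrow> (\<Sum>d\<in>D. d\<^sup>2) + (\<Sum>s\<in>S. s\<^sup>2) = 2 * (721764 - (\<Sum>y\<in>Er. y\<^sup>2) - (\<Sum>x\<in>Ec. x\<^sup>2))"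
begin

text \<open>The symmetry group of the square acts on tight boxes. Reflections exchange the two kinds of
diagonals; the three generators below suffice to reduce every later case distinction to one side.\<close>

lemma transposed: "tight_box h Ec Er (uminus ` D) S"
proof
  fix y :: int assume y: "\<bar>y\<bar> \<le> h"
  show "(y \<in> Ec \<longleftrightarrow> y - h \<in> uminus ` D \<or> y + h \<in> S) \<and> \<not> (y - h \<in> uminus ` D \<and> y + h \<in> S)"
    using top[OF y] by (simp add: mem_uminus_image algebra_simps)
  show "(y \<in> Ec \<longleftrightarrow> y + h \<in> uminus ` D \<or> y - h \<in> S) \<and> \<not> (y + h \<in> uminus ` D \<and> y - h \<in> S)"
    using bottom[OF y] by (simp add: mem_uminus_image algebra_simps)
  show "(y \<in> Er \<longleftrightarrow> h - y \<in> uminus ` D \<or> h + y \<in> S) \<and> \<not> (h - y \<in> uminus ` D \<and> h + y \<in> S)"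
    using right[OF y] by (simp add: mem_uminus_image algebra_simps)
  show "(y \<in> Er \<longleftrightarrow> - h - y \<in> uminus ` D \<or> - h + y \<in> S) \<and> \<not> (- h - y \<in> uminus ` D \<and> - h + y \<in> S)"
    using left[OF y] by (simp add: mem_uminus_image algebra_simps)
next
  fix x y assume "x \<in> Er" "y \<in> Ec"
  then show "y - x \<in> uminus ` D \<or> y + x \<in> S"
    using cover[of y x] by (simp add: mem_uminus_image algebra_simps)
qed (use h_ge h_le Er_bound Ec_bound Er_ends Ec_ends card_Er card_Ec D_bound S_bound card_D card_S
      moment_ge moment_eq in
      \<open>auto simp: card_uminus_image sum_uminus_image\<close>)

lemma reflected: "tight_box h Er (uminus ` Ec) S D"
proof
  fix y :: int assume y: "\<bar>y\<bar> \<le> h"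
  have y': "\<bar>- y\<bar> \<le> h" using y by simp
  show "(y \<in> Er \<longleftrightarrow> y - h \<in> S \<or> y + h \<in> D) \<and> \<not> (y - h \<in> S \<and> y + h \<in> D)"
    using left[OF y] by blast
  show "(y \<in> Er \<longleftrightarrow> y + h \<in> S \<or> y - h \<in> D) \<and> \<not> (y + h \<in> S \<and> y - h \<in> D)"
    using right[OF y] by blast
  show "(y \<in> uminus ` Ec \<longleftrightarrow> h - y \<in> S \<or> h + y \<in> D) \<and> \<not> (h - y \<in> S \<and> h + y \<in> D)"
    using top[OF y'] by (auto simp add: mem_uminus_image algebra_simps)
  show "(y \<in> uminus ` Ec \<longleftrightarrow> - h - y \<in> S \<or> - h + y \<in> D) \<and> \<not> (- h - y \<in> S \<and> - h + y \<in> D)"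
    using bottom[OF y'] by (auto simp add: mem_uminus_image algebra_simps)
next
  fix x y assume "x \<in> uminus ` Ec" "y \<in> Er"
  then show "y - x \<in> S \<or> y + x \<in> D"
    using cover[of "- x" y] by (auto simp add: mem_uminus_image algebra_simps)
next
  fix x assume "x \<in> uminus ` Ec"
  then show "\<bar>x\<bar> \<le> h" using Ec_bound[of "- x"] by (simp add: mem_uminus_image)
qed (use h_ge h_le Er_bound Er_ends Ec_ends card_Er card_Ec D_bound S_bound card_D card_S
      moment_ge moment_eq in
      \<open>auto simp: card_uminus_image sum_uminus_image mem_uminus_image\<close>)

lemma flipped: "tight_box h (uminus ` Er) Ec (uminus ` S) (uminus ` D)"
proof -
  interpret t: tight_box h Ec Er "uminus ` D" S by (rule transposed)
  interpret r: tight_box h Ec "uminus ` Er" S "uminus ` D" by (rule t.reflected)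
  show ?thesis by (rule r.transposed)
qed

lemma finite_Er: "finite Er" and finite_D: "finite D" and finite_S: "finite S"
  using card_Er card_D card_S card.infinite by fastforce+

text \<open>The rows in which the right side is covered by a difference diagonal, or by a sum diagonal.\<close>

definition RD where "RD = {y. \<bar>y\<bar> \<le> h \<and> y - h \<in> D}"
definition RS where "RS = {y. \<bar>y\<bar> \<le> h \<and> y + h \<in> S}"

lemma Er_split: "Er = RD \<union> RS" and RD_RS_disjoint: "RD \<inter> RS = {}"
  using right Er_bound unfolding RD_def RS_def by auto

lemma minus_RD_in_Ec: "y \<in> RD \<Longrightarrow> - y \<in> Ec"
  using bottom[of "- y"] by (auto simp: RD_def)

lemma RS_in_Ec: "y \<in> RS \<Longrightarrow> y \<in> Ec"
  using top[of y] by (auto simp: RS_def algebra_simps)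

lemma card_RD_RS: "card RD + card RS = 82"
  using card_Un_disjoint[of RD RS] Er_split RD_RS_disjoint card_Er finite_Er by auto

text \<open>Each of the 82 empty rows takes a diagonal at both vertical sides. A diagonal meets the two sides
together once, except that the two main diagonals meet both; 164 meetings from 162 diagonals are
possible only if both main diagonals are occupied.\<close>

lemma zero_in_D: "0 \<in> D" and zero_in_S: "0 \<in> S"
proof -
  interpret l: tight_box h Er "uminus ` Ec" S D by (rule reflected)
  have split: "card A + of_bool (0 \<in> A) \<ge> card {y. \<bar>y\<bar> \<le> h \<and> y - h \<in> A} + card {y. \<bar>y\<bar> \<le> h \<and> y + h \<in> A}"
    if A: "\<And>d. d \<in> A \<Longrightarrow> \<bar>d\<bar> \<le> 2 * h" "finite A" for A
  proof -
    define X where "X = {y. \<bar>y\<bar> \<le> h \<and> y - h \<in> A}"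
    define Y where "Y = {y. \<bar>y\<bar> \<le> h \<and> y + h \<in> A}"
    define P where "P = (\<lambda>y. y - h) ` X"
    define Q where "Q = (\<lambda>y. y + h) ` Y"
    have PA: "P \<subseteq> A" and QA: "Q \<subseteq> A" by (auto simp: P_def Q_def X_def Y_def)
    then have f: "finite P" "finite Q" using A(2) finite_subset by blast+
    have sub: "P \<inter> Q \<subseteq> {0}" by (auto simp: P_def Q_def X_def Y_def)
    then have none: "P \<inter> Q = {}" if "0 \<notin> A" using PA that by blast
    have "card (P \<inter> Q) \<le> of_bool (0 \<in> A)"
    proof (cases "0 \<in> A")
      case True
      then show ?thesis using card_mono[OF _ sub] by simp
    qed (simp add: none)
    moreover have "card (P \<union> Q) \<le> card A" using PA QA A(2) by (intro card_mono) auto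
    moreover have "card P + card Q = card (P \<union> Q) + card (P \<inter> Q)"
      using f by (rule card_Un_Int)
    moreover have "card P = card X" "card Q = card Y"
      unfolding P_def Q_def by (simp_all add: card_image)
    ultimately have "card X + card Y \<le> card A + of_bool (0 \<in> A)" by linarith
    then show ?thesis by (simp only: X_def Y_def)
  qed
  have "card D + of_bool (0 \<in> D) \<ge> card RD + card l.RS"
    using split[OF D_bound finite_D] by (simp add: RD_def l.RS_def)
  moreover have "card S + of_bool (0 \<in> S) \<ge> card l.RD + card RS"
    using split[OF S_bound finite_S] by (simp add: RS_def l.RD_def)
  ultimately have "of_bool (0 \<in> D) + of_bool (0 \<in> S) \<ge> (2::nat)"
    using card_RD_RS l.card_RD_RS card_D card_S by linarith
  then show "0 \<in> D" "0 \<in> S" by (auto simp: of_bool_def split: if_splits)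
qed

lemma h_in_RD: "h \<in> RD" and minus_h_in_RS: "- h \<in> RS"
  using zero_in_D zero_in_S h_ge by (auto simp: RD_def RS_def)

text \<open>The square in column \<open>h - a\<close> and row \<open>y\<close> lies on the diagonals through the squares of the right side in rows
\<open>y + a\<close> and \<open>y - a\<close>. The condition on \<open>y\<close> keeps these within the side.\<close>

lemma edge_step:
  assumes "h - a \<in> Ec" "y \<in> Er" "0 \<le> a" "\<bar>y\<bar> + a \<le> h"
  shows "y + a \<in> RD \<or> y - a \<in> RS"
  using cover[OF assms(1,2)] assms(3,4) by (auto simp: RD_def RS_def algebra_simps)

text \<open>\<open>Er\<close> and \<open>Ec\<close> contain equally many elements of \<open>{t, - t}\<close>: the eight perimeter squares at distance \<open>\<bar>t\<bar>\<close> from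
the midpoints of the sides are joined by the same diagonals.\<close>

lemma reflection_pairs:
  assumes "\<bar>t\<bar> \<le> h"
  shows "t \<in> Ec \<Longrightarrow> t \<in> Er \<or> - t \<in> Er"
    and "t \<in> Ec \<Longrightarrow> - t \<in> Ec \<Longrightarrow> t \<in> Er \<and> - t \<in> Er"
    and "t \<in> Er \<Longrightarrow> t \<in> Ec \<or> - t \<in> Ec"
    and "t \<in> Er \<Longrightarrow> - t \<in> Er \<Longrightarrow> t \<in> Ec \<and> - t \<in> Ec"
proof -
  have t': "\<bar>- t\<bar> \<le> h" using assms by simp
  note * = right[OF assms] right[OF t'] left[OF assms] left[OF t'] top[OF assms] top[OF t']
    bottom[OF assms] bottom[OF t']
  have n: "h + t = t + h" "- t + h = h - t" "- t - h = - h - t" "- h + t = t - h"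
     "h - - t = t + h" "- h - - t = t - h" "h + - t = h - t" "- h + - t = - h - t" by auto
  show "t \<in> Ec \<Longrightarrow> t \<in> Er \<or> - t \<in> Er"
    and "t \<in> Ec \<Longrightarrow> - t \<in> Ec \<Longrightarrow> t \<in> Er \<and> - t \<in> Er"
    and "t \<in> Er \<Longrightarrow> t \<in> Ec \<or> - t \<in> Ec"
    and "t \<in> Er \<Longrightarrow> - t \<in> Er \<Longrightarrow> t \<in> Ec \<and> - t \<in> Ec"
    using * unfolding n by argo+
qed

text \<open>Every diagonal of the box ends on a vertical side, and an occupied one ends there in an empty row.\<close>

lemma diagonal_meets_Er:
  shows "d \<in> D \<Longrightarrow> h - \<bar>d\<bar> \<in> Er \<or> \<bar>d\<bar> - h \<in> Er"
    and "s \<in> S \<Longrightarrow> h - \<bar>s\<bar> \<in> Er \<or> \<bar>s\<bar> - h \<in> Er"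
proof -
  show "d \<in> D \<Longrightarrow> h - \<bar>d\<bar> \<in> Er \<or> \<bar>d\<bar> - h \<in> Er"
    using D_bound[of d] right[of "d + h"] left[of "d - h"]
    by (cases "0 \<le> d") (simp_all add: algebra_simps)
  show "s \<in> S \<Longrightarrow> h - \<bar>s\<bar> \<in> Er \<or> \<bar>s\<bar> - h \<in> Er"
    using S_bound[of s] right[of "s - h"] left[of "s + h"]
    by (cases "0 \<le> s") (simp_all add: algebra_simps)
qed

end

section \<open>Empty rows at the distance of the smallest gap\<close>

text \<open>The maximal progressions with difference \<open>lam\<close> in \<open>E\<close> starting at the ends \<open>h\<close> and \<open>- h\<close>.\<close>

definition top_run :: "int \<Rightarrow> int \<Rightarrow> int set \<Rightarrow> int set" where
  "top_run h lam E = {y. \<exists>i::nat. y = h - lam * int i \<and> (\<forall>j\<le>i. h - lam * int j \<in> E)}"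

definition bot_run :: "int \<Rightarrow> int \<Rightarrow> int set \<Rightarrow> int set" where
  "bot_run h lam E = {y. \<exists>i::nat. y = - h + lam * int i \<and> (\<forall>j\<le>i. - h + lam * int j \<in> E)}"

definition height :: "int \<Rightarrow> int set \<Rightarrow> int \<Rightarrow> nat" where
  "height lam E y = (LEAST k. y + lam * (int k + 1) \<notin> E)"

lemma top_run_closed:
  assumes "y + lam \<in> top_run h lam E" "y \<in> E"
  shows "y \<in> top_run h lam E"
proof -
  from assms(1) obtain i :: nat where i: "y + lam = h - lam * int i" "\<forall>j\<le>i. h - lam * int j \<in> E"
    by (auto simp: top_run_def)
  have "y = h - lam * int (Suc i)" using i(1) by (simp add: algebra_simps)
  moreover have "\<forall>j\<le>Suc i. h - lam * int j \<in> E"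
    using i(2) assms(2) calculation by (auto simp: le_Suc_eq)
  ultimately show ?thesis unfolding top_run_def by blast
qed

lemma top_run_up:
  assumes "y \<in> top_run h lam E" "y \<noteq> h"
  shows "y + lam \<in> top_run h lam E"
proof -
  from assms(1) obtain i :: nat where i: "y = h - lam * int i" "\<forall>j\<le>i. h - lam * int j \<in> E"
    by (auto simp: top_run_def)
  then obtain k where k: "i = Suc k" using assms(2) by (cases i) auto
  then have "y + lam = h - lam * int k" "\<forall>j\<le>k. h - lam * int j \<in> E"
    using i by (auto simp: algebra_simps)
  then show ?thesis unfolding top_run_def by blast
qed

lemma mem_bot_run: "y \<in> bot_run h lam E \<longleftrightarrow> - y \<in> top_run h lam (uminus ` E)"
proof -
  have eq: "y = - h + lam * int i \<longleftrightarrow> - y = h - lam * int i" for i by linarith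
  have neg: "- h + lam * int j \<in> E \<longleftrightarrow> h - lam * int j \<in> uminus ` E" for j
    by (simp add: mem_uminus_image)
  show ?thesis unfolding bot_run_def top_run_def mem_Collect_eq eq neg ..
qed

lemma bot_run_closed:
  assumes "y - lam \<in> bot_run h lam E" "y \<in> E"
  shows "y \<in> bot_run h lam E"
  using top_run_closed[of "- y" lam h "uminus ` E"] assms by (simp add: mem_bot_run mem_uminus_image)

lemma bot_run_down:
  assumes "y \<in> bot_run h lam E" "y \<noteq> - h"
  shows "y - lam \<in> bot_run h lam E"
  using top_run_up[of "- y" h lam "uminus ` E"] assms by (simp add: mem_bot_run)

lemma top_run_sub: "top_run h lam E \<subseteq> E" and bot_run_sub: "bot_run h lam E \<subseteq> E"
  by (auto simp: top_run_def bot_run_def)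

lemma h_in_top_run: "h \<in> E \<Longrightarrow> h \<in> top_run h lam E"
  and minus_h_in_bot_run: "- h \<in> E \<Longrightarrow> - h \<in> bot_run h lam E"
  unfolding top_run_def bot_run_def by (auto intro: exI[of _ 0])

text \<open>\<open>lam\<close> is the distance from the right side to an empty column, and no inner empty row is closer to its
end of the side. Under this condition \<open>edge_step\<close> with \<open>a = lam\<close> applies to all inner empty rows.\<close>

locale side_gap = tight_box +
  fixes lam :: int
  assumes lam_pos: "0 < lam"
    and gap_Er: "y \<in> Er \<Longrightarrow> \<bar>y\<bar> < h \<Longrightarrow> \<bar>y\<bar> \<le> h - lam"
    and lam_Ec: "h - lam \<in> Ec"
begin

abbreviation "T \<equiv> top_run h lam Er"
abbreviation "B \<equiv> bot_run h lam Er"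
abbreviation "ht \<equiv> height lam Er"
definition "rest = Er - T - B"

lemma lam_step:
  assumes "y \<in> Er" "\<bar>y\<bar> < h"
  shows "y + lam \<in> RD \<or> y - lam \<in> RS"
  using edge_step[OF lam_Ec assms(1)] gap_Er[OF assms] lam_pos by auto

text \<open>A progression of empty rows that starts at \<open>l\<close> with nothing below alternates: each odd step is
forced into \<open>RD\<close>, hence out of \<open>RS\<close>, which forces the next odd step.\<close>

lemma climbing_run_in_RD:
  assumes "l - lam \<notin> RS" "\<And>j. j \<le> 2 * i \<Longrightarrow> l + lam * int j \<in> Er \<and> \<bar>l + lam * int j\<bar> < h"
  shows "l + lam * int (2 * i + 1) \<in> RD"
  using assms(2)
proof (induction i)
  case 0
  then show ?case using lam_step[of l] assms(1) by auto
next
  case (Suc i)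
  have "l + lam * int (2 * i + 1) \<in> RD" using Suc by auto
  then have "l + lam * int (2 * i + 1) \<notin> RS" using RD_RS_disjoint by blast
  moreover have "l + lam * int (2 * i + 2) \<in> Er \<and> \<bar>l + lam * int (2 * i + 2)\<bar> < h"
    using Suc.prems[of "2 * i + 2"] by auto
  ultimately show ?case using lam_step[of "l + lam * int (2 * i + 2)"]
    by (auto simp: algebra_simps)
qed

lemma descending_run_in_RS:
  assumes "r + lam \<notin> RD" "\<And>j. j \<le> 2 * i \<Longrightarrow> r - lam * int j \<in> Er \<and> \<bar>r - lam * int j\<bar> < h"
  shows "r - lam * int (2 * i + 1) \<in> RS"
  using assms(2)
proof (induction i)
  case 0
  then show ?case using lam_step[of r] assms(1) by auto
next
  case (Suc i)
  have "r - lam * int (2 * i + 1) \<in> RS" using Suc by auto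
  then have "r - lam * int (2 * i + 1) \<notin> RD" using RD_RS_disjoint by blast
  moreover have "r - lam * int (2 * i + 2) \<in> Er \<and> \<bar>r - lam * int (2 * i + 2)\<bar> < h"
    using Suc.prems[of "2 * i + 2"] by auto
  ultimately show ?case using lam_step[of "r - lam * int (2 * i + 2)"]
    by (auto simp: algebra_simps)
qed

lemma leaves_Er: "\<exists>k::nat. y + lam * (int k + 1) \<notin> Er" "\<exists>k::nat. y - lam * (int k + 1) \<notin> Er"
proof -
  have grow: "int k + 1 \<le> lam * (int k + 1)" for k
    using lam_pos mult_right_mono[of 1 lam "int k + 1"] by simp
  have outside: "z \<notin> Er" if "h < \<bar>z\<bar>" for z using Er_bound[of z] that by auto
  have "h < \<bar>y + lam * (int (nat (h - y)) + 1)\<bar>" using grow[of "nat (h - y)"] by linarith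
  then show "\<exists>k::nat. y + lam * (int k + 1) \<notin> Er" using outside by blast
  have "h < \<bar>y - lam * (int (nat (h + y)) + 1)\<bar>" using grow[of "nat (h + y)"] by linarith
  then show "\<exists>k::nat. y - lam * (int k + 1) \<notin> Er" using outside by blast
qed

lemma height_props:
  assumes "y \<in> Er"
  shows "y + lam * (int (ht y) + 1) \<notin> Er" and "j \<le> ht y \<Longrightarrow> y + lam * int j \<in> Er"
proof -
  show "y + lam * (int (ht y) + 1) \<notin> Er"
    unfolding height_def by (rule LeastI_ex[OF leaves_Er(1)])
  show "y + lam * int j \<in> Er" if "j \<le> ht y"
  proof (cases j)
    case (Suc i)
    then have "i < ht y" using that by simp
    from not_less_Least[OF this[unfolded height_def]] show ?thesis using Suc by (simp add: algebra_simps)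
  qed (use assms in simp)
qed

lemma rest_up:
  assumes "y \<in> rest" "y + lam \<in> Er"
  shows "y + lam \<in> rest"
proof -
  have "y + lam \<noteq> - h" using Er_bound[of y] assms(1) lam_pos by (auto simp: rest_def)
  then show ?thesis
    using assms top_run_closed[of y lam h Er] bot_run_down[of "y + lam" h lam Er]
    by (auto simp: rest_def)
qed

lemma rest_down:
  assumes "y \<in> rest" "y - lam \<in> Er"
  shows "y - lam \<in> rest"
proof -
  have "y - lam \<noteq> h" using Er_bound[of y] assms(1) lam_pos by (auto simp: rest_def)
  then show ?thesis
    using assms bot_run_closed[of y lam h Er] top_run_up[of "y - lam" h lam Er]
    by (auto simp: rest_def)
qed

text \<open>A maximal progression of step \<open>lam\<close> that avoids both ends of the side is subject to the alternation from its
bottom and from its top. If it had an odd number of elements, the alternation from the top would leave the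
progression at its bottom; so its length is even and it is made of pairs \<open>y \<in> RS\<close>, \<open>y + lam \<in> RD\<close>.\<close>

lemma rest_paired:
  assumes "y \<in> rest"
  shows "odd (ht y) \<Longrightarrow> y \<in> RS \<and> y + lam \<in> RD \<and> y + lam \<in> rest"
    and "even (ht y) \<Longrightarrow> y \<in> RD \<and> y - lam \<in> RS \<and> y - lam \<in> rest"
proof -
  have y: "y \<in> Er" "y \<notin> T" "y \<notin> B" using assms by (auto simp: rest_def)
  define k where "k = ht y"
  \<comment> \<open>The progression through y extends k steps upwards and m steps downwards.\<close>
  define m where "m = (LEAST m. y - lam * (int m + 1) \<notin> Er)"
  have up: "y + lam * int j \<in> Er" if "j \<le> k" for j using height_props(2)[OF y(1)] that by (simp add: k_def)
  have down: "y - lam * int j \<in> Er" if "j \<le> m" for j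
  proof (cases j)
    case (Suc i)
    then have "i < m" using that by simp
    from not_less_Least[OF this[unfolded m_def]] show ?thesis using Suc by (simp add: algebra_simps)
  qed (use y in simp)
  have top: "y + lam * (int k + 1) \<notin> Er" using height_props(1)[OF y(1)] by (simp add: k_def)
  have bot: "y - lam * (int m + 1) \<notin> Er"
    unfolding m_def by (rule LeastI_ex[OF leaves_Er(2)])
  have "y \<noteq> - h" "y \<noteq> h" using y minus_h_in_bot_run[OF Er_ends(2)] h_in_top_run[OF Er_ends(1)] by auto
  have yh: "\<bar>y\<bar> < h" using Er_bound[OF y(1)] \<open>y \<noteq> h\<close> \<open>y \<noteq> - h\<close> by auto
  have up_h: "y + lam * int j \<noteq> h" if "j \<le> k" for j
  proof
    assume eq: "y + lam * int j = h"
    have "h - lam * int i \<in> Er" if "i \<le> j" for i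
    proof -
      have "h - lam * int i = y + lam * int (j - i)"
        using eq that by (simp add: of_nat_diff algebra_simps)
      then show ?thesis using up[of "j - i"] \<open>j \<le> k\<close> by simp
    qed
    then have "y \<in> T" unfolding top_run_def using eq by (auto intro!: exI[of _ j] simp: algebra_simps)
    then show False using y by blast
  qed
  have down_h: "y - lam * int j \<noteq> - h" if "j \<le> m" for j
  proof
    assume eq: "y - lam * int j = - h"
    have "- h + lam * int i \<in> Er" if "i \<le> j" for i
    proof -
      have "- h + lam * int i = y - lam * int (j - i)"
        using eq that by (simp add: of_nat_diff algebra_simps)
      then show ?thesis using down[of "j - i"] \<open>j \<le> m\<close> by simp
    qed
    then have "y \<in> B" unfolding bot_run_def using eq by (auto intro!: exI[of _ j] simp: algebra_simps)
    then show False using y by blast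
  qed
  have nn: "0 \<le> lam * int j" for j using lam_pos by simp
  have up_in: "y + lam * int j \<in> Er \<and> \<bar>y + lam * int j\<bar> < h" if "j \<le> k" for j
    using Er_bound[OF up[OF that]] up[OF that] up_h[OF that] yh nn[of j] by auto
  have down_in: "y - lam * int j \<in> Er \<and> \<bar>y - lam * int j\<bar> < h" if "j \<le> m" for j
    using Er_bound[OF down[OF that]] down[OF that] down_h[OF that] yh nn[of j] by auto
  define r where "r = y + lam * int k"
  define l where "l = y - lam * int m"
  have from_r: "r - lam * int j \<in> Er \<and> \<bar>r - lam * int j\<bar> < h" if "j \<le> k + m" for j
  proof (cases "j \<le> k")
    case True
    then show ?thesis using up_in[of "k - j"] by (simp add: r_def of_nat_diff algebra_simps)
  next
    case False
    then show ?thesis using down_in[of "j - k"] that by (simp add: r_def of_nat_diff algebra_simps)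
  qed
  have from_l: "l + lam * int j \<in> Er \<and> \<bar>l + lam * int j\<bar> < h" if "j \<le> k + m" for j
    using from_r[of "k + m - j"] that by (simp add: r_def l_def of_nat_diff algebra_simps)
  have sub: "RD \<subseteq> Er" "RS \<subseteq> Er" using Er_split by auto
  have r_top: "r + lam \<notin> RD" using top sub by (auto simp: r_def algebra_simps)
  have l_bot: "l - lam \<notin> RS" using bot sub by (auto simp: l_def algebra_simps)
  have rs: "r - lam * int (2 * i + 1) \<in> RS" if "2 * i \<le> k + m" for i
    by (rule descending_run_in_RS[OF r_top]) (use from_r that in auto)
  have rd: "l + lam * int (2 * i + 1) \<in> RD" if "2 * i \<le> k + m" for i
    by (rule climbing_run_in_RD[OF l_bot]) (use from_l that in auto)
  have odd: "odd (k + m)"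
  proof (rule ccontr)
    assume "\<not> odd (k + m)"
    then have "even (k + m)" by simp
    then obtain i where "k + m = 2 * i" by (rule evenE)
    then have e: "int (2 * i + 1) = int k + int m + 1" by simp
    have "r - lam * int (2 * i + 1) = y - lam * (int m + 1)"
      unfolding r_def e by (simp add: algebra_simps)
    then have "y - lam * (int m + 1) \<in> RS" using rs[of i] \<open>k + m = 2 * i\<close> by simp
    then show False using bot sub by blast
  qed
  show "y \<in> RS \<and> y + lam \<in> RD \<and> y + lam \<in> rest" if "odd (ht y)"
  proof -
    from that obtain i where i: "k = 2 * i + 1" by (auto simp: k_def elim: oddE)
    have "y \<in> RS" using rs[of i] i by (simp add: r_def algebra_simps)
    have "even m" using odd i by simp
    then obtain i' where "m = 2 * i'" by (auto elim: evenE)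
    then have "y + lam \<in> RD" using rd[of i'] by (simp add: l_def algebra_simps)
    then show ?thesis using \<open>y \<in> RS\<close> rest_up[OF assms] sub by blast
  qed
  show "y \<in> RD \<and> y - lam \<in> RS \<and> y - lam \<in> rest" if "even (ht y)"
  proof -
    from that obtain i where i: "k = 2 * i" by (auto simp: k_def elim: evenE)
    have "y - lam \<in> RS" using rs[of i] i by (simp add: r_def algebra_simps)
    have "odd m" using odd i by simp
    then obtain i' where "m = 2 * i' + 1" by (auto elim: oddE)
    then have "y \<in> RD" using rd[of i'] by (simp add: l_def algebra_simps)
    then show ?thesis using \<open>y - lam \<in> RS\<close> rest_down[OF assms] sub by blast
  qed
qed

lemma rest_card: "card rest = 2 * card (rest \<inter> RS)"
proof -
  have RS: "y + lam \<in> rest \<inter> RD" if "y \<in> rest \<inter> RS" for y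
    using rest_paired[of y] that RD_RS_disjoint by blast
  have RD: "y - lam \<in> rest \<inter> RS" if "y \<in> rest \<inter> RD" for y
    using rest_paired[of y] that RD_RS_disjoint by blast
  have eq: "rest \<inter> RD = (\<lambda>y. y + lam) ` (rest \<inter> RS)"
    using RS RD by (force intro: rev_image_eqI)
  have "finite rest" using finite_Er by (simp add: rest_def)
  moreover have "rest \<subseteq> RD \<union> RS" using Er_split unfolding rest_def by blast
  then have "rest = (rest \<inter> RS) \<union> (rest \<inter> RD)" by blast
  moreover have "(rest \<inter> RS) \<inter> (rest \<inter> RD) = {}" using RD_RS_disjoint by blast
  ultimately have "card rest = card (rest \<inter> RS) + card (rest \<inter> RD)"
    by (metis card_Un_disjoint finite_Int)
  moreover have "card (rest \<inter> RD) = card (rest \<inter> RS)"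
    unfolding eq by (intro card_image) simp
  ultimately show "card rest = 2 * card (rest \<inter> RS)" by simp
qed

lemma top_run_image:
  obtains n :: nat where "T = (\<lambda>i. h - lam * int i) ` {..<n}" "h - lam * int n \<notin> Er" "card T = n"
proof -
  obtain k where "h - lam * (int k + 1) \<notin> Er" using leaves_Er(2) by blast
  then have "\<exists>n. h - lam * int n \<notin> Er" by (intro exI[of _ "Suc k"]) (simp add: algebra_simps)
  define n where "n = (LEAST n. h - lam * int n \<notin> Er)"
  have n: "h - lam * int n \<notin> Er" unfolding n_def by (rule LeastI_ex) fact
  have n_min: "h - lam * int j \<in> Er" if "j < n" for j
    using not_less_Least[OF that[unfolded n_def]] by simp
  have "i < n" if "\<forall>j\<le>i. h - lam * int j \<in> Er" for i using that n by (meson not_less)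
  then have T_eq: "T = (\<lambda>i. h - lam * int i) ` {..<n}"
    unfolding top_run_def using n_min by (auto intro!: exI)
  have "card T = n"
    unfolding T_eq using lam_pos by (subst card_image) (auto simp: inj_on_def)
  with T_eq n show thesis by (rule that)
qed

text \<open>If \<open>- (h - lam)\<close> were not empty, the run at the bottom would be \<open>{- h}\<close> alone. The row \<open>h - lam\<close> cannot be in
\<open>RD\<close>, since then both \<open>h - lam\<close> and its negative would be empty columns, hence empty rows.
The alternation along the top run therefore has the parity that makes its length even, and with the paired
rest the number of empty rows becomes odd, although it is 82.\<close>

lemma mirror_end:
  assumes top: "h - lam \<in> Er"
  shows "- (h - lam) \<in> Er"
proof (rule ccontr)
  assume no: "\<not> ?thesis"
  have hl: "\<bar>h - lam\<bar> \<le> h" using Er_bound[OF top] .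
  have "h - lam \<notin> RD"
    using minus_RD_in_Ec[of "h - lam"] reflection_pairs(2)[OF hl lam_Ec] no by blast
  obtain n where T_eq: "T = (\<lambda>i. h - lam * int i) ` {..<n}"
    and n: "h - lam * int n \<notin> Er" and card_T: "card T = n"
    by (rule top_run_image)
  have n_min: "h - lam * int j \<in> Er" if "j < n" for j
    using top_run_sub[of h lam Er] that unfolding T_eq by auto
  have n2: "2 \<le> n"
  proof -
    have "n \<noteq> 0" using n Er_ends(1) by (metis diff_zero mult_zero_right of_nat_0)
    moreover have "n \<noteq> 1" using n top by (metis mult_cancel_left1 of_nat_1)
    ultimately show ?thesis by simp
  qed
  have B_eq: "B = {- h}"
  proof -
    have "y = - h" if "y \<in> B" for y
    proof -
      from that obtain i :: nat where i: "y = - h + lam * int i" "\<forall>j\<le>i. - h + lam * int j \<in> Er"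
        by (auto simp: bot_run_def)
      have "i = 0"
      proof (rule ccontr)
        assume "i \<noteq> 0"
        then have "- h + lam \<in> Er" using i(2)[rule_format, of 1] by simp
        then show False using no by (simp add: algebra_simps)
      qed
      then show ?thesis using i by simp
    qed
    then show ?thesis using minus_h_in_bot_run[OF Er_ends(2)] by blast
  qed
  have mh: "h - lam * int j \<noteq> - h" if "j < n" for j
  proof
    assume eq: "h - lam * int j = - h"
    have "j \<noteq> 0"
    proof
      assume "j = 0"
      then show False using eq h_ge by simp
    qed
    then have "h - lam * int (j - 1) = - (h - lam)" using eq by (simp add: of_nat_diff algebra_simps)
    then show False using n_min[of "j - 1"] that no by (metis less_imp_diff_less)
  qed
  then have "T \<inter> B = {}" unfolding B_eq T_eq by auto
  have "even n"
  proof (rule ccontr)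
    assume "\<not> even n"
    then have "\<exists>i. n = 2 * i + 3" using n2 by presburger
    then obtain i where i: "n = 2 * i + 3" ..
    define l where "l = h - lam * (int n - 1)"
    have "l + lam * int (2 * i + 1) \<in> RD"
    proof (rule climbing_run_in_RD)
      show "l - lam \<notin> RS" using n Er_split by (auto simp: l_def algebra_simps)
      fix j assume "j \<le> 2 * i"
      define q where "q = n - 1 - j"
      have q: "q < n" "q \<noteq> 0" "l + lam * int j = h - lam * int q"
        using i \<open>j \<le> 2 * i\<close> by (auto simp: l_def q_def of_nat_diff algebra_simps)
      have "0 < lam * int q" using q(2) lam_pos by simp
      then have "\<bar>h - lam * int q\<bar> < h"
        using mh[OF q(1)] Er_bound[OF n_min[OF q(1)]] by linarith
      then show "l + lam * int j \<in> Er \<and> \<bar>l + lam * int j\<bar> < h"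
        using n_min[OF q(1)] unfolding q(3) by simp
    qed
    then show False using \<open>h - lam \<notin> RD\<close> i by (simp add: l_def algebra_simps)
  qed
  moreover have "card Er = card T + card B + card rest"
  proof -
    have "Er = T \<union> B \<union> rest"
      using top_run_sub[of h lam Er] bot_run_sub[of h lam Er] by (auto simp: rest_def)
    moreover have "(T \<union> B) \<inter> rest = {}" by (auto simp: rest_def)
    moreover have "finite T" "finite B" "finite rest"
      using finite_Er by (auto simp: T_eq B_eq rest_def)
    ultimately show ?thesis using \<open>T \<inter> B = {}\<close>
      by (metis card_Un_disjoint finite_Un)
  qed
  ultimately have "even n \<and> 82 = n + 1 + 2 * card (rest \<inter> RS)"
    using card_T B_eq rest_card card_Er by simp
  then show False by presburger
qed

lemma rest_inner: "y \<in> rest \<Longrightarrow> \<bar>y\<bar> < h"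
  using Er_bound[of y] h_in_top_run[OF Er_ends(1), of lam] minus_h_in_bot_run[of h Er lam] Er_ends(2)
  by (cases "y = h"; cases "y = - h") (auto simp: rest_def)

text \<open>The top pair of a progression; the row two steps below its upper member belongs to the next pair and hence to
\<open>RD\<close>, if it is empty at all.\<close>

lemma rest_top:
  assumes "y \<in> rest" "y + lam \<notin> Er"
  shows "y \<in> RD \<and> y - lam \<in> RS \<and> y - lam \<in> rest \<and> y - 2 * lam \<notin> RS"
proof -
  have "even (ht y)"
    using rest_paired(1)[OF assms(1)] assms(2) Er_split by blast
  then have *: "y \<in> RD \<and> y - lam \<in> RS \<and> y - lam \<in> rest" by (rule rest_paired(2)[OF assms(1)])
  moreover have "y - 2 * lam \<notin> RS"
  proof
    assume rs: "y - 2 * lam \<in> RS"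
    then have "y - lam - lam \<in> rest"
      using rest_down[of "y - lam"] * Er_split by (simp add: algebra_simps)
    then have "y - 2 * lam \<in> rest" by (simp add: algebra_simps)
    from rest_paired[OF this] rs RD_RS_disjoint have "y - 2 * lam + lam \<in> RD" by blast
    then show False using * RD_RS_disjoint by (auto simp: algebra_simps)
  qed
  ultimately show ?thesis by blast
qed

end

section \<open>Both pairs of sides have the same smallest gap\<close>

text \<open>The smallest gap occurs at all eight places where it can occur, so that everything proved for rows
also holds for columns and after reflections.\<close>

locale gap_box = tight_box +
  fixes lam :: int
  assumes lam_pos: "0 < lam" and lam_le: "lam \<le> h"
    and gap_r: "y \<in> Er \<Longrightarrow> \<bar>y\<bar> < h \<Longrightarrow> \<bar>y\<bar> \<le> h - lam"
    and gap_c: "x \<in> Ec \<Longrightarrow> \<bar>x\<bar> < h \<Longrightarrow> \<bar>x\<bar> \<le> h - lam"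
    and lam_r: "h - lam \<in> Er" "- (h - lam) \<in> Er"
    and lam_c: "h - lam \<in> Ec" "- (h - lam) \<in> Ec"

sublocale gap_box \<subseteq> side_gap
  by unfold_locales (use lam_pos gap_r lam_c in auto)

context gap_box
begin

lemma gap_transposed: "gap_box h Ec Er (uminus ` D) S lam"
proof -
  interpret t: tight_box h Ec Er "uminus ` D" S by (rule transposed)
  show ?thesis by unfold_locales (use lam_pos lam_le gap_r gap_c lam_r lam_c in auto)
qed

lemma gap_reflected: "gap_box h Er (uminus ` Ec) S D lam"
proof -
  interpret t: tight_box h Er "uminus ` Ec" S D by (rule reflected)
  show ?thesis
  proof unfold_locales
    fix x assume "x \<in> uminus ` Ec" "\<bar>x\<bar> < h"
    then show "\<bar>x\<bar> \<le> h - lam" using gap_c[of "- x"] by (simp add: mem_uminus_image)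
  qed (use lam_pos lam_le gap_r lam_r lam_c in \<open>auto simp: mem_uminus_image\<close>)
qed

lemma gap_flipped: "gap_box h (uminus ` Er) Ec (uminus ` S) (uminus ` D) lam"
proof -
  interpret t: gap_box h Ec Er "uminus ` D" S lam by (rule gap_transposed)
  interpret r: gap_box h Ec "uminus ` Er" S "uminus ` D" lam by (rule t.gap_reflected)
  show ?thesis by (rule r.gap_transposed)
qed

text \<open>The reflected box has the same rest and the same pairing, because both depend on \<open>Er\<close> and \<open>lam\<close>
only. So a row of the rest is covered by the same kind of position on the left and on the right side, and the
two diagonals hit both \<open>y\<close> and \<open>- y\<close> on a horizontal side.\<close>

lemma rest_symmetric:
  assumes "y \<in> rest"
  shows "y \<in> Ec" "- y \<in> Ec" "- y \<in> Er"
proof -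
  interpret l: gap_box h Er "uminus ` Ec" S D lam by (rule gap_reflected)
  show *: "y \<in> Ec" "- y \<in> Ec"
    using rest_paired[OF assms] l.rest_paired[OF assms] RS_in_Ec[of y] minus_RD_in_Ec[of y]
      l.RS_in_Ec[of y] l.minus_RD_in_Ec[of y]
    by (cases "even (ht y)"; simp add: mem_uminus_image)+
  show "- y \<in> Er"
    using reflection_pairs(2)[of y] * rest_inner[OF assms] by auto
qed

text \<open>Such a diagonal would end on a side strictly between the corner and the first inner empty line.\<close>

lemma no_short_diagonal:
  assumes "0 < \<bar>d\<bar>" "\<bar>d\<bar> < lam"
  shows "d \<notin> D" "d \<notin> S"
proof -
  have "h - \<bar>d\<bar> \<notin> Er" "\<bar>d\<bar> - h \<notin> Er"
    using gap_r[of "h - \<bar>d\<bar>"] gap_r[of "\<bar>d\<bar> - h"] assms lam_le by auto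
  then show "d \<notin> D" "d \<notin> S" using diagonal_meets_Er[of d] by auto
qed

lemma Er_in_range: "Er \<subseteq> {- (h - lam)..h - lam} \<union> {h, - h}"
  using gap_r Er_bound by fastforce

text \<open>Otherwise the 80 inner empty rows lie in an interval of at most 81 integers, and likewise for the
columns. An empty row at distance 1 and an empty column at distance 2 from the centre meet in a square whose
diagonals are both short but not main diagonals.\<close>

lemma lam_half: "2 * lam < h"
proof (rule ccontr)
  assume "\<not> 2 * lam < h"
  have "card Er \<le> card ({- (h - lam)..h - lam} \<union> {h, - h})"
    by (intro card_mono Er_in_range) auto
  also have "\<dots> \<le> card {- (h - lam)..h - lam} + card {h, - h}" by (rule card_Un_le)
  also have "\<dots> \<le> nat (2 * (h - lam) + 1) + 2"
    using card_insert_le_m1[of 2 "{- h}" h] by simp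
  finally have "82 \<le> 2 * (h - lam) + 3" using card_Er lam_le by simp
  then have hl: "40 \<le> lam \<and> h - lam \<le> 40" using \<open>\<not> 2 * lam < h\<close> h_le by presburger
  have meets: "c \<in> E \<or> - c \<in> E" if "c \<in> {1, 2}" "E \<subseteq> {- (h - lam)..h - lam} \<union> {h, - h}" "card E = 82" for E c
  proof (rule ccontr)
    assume no: "\<not> ?thesis"
    let ?I = "{- 40..40 :: int} - {c, - c} \<union> {h, - h}"
    have "E \<subseteq> ?I" using that no hl by fastforce
    then have "card E \<le> card ?I" by (intro card_mono) auto
    also have "\<dots> \<le> card ({- 40..40 :: int} - {c, - c}) + card {h, - h}" by (rule card_Un_le)
    also have "card ({- 40..40 :: int} - {c, - c}) = 79"
      using that by (subst card_Diff_subset) auto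
    also have "card {h, - h} \<le> 2" by (simp add: card_insert_if)
    finally show False using that by simp
  qed
  interpret t: gap_box h Ec Er "uminus ` D" S lam by (rule gap_transposed)
  obtain y where y: "y \<in> Er" "y = 1 \<or> y = - 1"
    using meets[OF _ Er_in_range card_Er, of 1] by auto
  obtain x where x: "x \<in> Ec" "x = 2 \<or> x = - 2"
    using meets[OF _ t.Er_in_range card_Ec, of 2] by auto
  from cover[OF x(1) y(1)] show False
    using no_short_diagonal[of "y - x"] no_short_diagonal[of "y + x"] hl x(2) y(2) by auto
qed

text \<open>Apply \<open>edge_step\<close> with \<open>a = 2 * lam\<close> at the top \<open>y\<close> of a progression of the rest: \<open>y - 2 * lam\<close> is not in \<open>RS\<close>, so \<open>y + 2 * lam\<close> is
an empty row of \<open>RD\<close> whose lower neighbour is not empty. By the pairing it lies outside the rest, hence in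
the top run. The step needs \<open>y\<close> to be at most \<open>h - 2 * lam\<close>; a larger \<open>y\<close> is excluded by means of the
empty column \<open>y\<close>.\<close>

lemma rest_top_two_up:
  assumes two: "h - 2 * lam \<in> Ec" and y: "y \<in> rest" "y + lam \<notin> Er"
    and corner: "y \<le> h - 2 * lam \<or> h - 2 * lam \<in> Er"
  shows "y + 2 * lam \<in> T"
proof -
  note t = rest_top[OF y]
  have yEr: "y \<in> Er" using y(1) by (simp add: rest_def)
  have y_ge: "- (h - 2 * lam) \<le> y"
    using gap_r[of "y - lam"] rest_inner[of "y - lam"] t by (auto simp: rest_def)
  have y_le: "y \<le> h - lam" using gap_r[OF yEr rest_inner[OF y(1)]] by auto
  have y_ne: "y \<noteq> h - lam"
    using y(1) top_run_closed[of "h - lam" lam h Er] h_in_top_run[OF Er_ends(1), of lam] lam_r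
    by (auto simp: rest_def)
  have "y \<le> h - 2 * lam"
  proof (rule ccontr)
    assume far: "\<not> ?thesis"
    have ec: "h - (h - y) \<in> Ec" using rest_symmetric(1)[OF y(1)] by simp
    have "h - 2 * lam + (h - y) \<in> RD \<or> h - 2 * lam - (h - y) \<in> RS"
      using edge_step[OF ec, of "h - 2 * lam"] corner far y_le lam_pos lam_half by auto
    moreover have "h - 2 * lam + (h - y) \<notin> RD"
      using gap_r[of "h - 2 * lam + (h - y)"] far y_le y_ne lam_half lam_pos Er_split by auto
    ultimately show False using t by (simp add: algebra_simps)
  qed
  then have "y + 2 * lam \<in> RD \<or> y - 2 * lam \<in> RS"
    using edge_step[OF two yEr] y_ge lam_pos by auto
  then have in_RD: "y + 2 * lam \<in> RD" using t by blast
  then have inE: "y + 2 * lam \<in> Er" using Er_split by blast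
  have "y + 2 * lam \<notin> rest"
    using rest_paired[of "y + 2 * lam"] in_RD RD_RS_disjoint y(2) Er_split by (auto simp: algebra_simps)
  moreover have "y + 2 * lam \<notin> B"
    using bot_run_down[of "y + 2 * lam" h lam Er] bot_run_sub[of h lam Er] y(2) y_ge lam_pos Er_bound[OF yEr]
    by (auto simp: algebra_simps)
  ultimately show ?thesis using inE by (auto simp: rest_def)
qed

text \<open>Climb the progression of \<open>y\<close> to its top; two steps above that is the top run.\<close>

lemma rest_congruent:
  assumes two: "h - 2 * lam \<in> Ec" "h - 2 * lam \<in> Er" and y: "y \<in> rest"
  shows "lam dvd h - y"
  using y
proof (induction "nat (h - y)" arbitrary: y rule: less_induct)
  case less
  show ?case
  proof (cases "y + lam \<in> Er")
    case True
    have "lam dvd h - (y + lam)"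
      using less(1)[of "y + lam"] rest_up[OF less(2) True] rest_inner[OF less(2)] lam_pos by simp
    then have "lam dvd h - (y + lam) + lam" by (rule dvd_add) simp
    then show ?thesis by simp
  next
    case False
    then have "y + 2 * lam \<in> T" using rest_top_two_up two less(2) by blast
    then obtain i :: nat where "y + 2 * lam = h - lam * int i" by (auto simp: top_run_def)
    then have "h - y = lam * (int i + 2)" by (simp add: algebra_simps)
    then show ?thesis by simp
  qed
qed

lemma rest_bottom_two_down:
  assumes two: "h - 2 * lam \<in> Ec" and y: "y \<in> rest" "y - lam \<notin> Er"
    and corner: "- (h - 2 * lam) \<le> y \<or> - (h - 2 * lam) \<in> Er"
  shows "y - 2 * lam \<in> B"
proof -
  interpret f: gap_box h "uminus ` Er" Ec "uminus ` S" "uminus ` D" lam by (rule gap_flipped)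
  have "f.rest = uminus ` rest"
    by (auto simp: f.rest_def rest_def mem_bot_run mem_uminus_image image_image
        intro!: rev_image_eqI[of "- _"])
  then have "- y \<in> f.rest" using y(1) by (simp add: mem_uminus_image)
  then have "- y + 2 * lam \<in> f.T"
    using f.rest_top_two_up[of "- y"] two y(2) corner by (auto simp: mem_uminus_image algebra_simps)
  then show ?thesis by (simp add: mem_bot_run)
qed

end

section \<open>Rows at twice the gap force two progressions\<close>

lemma top_run_mono:
  assumes "t \<in> top_run h lam E" "0 < lam" "z = t + lam * int j" "z \<le> h"
  shows "z \<in> top_run h lam E"
  using assms(3,4)
proof (induction j arbitrary: z)
  case 0
  then show ?case using assms(1) by simp
next
  case (Suc j)
  then have "z - lam \<in> top_run h lam E" using assms(2) by (simp add: algebra_simps)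
  moreover have "z - lam \<noteq> h" using Suc.prems assms(2) by auto
  ultimately show ?case using top_run_up[of "z - lam" h lam E] by simp
qed

context gap_box
begin

lemma bot_run_mono:
  assumes "t \<in> B" "z = t - lam * int j" "- h \<le> z"
  shows "z \<in> B"
  using top_run_mono[of "- t" h lam "uminus ` Er" "- z" j] assms lam_pos by (simp add: mem_bot_run)

text \<open>The top of the rest is two steps below the top run. For \<open>lam = 1\<close> this leaves only two missing rows in the
whole side, far too few. For larger \<open>lam\<close> all empty rows, apart from at most two at the bottom, are congruent
to \<open>h\<close> modulo \<open>lam\<close>, and this residue class has too few members, all the more as the row above the rest is missing.\<close>

lemma rest_empty:
  assumes two: "h - 2 * lam \<in> Ec" "h - 2 * lam \<in> Er"
  shows "rest = {}"
proof (rule ccontr)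
  assume ne: "rest \<noteq> {}"
  have fin: "finite rest" using finite_Er by (simp add: rest_def)
  define r where "r = Max rest"
  define l where "l = Min rest"
  have r: "r \<in> rest" "\<And>y. y \<in> rest \<Longrightarrow> y \<le> r" and l: "l \<in> rest" "\<And>y. y \<in> rest \<Longrightarrow> l \<le> y"
    using ne fin by (auto simp: r_def l_def)
  have r_top: "r + lam \<notin> Er" using rest_up[OF r(1)] r(2)[of "r + lam"] lam_pos by auto
  have l_bot: "l - lam \<notin> Er" using rest_down[OF l(1)] l(2)[of "l - lam"] lam_pos by auto
  have r2: "r + 2 * lam \<in> T" using rest_top_two_up[OF two(1) r(1) r_top] two(2) by blast
  then have r2_le: "r + 2 * lam \<le> h" using top_run_sub[of h lam Er] Er_bound by force
  have sub: "y \<in> Er" if "y \<in> T \<or> y \<in> B \<or> y \<in> rest" for y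
    using that top_run_sub[of h lam Er] bot_run_sub[of h lam Er] unfolding rest_def by blast
  have Er_cases: "y \<in> T \<or> y \<in> B \<or> y \<in> rest" if "y \<in> Er" for y
    using that unfolding rest_def by blast
  show False
  proof (cases "lam = 1")
    case True
    have "l \<noteq> - (h - lam)"
      using l(1) lam_r bot_run_closed[of "- (h - lam)" lam h Er] minus_h_in_bot_run[OF Er_ends(2), of lam]
      by (auto simp: rest_def)
    then have "- (h - 2 * lam) \<le> l"
      using gap_r[of l] rest_inner[OF l(1)] l(1) True by (auto simp: rest_def)
    then have l2: "l - 2 \<in> B" using rest_bottom_two_down[OF two(1) l(1) l_bot] True by simp
    have T_up: "z \<in> T" if "t \<in> T" "t \<le> z" "z \<le> h" for t z
      using top_run_mono[OF that(1) lam_pos, of z "nat (z - t)"] that True by simp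
    have B_down: "z \<in> B" if "t \<in> B" "z \<le> t" "- h \<le> z" for t z
      using bot_run_mono[OF that(1), of z "nat (t - z)"] that True by simp
    \<comment> \<open>Only the rows next to the extremes of the rest can be missing.\<close>
    have full: "z \<in> Er" if z: "\<bar>z\<bar> \<le> h" "z \<noteq> l - 1" "z \<noteq> r + 1" for z
    proof (rule ccontr)
      assume no: "z \<notin> Er"
      have "\<not> r + 2 \<le> z" using T_up[of "r + 2" z] r2 z(1) no sub[of z] True by auto
      then have "z \<le> r" using z(3) by linarith
      have "\<not> z \<le> l - 2" using B_down[of "l - 2" z] l2 z(1) no sub[of z] by auto
      then have "l \<le> z" using z(2) by linarith
      moreover have "z \<noteq> l" using sub[of l] l(1) no by blast
      ultimately have lz: "l < z" by simp
      define y where "y = Max {w \<in> rest. w < z}"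
      have "finite {w \<in> rest. w < z}" "{w \<in> rest. w < z} \<noteq> {}" using fin l lz by auto
      from Max_in[OF this] Max_ge[OF this(1)] have y: "y \<in> rest" "y < z" "\<And>w. w \<in> rest \<Longrightarrow> w < z \<Longrightarrow> w \<le> y"
        by (auto simp: y_def)
      have y1: "y + lam \<notin> Er"
      proof
        assume "y + lam \<in> Er"
        then have "y + 1 \<in> rest" "y + 1 \<noteq> z" using rest_up[OF y(1)] True no by auto
        then show False using y(2) y(3)[of "y + 1"] by simp
      qed
      then have "y + 2 \<in> T" using rest_top_two_up[OF two(1) y(1)] two(2) True by simp
      moreover have "r \<noteq> y + 1" using y1 sub[of r] r(1) True by auto
      ultimately have "r \<in> T" using T_up[of "y + 2" r] \<open>z \<le> r\<close> y(2) r2_le lam_pos by auto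
      then show False using r(1) by (simp add: rest_def)
    qed
    have "{- h..h} - {l - 1, r + 1} \<subseteq> Er"
    proof
      fix z assume "z \<in> {- h..h} - {l - 1, r + 1}"
      then have "\<bar>z\<bar> \<le> h" "z \<noteq> l - 1" "z \<noteq> r + 1" by auto
      then show "z \<in> Er" by (rule full)
    qed
    then have "card ({- h..h} - {l - 1, r + 1}) \<le> 82" using card_mono[OF finite_Er] card_Er by metis
    moreover have "card {- h..h} - card {l - 1, r + 1} \<le> card ({- h..h} - {l - 1, r + 1})"
      by (intro diff_card_le_card_Diff) auto
    moreover have "card {l - 1, r + 1} \<le> 2" by (simp add: card_insert_if)
    ultimately show False using h_ge by simp
  next
    case False
    then have lam2: "2 \<le> lam" using lam_pos by simp
    \<comment> \<open>For steps above 1 the contradiction comes from the size of the residue class of h.\<close>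
    define K where "K = {z. \<bar>z\<bar> \<le> h \<and> lam dvd h - z}"
    have "K \<subseteq> (\<lambda>i. h - lam * int i) ` {..nat (2 * h div lam)}"
    proof
      fix z assume z: "z \<in> K"
      then obtain q where q: "h - z = lam * q" by (auto simp: K_def)
      have "0 \<le> lam * q" "lam * q \<le> 2 * h" using z q[symmetric] by (auto simp: K_def)
      then have "0 \<le> q" "q \<le> 2 * h div lam"
        using lam_pos by (auto simp: zero_le_mult_iff zdiv_mono1[of "lam * q" "2 * h" lam] dest: zdiv_mono1[of "lam * q" "2 * h" lam])
      then show "z \<in> (\<lambda>i. h - lam * int i) ` {..nat (2 * h div lam)}"
        using q by (intro image_eqI[of _ _ "nat q"]) auto
    qed
    note K_sub = this
    have finK: "finite K" using K_sub by (rule finite_subset) simp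
    have "card K \<le> card ((\<lambda>i. h - lam * int i) ` {..nat (2 * h div lam)})"
      using K_sub by (intro card_mono) auto
    also have "\<dots> \<le> nat (2 * h div lam) + 1" using card_image_le[of "{..nat (2 * h div lam)}"] by simp
    finally have cardK: "card K \<le> nat (2 * h div lam) + 1" .
    have TK: "T \<subseteq> K" using top_run_sub[of h lam Er] Er_bound by (force simp: K_def top_run_def)
    have rK: "rest \<subseteq> K" using rest_congruent[OF two] rest_inner by (force simp: K_def)
    show False
    proof (cases "lam = 2")
      case True
      have "B \<subseteq> K" using bot_run_sub[of h lam Er] Er_bound True by (force simp: K_def bot_run_def)
      then have "Er \<subseteq> K - {r + lam}" using Er_cases TK rK r_top by blast
      moreover have "r + lam \<in> K"
        using rK r(1) r2_le lam_pos rest_inner[OF r(1)] True by (auto simp: K_def)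
      ultimately have "card Er \<le> card K - 1" using finK by (metis card_Diff_singleton card_mono finite_Diff)
      then show False using cardK card_Er True h_le h_ge by simp
    next
      case False
      then have lam3: "3 \<le> lam" using lam2 by simp
      have "B \<subseteq> K \<union> {- h, - h + lam}"
      proof
        fix y assume "y \<in> B"
        then obtain i :: nat where i: "y = - h + lam * int i" "\<forall>j\<le>i. - h + lam * int j \<in> Er"
          by (auto simp: bot_run_def)
        show "y \<in> K \<union> {- h, - h + lam}"
        proof (cases "i \<le> 1")
          case True
          then have "i = 0 \<or> i = 1" by auto
          then show ?thesis using i by auto
        next
          case False
          then have "- (h - 2 * lam) \<in> Er" using i(2)[rule_format, of 2] by (simp add: algebra_simps)
          then have "l - 2 * lam \<in> B" using rest_bottom_two_down[OF two(1) l(1) l_bot] by blast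
          then obtain j :: nat where j: "l - 2 * lam = - h + lam * int j" by (auto simp: bot_run_def)
          have "lam dvd h - l" using rest_congruent[OF two l(1)] .
          moreover have "h - y = (h - l) + lam * (2 + int j - int i)" using i(1) j by (simp add: algebra_simps)
          ultimately have "lam dvd h - y" by (metis dvd_add dvd_triv_left)
          moreover have "\<bar>y\<bar> \<le> h" using \<open>y \<in> B\<close> bot_run_sub[of h lam Er] Er_bound by blast
          ultimately show ?thesis by (simp add: K_def)
        qed
      qed
      then have "Er \<subseteq> K \<union> {- h, - h + lam}" using Er_cases TK rK by blast
      then have "card Er \<le> card (K \<union> {- h, - h + lam})" using finK by (intro card_mono) auto
      also have "\<dots> \<le> card K + card {- h, - h + lam}" by (rule card_Un_le)
      also have "card {- h, - h + lam} \<le> 2" by (simp add: card_insert_if)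
      finally have "82 \<le> nat (2 * h div lam) + 3" using cardK card_Er by linarith
      moreover have "2 * h div lam \<le> 2 * h div 3" using lam3 h_ge by (intro zdiv_mono2) auto
      ultimately show False using h_le by linarith
    qed
  qed
qed

lemma bot_run_image:
  obtains k :: nat where "B = (\<lambda>i. - h + lam * int i) ` {..<k}" "- h + lam * int k \<notin> Er" "card B = k"
proof -
  interpret f: gap_box h "uminus ` Er" Ec "uminus ` S" "uminus ` D" lam by (rule gap_flipped)
  obtain k :: nat where k: "f.T = (\<lambda>i. h - lam * int i) ` {..<k}" "h - lam * int k \<notin> uminus ` Er" "card f.T = k"
    by (rule f.top_run_image)
  have "B = uminus ` f.T" by (intro set_eqI) (simp add: mem_bot_run mem_uminus_image)
  then have "B = (\<lambda>i. - h + lam * int i) ` {..<k}" "card B = k"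
    using k card_uminus_image[of f.T] by (auto simp: image_image)
  moreover have "- h + lam * int k \<notin> Er" using k(2) by (simp add: mem_uminus_image)
  ultimately show thesis using that by blast
qed

end

context gap_box
begin

text \<open>Without a rest the two runs share the 82 empty rows. If they meet, they are a single progression of 81 steps
across the side, so that \<open>2 * h = 81 * lam\<close>. If they are disjoint, a step of 5 or more does not fit into the side,
and with steps 2 and 4 the runs come so close to each other or to the opposite end that they violate maximality,
disjointness or the gap next to the corner.\<close>

lemma run_shape:
  assumes rest: "rest = {}" and two: "h - 2 * lam \<in> Er"
  shows "(lam = 2 \<and> h = 81 \<and> Er = (\<lambda>i. 81 - 2 * int i) ` {..<82}) \<or>
    (\<exists>n k. lam \<in> {1, 3} \<and> n + k = 82 \<and> 3 \<le> n \<and> 2 \<le> k \<and>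
      Er = (\<lambda>i. h - lam * int i) ` {..<n} \<union> (\<lambda>i. - h + lam * int i) ` {..<k} \<and>
      (\<lambda>i. h - lam * int i) ` {..<n} \<inter> (\<lambda>i. - h + lam * int i) ` {..<k} = {} \<and>
      h - lam * int n \<notin> Er \<and> - h + lam * int k \<notin> Er)"
proof -
  obtain n :: nat where n: "T = (\<lambda>i. h - lam * int i) ` {..<n}" "h - lam * int n \<notin> Er" "card T = n"
    by (rule top_run_image)
  obtain k :: nat where k: "B = (\<lambda>i. - h + lam * int i) ` {..<k}" "- h + lam * int k \<notin> Er" "card B = k"
    by (rule bot_run_image)
  have Er_eq: "Er = T \<union> B"
    using rest top_run_sub[of h lam Er] bot_run_sub[of h lam Er] unfolding rest_def by blast
  have T_mem: "h - lam * int i \<in> Er" if "i < n" for i using that n(1) top_run_sub[of h lam Er] by blast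
  have B_mem: "- h + lam * int i \<in> Er" if "i < k" for i using that k(1) bot_run_sub[of h lam Er] by blast
  have n3: "3 \<le> n"
  proof -
    have "n \<noteq> 0" using n(2) Er_ends(1) by (intro notI) simp
    moreover have "n \<noteq> 1" using n(2) lam_r(1) by (intro notI) simp
    moreover have "n \<noteq> 2" using n(2) two by (intro notI) (simp add: mult.commute)
    ultimately show ?thesis by linarith
  qed
  have k2: "2 \<le> k"
  proof -
    have "k \<noteq> 0" using k(2) Er_ends(2) by (intro notI) simp
    moreover have "k \<noteq> 1" using k(2) lam_r(2) by (intro notI) simp
    ultimately show ?thesis by linarith
  qed
  have finT: "finite T" and finB: "finite B" by (simp_all only: n(1) k(1) finite_imageI finite_lessThan)
  have n_le: "lam * (int n - 1) \<le> 2 * h"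
    using Er_bound[OF T_mem[of "n - 1"]] n3 by (auto simp: of_nat_diff algebra_simps)
  have k_le: "lam * (int k - 1) \<le> 2 * h"
    using Er_bound[OF B_mem[of "k - 1"]] k2 by (auto simp: of_nat_diff algebra_simps)
  show ?thesis
  proof (cases "T \<inter> B = {}")
    case False
    then obtain i j where ij: "i < n" "j < k" "h - lam * int i = - h + lam * int j"
      using n(1) k(1) by auto
    then have sum: "2 * h = lam * int (i + j)" by (simp add: algebra_simps)
    define P where "P = (\<lambda>t. h - lam * int t) ` {..i + j}"
    have "P \<subseteq> Er"
    proof
      fix z assume "z \<in> P"
      then obtain t where t: "t \<le> i + j" "z = h - lam * int t" by (auto simp: P_def)
      show "z \<in> Er"
      proof (cases "t < n")
        case False
        then have "i \<le> t" using ij(1) by simp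
        then have "z = - h + lam * int (i + j - t)" using t sum by (simp add: of_nat_diff algebra_simps)
        then show ?thesis using B_mem[of "i + j - t"] ij(2) \<open>i \<le> t\<close> by simp
      qed (use t T_mem in simp)
    qed
    moreover have "Er \<subseteq> P"
    proof
      fix z assume z: "z \<in> Er"
      then consider t where "z = h - lam * int t" | t where "z = - h + lam * int t"
        using n(1) k(1) Er_eq by blast
      then obtain q :: int where q: "z = h - lam * q"
      proof cases
        case (2 t)
        then have "z = h - lam * (int (i + j) - int t)" using sum by (simp add: algebra_simps)
        then show ?thesis by (rule that)
      qed (use that in blast)
      have "0 \<le> lam * q" "lam * q \<le> lam * int (i + j)" using Er_bound[OF z] q sum by auto
      then have "0 \<le> q" "q \<le> int (i + j)" using lam_pos by (auto simp: zero_le_mult_iff)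
      then show "z \<in> P" using q unfolding P_def by (intro image_eqI[of _ _ "nat q"]) auto
    qed
    ultimately have "Er = P" by simp
    moreover have "card P = i + j + 1"
      unfolding P_def using lam_pos by (subst card_image) (auto simp: inj_on_def)
    ultimately have ij81: "i + j = 81" using card_Er by simp
    then have "2 * h = lam * 81" using sum by simp
    then have "lam = 2" "h = 81" using h_ge h_le by presburger+
    moreover have "{..81} = {..<82::nat}" by auto
    ultimately show ?thesis using \<open>Er = P\<close> ij81 by (simp add: P_def)
  next
    case True
    then have nk: "n + k = 82" using card_Un_disjoint[OF finT finB] Er_eq n(3) k(3) card_Er by simp
    have "lam \<in> {1, 3}"
    proof (rule ccontr)
      assume "lam \<notin> {1, 3}"
      then have "lam = 2 \<or> lam = 4 \<or> 5 \<le> lam" using lam_pos by auto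
      then consider "lam = 2" | "lam = 4" | "5 \<le> lam" by blast
      then show False
      proof cases
        case 1
        define j where "j = h - int n + 1"
        have l: "h - lam * int (n - 1) = - h + lam * j"
          using 1 n3 by (simp add: j_def of_nat_diff algebra_simps)
        have "0 \<le> j" using n_le 1 by (simp add: j_def)
        have "int k \<le> j"
        proof (rule ccontr)
          assume "\<not> ?thesis"
          then have "nat j < k" using \<open>0 \<le> j\<close> by linarith
          then have "- h + lam * int (nat j) \<in> B" unfolding k(1) by blast
          moreover have "h - lam * int (n - 1) \<in> T" unfolding n(1) using n3 by (intro imageI) simp
          moreover have "h - lam * int (n - 1) = - h + lam * int (nat j)" using l \<open>0 \<le> j\<close> by simp
          ultimately show False using True by (metis disjoint_iff)
        qed
        then have h81: "h = 81" using nk h_le unfolding j_def by linarith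
        then have "int k = j" using \<open>int k \<le> j\<close> nk unfolding j_def by linarith
        then have "h - lam * int n = - h + lam * int (k - 1)"
          using 1 k2 h81 by (simp add: j_def of_nat_diff)
        moreover have "- h + lam * int (k - 1) \<in> Er" by (rule B_mem) (use k2 in simp)
        ultimately show False using n(2) by metis
      next
        case 2
        have n41: "n = 41" using n_le k_le nk h_le unfolding 2 by presburger
        then have "h = 80 \<or> h = 81" using n_le h_le unfolding 2 by presburger
        then show False
        proof (elim disjE)
          assume "h = 80"
          then have "h - lam * int 40 \<in> T" unfolding n(1) n41 by (intro imageI) simp
          then have "- h \<in> T" using 2 \<open>h = 80\<close> by simp
          then show False using True minus_h_in_bot_run[OF Er_ends(2), of lam] by blast
        next
          assume "h = 81"
          have "h - 4 * 40 \<in> Er" using T_mem[of 40] 2 n41 by simp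
          then show False using gap_r[of "h - 4 * 40"] \<open>h = 81\<close> 2 by simp
        qed
      next
        case 3
        have "5 * (int n - 1) \<le> lam * (int n - 1)" using 3 n3 by (intro mult_right_mono) auto
        then have "5 * (int n - 1) \<le> 2 * h" using n_le by (rule order_trans)
        moreover have "5 * (int k - 1) \<le> lam * (int k - 1)" using 3 k2 by (intro mult_right_mono) auto
        then have "5 * (int k - 1) \<le> 2 * h" using k_le by (rule order_trans)
        ultimately show False using nk h_le by presburger
      qed
    qed
    moreover have "n + k = 82 \<and> 3 \<le> n \<and> 2 \<le> k \<and>
      Er = (\<lambda>i. h - lam * int i) ` {..<n} \<union> (\<lambda>i. - h + lam * int i) ` {..<k} \<and>
      (\<lambda>i. h - lam * int i) ` {..<n} \<inter> (\<lambda>i. - h + lam * int i) ` {..<k} = {} \<and>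
      h - lam * int n \<notin> Er \<and> - h + lam * int k \<notin> Er"
      unfolding n(1)[symmetric] k(1)[symmetric] by (intro conjI nk n3 k2 Er_eq True n(2) k(2))
    ultimately have "lam \<in> {1, 3} \<and> n + k = 82 \<and> 3 \<le> n \<and> 2 \<le> k \<and>
      Er = (\<lambda>i. h - lam * int i) ` {..<n} \<union> (\<lambda>i. - h + lam * int i) ` {..<k} \<and>
      (\<lambda>i. h - lam * int i) ` {..<n} \<inter> (\<lambda>i. - h + lam * int i) ` {..<k} = {} \<and>
      h - lam * int n \<notin> Er \<and> - h + lam * int k \<notin> Er" by (rule conjI)
    then show ?thesis by (intro disjI2 exI)
  qed
qed

end

text \<open>The shape of \<open>Er\<close> that remains for step 1 or 3. For the columns only the line at distance \<open>2 * lam\<close> is required, so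
that the locale survives flipping.\<close>

locale two_runs = gap_box +
  fixes n k :: nat
  assumes lam_13: "lam = 1 \<or> lam = 3"
    and nk: "n + k = 82" and n2: "2 \<le> n" and k2: "2 \<le> k"
    and Er_runs: "Er = (\<lambda>i. h - lam * int i) ` {..<n} \<union> (\<lambda>i. - h + lam * int i) ` {..<k}"
    and runs_disjoint: "(\<lambda>i. h - lam * int i) ` {..<n} \<inter> (\<lambda>i. - h + lam * int i) ` {..<k} = {}"
    and n_end: "h - lam * int n \<notin> Er" and k_end: "- h + lam * int k \<notin> Er"
    and two_Ec: "h - 2 * lam \<in> Ec"
begin

lemma top_mem: "i < n \<Longrightarrow> h - lam * int i \<in> Er" and bot_mem: "i < k \<Longrightarrow> - h + lam * int i \<in> Er"
  unfolding Er_runs by auto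

lemma runs_differ: "i < n \<Longrightarrow> j < k \<Longrightarrow> h - lam * int i \<noteq> - h + lam * int j"
  using runs_disjoint unfolding disjoint_iff by (metis imageI lessThan_iff)

lemma two_runs_flipped: "two_runs h (uminus ` Er) Ec (uminus ` S) (uminus ` D) lam k n"
proof (intro two_runs.intro two_runs_axioms.intro)
  show "gap_box h (uminus ` Er) Ec (uminus ` S) (uminus ` D) lam" by (rule gap_flipped)
  show "lam = 1 \<or> lam = 3" by (rule lam_13)
  show "k + n = 82" "2 \<le> k" "2 \<le> n" using nk k2 n2 by simp_all
  show "uminus ` Er = (\<lambda>i. h - lam * int i) ` {..<k} \<union> (\<lambda>i. - h + lam * int i) ` {..<n}"
    unfolding Er_runs by (simp add: image_Un image_image Un_commute)
  have "h - lam * int i \<noteq> - h + lam * int j" if "i < k" "j < n" for i j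
    using runs_differ[OF that(2,1)] by linarith
  then show "(\<lambda>i. h - lam * int i) ` {..<k} \<inter> (\<lambda>i. - h + lam * int i) ` {..<n} = {}" by blast
  show "h - lam * int k \<notin> uminus ` Er" "- h + lam * int n \<notin> uminus ` Er"
    using n_end k_end by (simp_all add: mem_uminus_image)
  show "h - 2 * lam \<in> Ec" by (rule two_Ec)
qed

text \<open>The square in column \<open>h - 2 * lam\<close> and the lowest row \<open>l\<close> of the top run is covered by a diagonal. If this is a
sum diagonal, it ends at a side in a row that is not empty: on the right side the row \<open>l - 2 * lam\<close> below the run, on
the left side a row within the gap of the corner. So it is the other diagonal, which ends at \<open>l + 2 * lam\<close>.\<close>

lemma third_last_in_RD:
  assumes "3 \<le> n"
  shows "h - lam * int (n - 3) \<in> RD"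
proof -
  define l where "l = h - lam * int (n - 1)"
  have l_Er: "l \<in> Er" using top_mem[of "n - 1"] assms by (simp add: l_def)
  have up: "h - lam * int (n - 3) = l + 2 * lam" using assms by (simp add: l_def of_nat_diff algebra_simps)
  have "l \<noteq> - h" using runs_differ[of "n - 1" 0] assms k2 by (simp add: l_def)
  moreover have "l < h" using assms lam_pos by (simp add: l_def)
  ultimately have l_in: "\<bar>l\<bar> < h" using Er_bound[OF l_Er] by linarith
  have l_ge: "- h + lam \<le> l" using gap_r[OF l_Er l_in] by linarith
  have "l \<noteq> - h + lam" using runs_differ[of "n - 1" 1] assms k2 by (simp add: l_def)
  have two_le: "l + 2 * lam \<le> h" using Er_bound[OF top_mem[of "n - 3"]] assms up by simp
  consider "l - (h - 2 * lam) \<in> D" | "l + (h - 2 * lam) \<in> S" using cover[OF two_Ec l_Er] by blast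
  then show ?thesis
  proof cases
    case 1
    then show ?thesis unfolding up RD_def using l_ge two_le lam_pos by (auto simp: algebra_simps)
  next
    case 2
    show ?thesis
    proof (cases "0 \<le> l + (h - 2 * lam)")
      case True
      then have "\<bar>l - 2 * lam\<bar> \<le> h" using l_in lam_pos by linarith
      from right[OF this] 2 have "l - 2 * lam \<in> Er" by (simp add: algebra_simps)
      then consider i where "i < n" "l - 2 * lam = h - lam * int i"
        | j where "j < k" "l - 2 * lam = - h + lam * int j" unfolding Er_runs by auto
      then have False
      proof cases
        case (1 i)
        then have "lam * (int (n - 1) + 2) = lam * int i" by (simp add: l_def algebra_simps)
        then show False using 1(1) lam_pos by simp
      next
        case (2 j)
        then have eq: "h - lam * int n = - h + lam * (int j + 1)"
          using assms by (simp add: l_def of_nat_diff algebra_simps)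
        have "- h + lam * int (j + 1) \<notin> Er" using n_end[unfolded eq] by (simp add: add.commute)
        then have "j + 1 = k" using bot_mem[of "j + 1"] 2(1) by (cases "j + 1 < k") auto
        \<comment> \<open>One missing row would separate two runs of a common progression, whose 82 steps have the wrong length.\<close>
        then have "2 * h = lam * int (n + k)" using eq by (auto simp: algebra_simps)
        then show False using nk lam_13 h_ge h_le by (elim disjE) simp_all
      qed
      then show ?thesis ..
    next
      case False
      define z where "z = l + (h - 2 * lam) + h"
      have z: "h - lam < z" "z < h"
        using False l_ge \<open>l \<noteq> - h + lam\<close> by (auto simp: z_def)
      then have "\<bar>z\<bar> \<le> h" using lam_le by linarith
      moreover have "z - h = l + (h - 2 * lam)" by (simp add: z_def)
      ultimately have "z \<in> Er" using left[of z] 2 by metis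
      then show ?thesis using gap_r[of z] z lam_le by auto
    qed
  qed
qed

text \<open>If the lower neighbour of a row of the run is in \<open>RD\<close>, it is not in \<open>RS\<close>, and \<open>lam_step\<close> puts the upper neighbour into \<open>RD\<close>.
This climbs from the end of the run in steps of two; the two starting values are the row above the end and the one
in \<open>third_last_in_RD\<close>.\<close>

lemma top_RD: "i + 1 < n \<Longrightarrow> h - lam * int i \<in> RD"
proof (induction "n - i" arbitrary: i rule: less_induct)
  case less
  consider "i + 2 = n" | "i + 3 = n" | "i + 3 < n" using less(2) by linarith
  then show ?case
  proof cases
    case 1
    have l: "h - lam * int (i + 1) \<in> Er" using top_mem[of "i + 1"] 1 by simp
    have "h - lam * int (i + 1) \<noteq> - h" using runs_differ[of "i + 1" 0] 1 k2 by simp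
    moreover have "h - lam * int (i + 1) < h" using lam_pos by simp
    ultimately have "\<bar>h - lam * int (i + 1)\<bar> < h" using Er_bound[OF l] by linarith
    from lam_step[OF l this] show ?thesis
      using n_end 1 Er_split by (auto simp: algebra_simps)
  next
    case 2
    then show ?thesis using third_last_in_RD by (metis add_diff_cancel_right' le_add2)
  next
    case 3
    have "h - lam * int (i + 2) \<in> RD" using less(1)[of "i + 2"] 3 by simp
    then have no: "h - lam * int (i + 2) \<notin> RS" using RD_RS_disjoint by blast
    have l: "h - lam * int (i + 1) \<in> Er" using top_mem[of "i + 1"] 3 by simp
    have "h - lam * int (i + 1) \<noteq> - h" using runs_differ[of "i + 1" 0] 3 k2 by simp
    moreover have "h - lam * int (i + 1) < h" using lam_pos by simp
    ultimately have "\<bar>h - lam * int (i + 1)\<bar> < h" using Er_bound[OF l] by linarith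
    from lam_step[OF l this] show ?thesis
      using no by (auto simp: algebra_simps)
  qed
qed

lemma bot_RS: "i + 1 < k \<Longrightarrow> - h + lam * int i \<in> RS"
proof -
  interpret f: two_runs h "uminus ` Er" Ec "uminus ` S" "uminus ` D" lam k n by (rule two_runs_flipped)
  assume "i + 1 < k"
  from f.top_RD[OF this] show ?thesis by (auto simp: f.RD_def RS_def mem_uminus_image algebra_simps)
qed

lemma RD_sub: "RD \<subseteq> (\<lambda>i. h - lam * int i) ` {..<n} \<union> {- h + lam * (int k - 1)}"
proof
  fix y assume y: "y \<in> RD"
  then have "y \<in> Er" using Er_split by blast
  then have "y \<in> (\<lambda>i. h - lam * int i) ` {..<n} \<or> y \<in> (\<lambda>i. - h + lam * int i) ` {..<k}"
    unfolding Er_runs by (rule UnE) simp_all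
  then show "y \<in> (\<lambda>i. h - lam * int i) ` {..<n} \<union> {- h + lam * (int k - 1)}"
  proof
    assume "y \<in> (\<lambda>i. - h + lam * int i) ` {..<k}"
    then obtain i where i: "i < k" "y = - h + lam * int i" by blast
    then have "i + 1 = k" using bot_RS[of i] y RD_RS_disjoint by (cases "i + 1 < k") auto
    then show ?thesis using i by auto
  qed simp
qed

text \<open>By \<open>top_RD\<close> and its mirror image, \<open>RD\<close> is contained in the top run together with one more row, the end of the bottom run. At 42 rows
in a run the sum \<open>0\<^sup>2 + 1\<^sup>2 + \<dots> + 41\<^sup>2\<close> is 23821.\<close>

lemma RD_moment:
  assumes "40 \<le> n" "40 \<le> k"
  shows "(\<Sum>y\<in>RD. (y - h)\<^sup>2) \<le> lam\<^sup>2 * 23821 + (2 * h - 39 * lam)\<^sup>2"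
proof -
  let ?T = "(\<lambda>i. h - lam * int i) ` {..<n}" and ?b = "- h + lam * (int k - 1)"
  have "(\<Sum>y\<in>RD. (y - h)\<^sup>2) \<le> (\<Sum>y\<in>?T \<union> {?b}. (y - h)\<^sup>2)"
    by (rule sum_mono2[OF _ RD_sub]) simp_all
  also have "\<dots> \<le> (\<Sum>y\<in>?T. (y - h)\<^sup>2) + (?b - h)\<^sup>2"
  proof (cases "?b \<in> ?T")
    case True
    then have "?T \<union> {?b} = ?T" by blast
    then show ?thesis by simp
  next
    case False
    then show ?thesis by (subst sum.union_disjoint) simp_all
  qed
  also have "(\<Sum>y\<in>?T. (y - h)\<^sup>2) = (\<Sum>i<n. lam\<^sup>2 * (int i)\<^sup>2)"
    using lam_pos by (subst sum.reindex) (simp_all add: inj_on_def power_mult_distrib)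
  also have "\<dots> \<le> (\<Sum>i<42. lam\<^sup>2 * (int i)\<^sup>2)"
    using assms nk by (intro sum_mono2) auto
  also have "\<dots> = lam\<^sup>2 * (\<Sum>i<42. (int i)\<^sup>2)" by (simp only: sum_distrib_left)
  also have "(\<Sum>i<42. (int i)\<^sup>2) = 23821" by code_simp
  also have "(?b - h)\<^sup>2 \<le> (2 * h - 39 * lam)\<^sup>2"
  proof (rule abs_le_square_iff[THEN iffD1])
    have "k = 40 \<or> k = 41 \<or> k = 42" using assms nk by linarith
    then show "\<bar>?b - h\<bar> \<le> \<bar>2 * h - 39 * lam\<bar>" using lam_13 h_ge by auto
  qed
  finally show ?thesis by simp
qed

lemma RS_moment:
  assumes "40 \<le> n" "40 \<le> k"
  shows "(\<Sum>y\<in>RS. (y + h)\<^sup>2) \<le> lam\<^sup>2 * 23821 + (2 * h - 39 * lam)\<^sup>2"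
proof -
  interpret f: two_runs h "uminus ` Er" Ec "uminus ` S" "uminus ` D" lam k n by (rule two_runs_flipped)
  have "f.RD = uminus ` RS"
    by (intro set_eqI) (simp add: f.RD_def RS_def mem_uminus_image algebra_simps)
  then have "(\<Sum>y\<in>f.RD. (y - h)\<^sup>2) = (\<Sum>y\<in>RS. (- y - h)\<^sup>2)"
    by (simp add: sum.reindex)
  also have "\<dots> = (\<Sum>y\<in>RS. (y + h)\<^sup>2)"
    by (intro sum.cong refl) (simp only: power2_eq_square minus_add_distrib[symmetric] diff_conv_add_uminus minus_mult_minus)
  finally show ?thesis using f.RD_moment[OF assms(2,1)] by (simp only:)
qed

end

section \<open>The parallelogram law against two progressions\<close>

text \<open>A diagonal \<open>d \<le> 0\<close> ends on the right side and one with \<open>d \<ge> 0\<close> on the left; the diagonal 0 that is counted twice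
contributes nothing to the sum of squares.\<close>

lemma (in tight_box) sum_D: "(\<Sum>d\<in>D. d\<^sup>2) = (\<Sum>y\<in>RD. (y - h)\<^sup>2) + (\<Sum>y\<in>tight_box.RS h D. (y + h)\<^sup>2)"
proof -
  interpret l: tight_box h Er "uminus ` Ec" S D by (rule reflected)
  define P where "P = (\<lambda>y. y - h) ` RD"
  define Q where "Q = (\<lambda>y. y + h) ` l.RS"
  have "P \<union> Q = D"
  proof
    show "P \<union> Q \<subseteq> D" by (auto simp: P_def Q_def RD_def l.RS_def)
    show "D \<subseteq> P \<union> Q"
    proof
      fix d assume d: "d \<in> D"
      show "d \<in> P \<union> Q"
      proof (cases "d \<le> 0")
        case True
        then have "d + h \<in> RD" using d D_bound[OF d] by (auto simp: RD_def)
        then show ?thesis unfolding P_def by (intro UnI1 image_eqI[of _ _ "d + h"]) simp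
      next
        case False
        then have "d - h \<in> l.RS" using d D_bound[OF d] by (auto simp: l.RS_def)
        then show ?thesis unfolding Q_def by (intro UnI2 image_eqI[of _ _ "d - h"]) simp
      qed
    qed
  qed
  moreover have "P \<inter> Q \<subseteq> {0}" by (auto simp: P_def Q_def RD_def l.RS_def)
  then have "(\<Sum>d\<in>P \<inter> Q. d\<^sup>2) = 0" by (intro sum.neutral) auto
  moreover have fin: "finite P" "finite Q" using finite_D \<open>P \<union> Q = D\<close> by auto
  ultimately have "(\<Sum>d\<in>D. d\<^sup>2) = (\<Sum>d\<in>P. d\<^sup>2) + (\<Sum>d\<in>Q. d\<^sup>2)"
    using sum.union_inter[OF fin, of "\<lambda>d. d\<^sup>2"] by simp
  then show ?thesis unfolding P_def Q_def by (simp add: sum.reindex)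
qed

lemma (in tight_box) sum_S: "(\<Sum>s\<in>S. s\<^sup>2) = (\<Sum>y\<in>RS. (y + h)\<^sup>2) + (\<Sum>y\<in>tight_box.RD h S. (y - h)\<^sup>2)"
proof -
  interpret l: tight_box h Er "uminus ` Ec" S D by (rule reflected)
  show ?thesis using l.sum_D by (simp add: add.commute)
qed

text \<open>Here \<open>Er = Ec\<close> is symmetric, and comparing adjacent sides shows that \<open>D\<close> and \<open>S\<close> are symmetric. Moving the elements
of \<open>RD\<close> from \<open>(y - h)\<^sup>2\<close> to \<open>(y + h)\<^sup>2\<close> changes each square by a multiple of \<open>4 * h = 324\<close>, so that the sum of all
squares is known modulo 648, and it disagrees with the parallelogram law.\<close>

lemma (in tight_box) not_odd_lines:
  assumes h81: "h = 81" and Er_odd: "Er = (\<lambda>i. 81 - 2 * int i) ` {..<82}" and Ec_odd: "Ec = Er"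
  shows False
proof -
  interpret l: tight_box h Er "uminus ` Ec" S D by (rule reflected)
  have sym: "- t \<in> Er" if "t \<in> Er" for t
  proof -
    from that obtain i :: nat where i: "i < 82" "t = 81 - 2 * int i" unfolding Er_odd by auto
    then have "- t = 81 - 2 * int (81 - i)" by (simp add: of_nat_diff)
    then show ?thesis unfolding Er_odd using i(1) by (intro image_eqI[of _ _ "81 - i"]) auto
  qed
  have sym_iff: "- t \<in> Er \<longleftrightarrow> t \<in> Er" for t using sym[of t] sym[of "- t"] by auto
  have D_sym: "t - h \<in> D \<longleftrightarrow> h - t \<in> D" and S_sym: "t + h \<in> S \<longleftrightarrow> - t - h \<in> S" if t: "\<bar>t\<bar> \<le> h" for t
  proof -
    have t': "\<bar>- t\<bar> \<le> h" using t by simp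
    show "t - h \<in> D \<longleftrightarrow> h - t \<in> D"
      using right[OF t] top[OF t] Ec_odd by (auto simp: add.commute)
    then show "t + h \<in> S \<longleftrightarrow> - t - h \<in> S"
      using right[OF t] left[OF t'] sym_iff[of t] by auto
  qed
  have "l.RS = uminus ` RD"
  proof (intro set_eqI)
    fix t show "t \<in> l.RS \<longleftrightarrow> t \<in> uminus ` RD"
      using D_sym[of "- t"] by (auto simp: l.RS_def RD_def mem_uminus_image algebra_simps)
  qed
  then have "(\<Sum>y\<in>l.RS. (y + h)\<^sup>2) = (\<Sum>y\<in>RD. (- y + h)\<^sup>2)" by (simp add: sum.reindex)
  also have "\<dots> = (\<Sum>y\<in>RD. (y - h)\<^sup>2)" by (intro sum.cong refl) (simp add: power2_eq_square algebra_simps)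
  finally have D2: "(\<Sum>d\<in>D. d\<^sup>2) = 2 * (\<Sum>y\<in>RD. (y - h)\<^sup>2)" using sum_D by simp
  have "l.RD = uminus ` RS"
  proof (intro set_eqI)
    fix t show "t \<in> l.RD \<longleftrightarrow> t \<in> uminus ` RS"
      using S_sym[of "- t"] by (auto simp: l.RD_def RS_def mem_uminus_image algebra_simps)
  qed
  then have "(\<Sum>y\<in>l.RD. (y - h)\<^sup>2) = (\<Sum>y\<in>RS. (- y - h)\<^sup>2)" by (simp add: sum.reindex)
  also have "\<dots> = (\<Sum>y\<in>RS. (y + h)\<^sup>2)" by (intro sum.cong refl) (simp add: power2_eq_square algebra_simps)
  finally have S2: "(\<Sum>s\<in>S. s\<^sup>2) = 2 * (\<Sum>y\<in>RS. (y + h)\<^sup>2)" using sum_S by simp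
  have fin: "finite RD" "finite RS" using finite_Er Er_split by auto
  have "(\<Sum>y\<in>RD. (y - h)\<^sup>2) = (\<Sum>y\<in>RD. (y + h)\<^sup>2 - 324 * y)"
    by (intro sum.cong refl) (simp add: h81 power2_eq_square algebra_simps)
  also have "\<dots> = (\<Sum>y\<in>RD. (y + h)\<^sup>2) - 324 * (\<Sum>y\<in>RD. y)"
    by (simp add: sum_subtractf sum_distrib_left)
  finally have "(\<Sum>y\<in>RD. (y - h)\<^sup>2) + (\<Sum>y\<in>RS. (y + h)\<^sup>2) =
      (\<Sum>y\<in>RD. (y + h)\<^sup>2) + (\<Sum>y\<in>RS. (y + h)\<^sup>2) - 324 * (\<Sum>y\<in>RD. y)" by simp
  also have "(\<Sum>y\<in>RD. (y + h)\<^sup>2) + (\<Sum>y\<in>RS. (y + h)\<^sup>2) = (\<Sum>y\<in>RD \<union> RS. (y + h)\<^sup>2)"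
    by (rule sum.union_disjoint[OF fin RD_RS_disjoint, symmetric])
  also have "RD \<union> RS = (\<lambda>i. 81 - 2 * int i) ` {..<82}" using Er_split Er_odd by simp
  also have "(\<Sum>y\<in>(\<lambda>i. 81 - 2 * int i) ` {..<82}. (y + h)\<^sup>2) = (\<Sum>i<82. (162 - 2 * int i)\<^sup>2)"
    unfolding h81 by (subst sum.reindex) (auto simp: inj_on_def)
  also have "\<dots> = 721764" by code_simp
  finally have total: "(\<Sum>d\<in>D. d\<^sup>2) + (\<Sum>s\<in>S. s\<^sup>2) = 2 * (721764 - 324 * (\<Sum>y\<in>RD. y))"
    using D2 S2 by simp
  have "(\<Sum>y\<in>Er. y\<^sup>2) = (\<Sum>i<82. (81 - 2 * int i)\<^sup>2)"
    unfolding Er_odd by (subst sum.reindex) (auto simp: inj_on_def)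
  also have "\<dots> = 183762" by code_simp
  finally have "324 * (\<Sum>y\<in>RD. y) = 367524" using moment_eq[OF h81] total Ec_odd by simp
  then show False by presburger
qed

context two_runs
begin

lemma two_runs_reflected:
  assumes "- (h - 2 * lam) \<in> Ec"
  shows "two_runs h Er (uminus ` Ec) S D lam n k"
proof (intro two_runs.intro two_runs_axioms.intro)
  show "gap_box h Er (uminus ` Ec) S D lam" by (rule gap_reflected)
  show "h - 2 * lam \<in> uminus ` Ec" using assms by (simp add: mem_uminus_image)
qed (fact lam_13 nk n2 k2 Er_runs runs_disjoint n_end k_end)+

text \<open>\<open>top_RD\<close> and \<open>bot_RS\<close> hand rows of the runs over to columns, so a run of rows cannot be longer by more than one than the
bottom run of the columns.\<close>

lemma run_lengths_nearly_equal:
  assumes "- h + lam * int kc \<notin> Ec"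
  shows "n \<le> kc + 1" and "k \<le> kc + 1"
proof -
  show "n \<le> kc + 1"
  proof (rule ccontr)
    assume "\<not> ?thesis"
    then have "- (h - lam * int kc) \<in> Ec" by (intro minus_RD_in_Ec top_RD) simp
    moreover have "- (h - lam * int kc) = - h + lam * int kc" by simp
    ultimately show False using assms by metis
  qed
  show "k \<le> kc + 1"
  proof (rule ccontr)
    assume "\<not> ?thesis"
    then have "- h + lam * int kc \<in> Ec" by (intro RS_in_Ec bot_RS) simp
    then show False using assms by blast
  qed
qed

lemma Er_moment:
  assumes "40 \<le> n" "40 \<le> k"
  shows "(\<Sum>y\<in>Er. y\<^sup>2) \<le> 82 * h\<^sup>2 - 3280 * h * lam + 44280 * lam\<^sup>2 + 363"
proof -
  have part: "(\<Sum>i<m. (h - lam * int i)\<^sup>2) =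
      int m * h\<^sup>2 - 2 * h * lam * (\<Sum>i<m. int i) + lam\<^sup>2 * (\<Sum>i<m. (int i)\<^sup>2)" for m
  proof -
    have "(\<Sum>i<m. (h - lam * int i)\<^sup>2) = (\<Sum>i<m. h\<^sup>2 - 2 * h * lam * int i + lam\<^sup>2 * (int i)\<^sup>2)"
      by (intro sum.cong refl) (simp add: power2_eq_square algebra_simps)
    then show ?thesis by (simp add: sum.distrib sum_subtractf sum_distrib_left)
  qed
  have sums: "(\<Sum>i<40. int i) = 780" "(\<Sum>i<41. int i) = 820" "(\<Sum>i<42. int i) = 861"
    "(\<Sum>i<40. (int i)\<^sup>2) = 20540" "(\<Sum>i<41. (int i)\<^sup>2) = 22140" "(\<Sum>i<42. (int i)\<^sup>2) = 23821"
    by code_simp+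
  have "(\<Sum>y\<in>Er. y\<^sup>2) = (\<Sum>y\<in>(\<lambda>i. h - lam * int i) ` {..<n}. y\<^sup>2) + (\<Sum>y\<in>(\<lambda>i. - h + lam * int i) ` {..<k}. y\<^sup>2)"
    unfolding Er_runs by (rule sum.union_disjoint) (use runs_disjoint in simp_all)
  also have "(\<Sum>y\<in>(\<lambda>i. h - lam * int i) ` {..<n}. y\<^sup>2) = (\<Sum>i<n. (h - lam * int i)\<^sup>2)"
    using lam_pos by (subst sum.reindex) (auto simp: inj_on_def)
  also have "(\<Sum>y\<in>(\<lambda>i. - h + lam * int i) ` {..<k}. y\<^sup>2) = (\<Sum>i<k. (- h + lam * int i)\<^sup>2)"
    using lam_pos by (subst sum.reindex) (auto simp: inj_on_def)
  also have "(\<Sum>i<k. (- h + lam * int i)\<^sup>2) = (\<Sum>i<k. (h - lam * int i)\<^sup>2)"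
    by (intro sum.cong refl) (simp add: power2_eq_square algebra_simps)
  finally have eq: "(\<Sum>y\<in>Er. y\<^sup>2) = (\<Sum>i<n. (h - lam * int i)\<^sup>2) + (\<Sum>i<k. (h - lam * int i)\<^sup>2)" .
  consider "n = 40" "k = 42" | "n = 41" "k = 41" | "n = 42" "k = 40" using assms nk by linarith
  then show ?thesis
  proof cases
    case 1
    have "(\<Sum>y\<in>Er. y\<^sup>2) = 82 * h\<^sup>2 - 3282 * h * lam + 44361 * lam\<^sup>2"
      unfolding eq 1 part sums by simp
    then show ?thesis using lam_13 h_ge by auto
  next
    case 2
    have "(\<Sum>y\<in>Er. y\<^sup>2) = 82 * h\<^sup>2 - 3280 * h * lam + 44280 * lam\<^sup>2"
      unfolding eq 2 part sums by simp
    then show ?thesis by simp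
  next
    case 3
    have "(\<Sum>y\<in>Er. y\<^sup>2) = 82 * h\<^sup>2 - 3282 * h * lam + 44361 * lam\<^sup>2"
      unfolding eq 3 part sums by simp
    then show ?thesis using lam_13 h_ge by auto
  qed
qed

lemma diagonal_moment:
  assumes "40 \<le> n" "40 \<le> k" "- (h - 2 * lam) \<in> Ec"
  shows "(\<Sum>d\<in>D. d\<^sup>2) + (\<Sum>s\<in>S. s\<^sup>2) \<le> 4 * (lam\<^sup>2 * 23821 + (2 * h - 39 * lam)\<^sup>2)"
proof -
  interpret l: two_runs h Er "uminus ` Ec" S D lam n k by (rule two_runs_reflected[OF assms(3)])
  define X where "X = lam\<^sup>2 * 23821 + (2 * h - 39 * lam)\<^sup>2"
  note m = RD_moment[OF assms(1,2), folded X_def] RS_moment[OF assms(1,2), folded X_def]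
    l.RD_moment[OF assms(1,2), folded X_def] l.RS_moment[OF assms(1,2), folded X_def]
  show ?thesis unfolding X_def[symmetric] using m sum_D sum_S by simp
qed

text \<open>The upper bound \<open>diagonal_moment\<close> for the diagonals lies below what the parallelogram law demands in view of
\<open>Er_moment\<close>, for all 42 values of \<open>h\<close> and \<open>lam\<close>.\<close>

lemma moment_bounds_clash: "4 * (lam\<^sup>2 * 23821 + (2 * h - 39 * lam)\<^sup>2) <
    2 * (721764 - 2 * (82 * h\<^sup>2 - 3280 * h * lam + 44280 * lam\<^sup>2 + 363))"
proof -
  have "h \<in> set [61..81]" unfolding set_upto using h_ge h_le by simp
  moreover have "\<forall>g\<in>set [61..81]. \<forall>q\<in>set [1, 3]. 4 * (q\<^sup>2 * 23821 + (2 * g - 39 * q)\<^sup>2) <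
    2 * (721764 - 2 * (82 * g\<^sup>2 - 3280 * g * q + 44280 * q\<^sup>2 + (363::int)))" by code_simp
  moreover have "lam \<in> set [1, 3]" using lam_13 by simp
  ultimately show ?thesis by blast
qed

end

context gap_box
begin

text \<open>If one of these two runs had at most 39 elements, its partner among 82 would have at least 43, and the comparison of rows with
columns in both directions would be violated.\<close>

lemma columns_and_rows_long:
  assumes r: "two_runs h Er Ec D S lam n k" and c: "two_runs h Ec Er (uminus ` D) S lam nc kc"
  shows "40 \<le> k" "40 \<le> kc"
proof -
  interpret r: two_runs h Er Ec D S lam n k by (rule r)
  interpret c: two_runs h Ec Er "uminus ` D" S lam nc kc by (rule c)
  show "40 \<le> k" "40 \<le> kc"
    using r.run_lengths_nearly_equal[OF c.k_end] c.run_lengths_nearly_equal[OF r.k_end] r.nk c.nk by linarith+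
qed

lemma no_two_runs:
  assumes r: "two_runs h Er Ec D S lam n k" and c: "two_runs h Ec Er (uminus ` D) S lam nc kc"
  shows False
proof -
  interpret r: two_runs h Er Ec D S lam n k by (rule r)
  interpret c: two_runs h Ec Er "uminus ` D" S lam nc kc by (rule c)
  note long = columns_and_rows_long[OF r c]
  have bot: "- (h - 2 * lam) \<in> Er" "- (h - 2 * lam) \<in> Ec"
    using r.bot_mem[of 2] c.bot_mem[of 2] long by (simp_all add: algebra_simps)
  have R: "two_runs h (uminus ` Er) (uminus ` Ec) (uminus ` D) (uminus ` S) lam k n"
  proof -
    interpret f: two_runs h "uminus ` Er" Ec "uminus ` S" "uminus ` D" lam k n by (rule r.two_runs_flipped)
    show ?thesis by (rule f.two_runs_reflected[OF bot(2)])
  qed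
  have C: "two_runs h (uminus ` Ec) (uminus ` Er) (uminus ` uminus ` D) (uminus ` S) lam kc nc"
  proof -
    interpret f: two_runs h "uminus ` Ec" Er "uminus ` S" "uminus ` uminus ` D" lam kc nc by (rule c.two_runs_flipped)
    show ?thesis by (rule f.two_runs_reflected[OF bot(1)])
  qed
  note long' = gap_box.columns_and_rows_long[OF two_runs.axioms(1)[OF R] R C]
  have "2 * (721764 - (\<Sum>y\<in>Er. y\<^sup>2) - (\<Sum>x\<in>Ec. x\<^sup>2)) \<le> 4 * (lam\<^sup>2 * 23821 + (2 * h - 39 * lam)\<^sup>2)"
    using moment_ge r.diagonal_moment[OF long'(1) long(1) bot(2)] by (rule order_trans)
  also note r.moment_bounds_clash
  finally show False
    using r.Er_moment[OF long'(1) long(1)] c.Er_moment[OF long'(2) long(2)] by simp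
qed

lemma no_lines_at_double_gap:
  assumes two: "h - 2 * lam \<in> Er" "h - 2 * lam \<in> Ec"
  shows False
proof -
  interpret t: gap_box h Ec Er "uminus ` D" S lam by (rule gap_transposed)
  note shape_r = run_shape[OF rest_empty[OF two(2,1)] two(1)]
  note shape_c = t.run_shape[OF t.rest_empty[OF two] two(2)]
  show False
  proof (cases "lam = 2")
    case True
    then show False using not_odd_lines shape_r shape_c by auto
  next
    case False
    obtain n k where r: "lam \<in> {1, 3}" "n + k = 82" "3 \<le> n" "2 \<le> k"
      "Er = (\<lambda>i. h - lam * int i) ` {..<n} \<union> (\<lambda>i. - h + lam * int i) ` {..<k}"
      "(\<lambda>i. h - lam * int i) ` {..<n} \<inter> (\<lambda>i. - h + lam * int i) ` {..<k} = {}"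
      "h - lam * int n \<notin> Er" "- h + lam * int k \<notin> Er"
      using shape_r False by (elim disjE exE conjE) simp_all
    have R: "two_runs h Er Ec D S lam n k"
      by (intro two_runs.intro two_runs_axioms.intro gap_box_axioms) (use r two in auto)
    obtain nc kc where c: "nc + kc = 82" "3 \<le> nc" "2 \<le> kc"
      "Ec = (\<lambda>i. h - lam * int i) ` {..<nc} \<union> (\<lambda>i. - h + lam * int i) ` {..<kc}"
      "(\<lambda>i. h - lam * int i) ` {..<nc} \<inter> (\<lambda>i. - h + lam * int i) ` {..<kc} = {}"
      "h - lam * int nc \<notin> Ec" "- h + lam * int kc \<notin> Ec"
      using shape_c False by (elim disjE exE conjE) simp_all
    have C: "two_runs h Ec Er (uminus ` D) S lam nc kc"
      by (intro two_runs.intro two_runs_axioms.intro t.gap_box_axioms) (use r(1) c two in auto)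
    show False by (rule no_two_runs[OF R C])
  qed
qed

end

section \<open>No line at twice the gap\<close>

text \<open>Two differences \<open>b\<close> and \<open>b + lam\<close> are on offer at every inner point, but a point can never have neighbours
at both distances on the same side, as these would differ by \<open>lam\<close>. So the choice propagates from a point to its
neighbours and down to \<open>lo\<close>, where it is the same for all points.\<close>

lemma shift_progression:
  fixes P :: "int set" and b lam lo hi :: int
  assumes pos: "0 < b" "0 < lam"
    and ends: "lo \<in> P" "hi \<in> P" and range: "\<And>p. p \<in> P \<Longrightarrow> lo \<le> p \<and> p \<le> hi"
    and inner: "c \<in> P" "c \<noteq> lo" "c \<noteq> hi"
    and shift: "\<And>p. p \<in> P \<Longrightarrow> p + lam \<notin> P"
    and progr: "\<And>p. p \<in> P \<Longrightarrow> p \<noteq> lo \<Longrightarrow> p \<noteq> hi \<Longrightarrow>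
      (p - b \<in> P \<and> p + b \<in> P) \<or> (p - (b + lam) \<in> P \<and> p + (b + lam) \<in> P)"
  shows "\<exists>e\<in>{b, b + lam}. \<exists>N::nat. P = (\<lambda>i. lo + e * int i) ` {..N} \<and> hi = lo + e * int N"
proof -
  define stepping where "stepping e p \<longleftrightarrow> p \<in> P \<and> p \<noteq> lo \<and> p \<noteq> hi \<and> p - e \<in> P \<and> p + e \<in> P" for e p
  have two: "stepping b p \<or> stepping (b + lam) p" if "p \<in> P" "p \<noteq> lo" "p \<noteq> hi" for p
    using progr[OF that] that by (auto simp: stepping_def)
  have keep: "stepping e q" if e: "e \<in> {b, b + lam}" and q: "q \<in> P" "q \<noteq> lo" "q \<noteq> hi"
    and nb: "q + e \<in> P \<or> q - e \<in> P" for e q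
  proof -
    have "\<not> (q + b \<in> P \<and> q + (b + lam) \<in> P)" using shift[of "q + b"] by (auto simp: algebra_simps)
    moreover have "\<not> (q - b \<in> P \<and> q - (b + lam) \<in> P)" using shift[of "q - (b + lam)"] by (auto simp: algebra_simps)
    ultimately show ?thesis using two[OF q] e nb by (auto simp: stepping_def)
  qed
  have down: "lo + e \<in> P \<and> e dvd p - lo" if "e \<in> {b, b + lam}" "stepping e p" for e p
    using that
  proof (induction "nat (p - lo)" arbitrary: p rule: less_induct)
    case less
    have pe: "p - e \<in> P" "p + e \<in> P" "p \<in> P" "0 < e" using less(2,3) pos by (auto simp: stepping_def)
    show ?case
    proof (cases "p - e = lo")
      case True
      then have "p = lo + e" by simp
      then show ?thesis using pe by simp
    next
      case False
      have lt: "lo \<le> p - e" "p \<le> hi" using range pe by auto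
      then have "stepping e (p - e)" using keep[OF less(2) pe(1) False] pe by simp
      moreover have "nat (p - e - lo) < nat (p - lo)" using lt pe(4) by simp
      ultimately have ih: "lo + e \<in> P" "e dvd p - e - lo" using less(1,2) by blast+
      from dvd_add[OF ih(2) dvd_refl] show ?thesis using ih(1) by simp
    qed
  qed
  have up: "e dvd hi - p" if "e \<in> {b, b + lam}" "stepping e p" for e p
    using that
  proof (induction "nat (hi - p)" arbitrary: p rule: less_induct)
    case less
    have pe: "p - e \<in> P" "p + e \<in> P" "p \<in> P" "0 < e" using less(2,3) pos by (auto simp: stepping_def)
    show ?case
    proof (cases "p + e = hi")
      case True
      then have "hi - p = e" by simp
      then show ?thesis by simp
    next
      case False
      have lt: "lo \<le> p" "p + e \<le> hi" using range pe by auto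
      then have "stepping e (p + e)" using keep[OF less(2) pe(2) _ False] pe by simp
      moreover have "nat (hi - (p + e)) < nat (hi - p)" using lt pe(4) by simp
      ultimately have ih: "e dvd hi - (p + e)" using less(1,2) by blast
      from dvd_add[OF ih dvd_refl] show ?thesis by simp
    qed
  qed
  obtain e where e: "e \<in> {b, b + lam}" "stepping e c" using two[OF inner] by blast
  have e_pos: "0 < e" using e pos by auto
  have all: "stepping e p" if p: "p \<in> P" "p \<noteq> lo" "p \<noteq> hi" for p
  proof -
    obtain e' where e': "e' \<in> {b, b + lam}" "stepping e' p" using two[OF p] by blast
    have "\<not> (lo + b \<in> P \<and> lo + (b + lam) \<in> P)" using shift[of "lo + b"] by (auto simp: algebra_simps)
    then have "e' = e" using down[OF e] down[OF e'] e(1) e'(1) by auto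
    then show ?thesis using e'(2) by simp
  qed
  have "e dvd (hi - c) + (c - lo)" using up[OF e] down[OF e] by (intro dvd_add) auto
  then obtain q where q: "hi - lo = e * q" by auto
  have "0 \<le> e * q" using range[OF ends(1)] range[OF ends(2)] q[symmetric] by simp
  then have q0: "0 \<le> q" using e_pos by (simp add: zero_le_mult_iff)
  define N where "N = nat q"
  have hi: "hi = lo + e * int N" using q q0 by (simp add: N_def)
  have mem: "lo + e * int i \<in> P" if "i \<le> N" for i
    using that
  proof (induction i)
    case 0
    then show ?case using ends by simp
  next
    case (Suc i)
    show ?case
    proof (cases "i = 0")
      case True
      then show ?thesis using down[OF e] by simp
    next
      case False
      have "lo + e * int i \<noteq> hi" using Suc(2) e_pos by (simp add: hi)
      moreover have "lo + e * int i \<noteq> lo" using False e_pos by simp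
      ultimately have "stepping e (lo + e * int i)" using all Suc by simp
      then show ?thesis by (simp add: stepping_def algebra_simps)
    qed
  qed
  have "P \<subseteq> (\<lambda>i. lo + e * int i) ` {..N}"
  proof
    fix p assume p: "p \<in> P"
    have "e dvd p - lo"
      using down[OF e(1) all[OF p]] q by (cases "p = lo \<or> p = hi") auto
    then obtain r where r: "p - lo = e * r" by auto
    have "0 \<le> e * r" "e * r \<le> e * int N" using range[OF p] r[symmetric] hi by auto
    then have "0 \<le> r" "r \<le> int N" using e_pos by (simp_all add: zero_le_mult_iff)
    then show "p \<in> (\<lambda>i. lo + e * int i) ` {..N}" using r by (intro image_eqI[of _ _ "nat r"]) auto
  qed
  then have "P = (\<lambda>i. lo + e * int i) ` {..N}" using mem by auto
  then show ?thesis using e(1) hi by blast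
qed

context gap_box
begin

text \<open>Both runs have two elements, so 78 empty rows form 39 pairs, the lower members of which are the set \<open>P\<close>.
Let \<open>a\<close> be the distance of the next empty line. Then \<open>edge_step\<close> with this \<open>a\<close>, applied to both members of the pair of \<open>p\<close>, shows that
\<open>P\<close> contains the neighbours of \<open>p\<close> at distance \<open>a - lam\<close> or those at distance \<open>a\<close>. By \<open>shift_progression\<close> \<open>P\<close> is a progression of
39 elements between known ends. With difference \<open>a\<close> this gives \<open>2 * h = 40 * a + lam\<close>, and the bounds on \<open>h\<close> leave one
solution. With difference \<open>b = a - lam\<close> it gives \<open>2 * h = 40 * b + 3 * lam\<close>; then 1 and 2 are empty lines, and they meet in a
square which no diagonal covers.\<close>

lemma isolated_ends:
  assumes no_r: "h - 2 * lam \<notin> Er" "- (h - 2 * lam) \<notin> Er"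
    and no_c: "h - 2 * lam \<notin> Ec" "- (h - 2 * lam) \<notin> Ec"
    and a: "h - a \<in> Ec" "lam < a" "a \<le> h"
    and second: "\<And>e. e \<in> Er \<Longrightarrow> \<bar>e\<bar> < h - lam \<Longrightarrow> \<bar>e\<bar> \<le> h - a"
  shows "h = 61" "lam = 2" "a = 3"
    and "RD \<subseteq> (\<lambda>i. 61 - 3 * int i) ` {..<41} \<union> {59}"
    and "RS \<subseteq> (\<lambda>i. - 61 + 3 * int i) ` {..<41} \<union> {- 59}"
    and "h - a \<in> Er" "- (h - a) \<in> Ec"
proof -
  obtain n :: nat where n: "T = (\<lambda>i. h - lam * int i) ` {..<n}" "h - lam * int n \<notin> Er" "card T = n"
    by (rule top_run_image)
  obtain k :: nat where k: "B = (\<lambda>i. - h + lam * int i) ` {..<k}" "- h + lam * int k \<notin> Er" "card B = k"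
    by (rule bot_run_image)
  have "n = 2"
  proof -
    have "h - lam * int i \<in> Er" if "i < n" for i using that n(1) top_run_sub[of h lam Er] by blast
    from this[of 2] have "n \<le> 2" using no_r by (cases "2 < n") (auto simp: algebra_simps)
    moreover have "n \<noteq> 0" using n(2) Er_ends(1) by (intro notI) simp
    moreover have "n \<noteq> 1" using n(2) lam_r(1) by (intro notI) simp
    ultimately show ?thesis by linarith
  qed
  have "k = 2"
  proof -
    have "- h + lam * int i \<in> Er" if "i < k" for i using that k(1) bot_run_sub[of h lam Er] by blast
    from this[of 2] have "k \<le> 2" using no_r by (cases "2 < k") (auto simp: algebra_simps)
    moreover have "k \<noteq> 0" using k(2) Er_ends(2) by (intro notI) simp
    moreover have "k \<noteq> 1" using k(2) lam_r(2) by (intro notI) simp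
    ultimately show ?thesis by linarith
  qed
  have two: "{..<2} = {0, 1 :: nat}" by auto
  have T2: "T = {h, h - lam}" and B2: "B = {- h, - h + lam}"
    using n(1) k(1) unfolding \<open>n = 2\<close> \<open>k = 2\<close> two by simp_all
  have rest2: "y \<in> rest \<longleftrightarrow> y \<in> Er \<and> y \<noteq> h \<and> y \<noteq> h - lam \<and> y \<noteq> - h \<and> y \<noteq> - h + lam" for y
    unfolding rest_def T2 B2 by blast
  have "card rest = 78"
  proof -
    have "rest = Er - {h, h - lam, - h, - h + lam}" using rest2 by auto
    moreover have "card {h, h - lam, - h, - h + lam} = 4" using lam_half lam_pos h_ge by auto
    moreover have "{h, h - lam, - h, - h + lam} \<subseteq> Er" using Er_ends lam_r by auto
    ultimately show ?thesis using card_Er finite_Er by (simp add: card_Diff_subset)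
  qed
  define P where "P = rest \<inter> RS"
  have card_P: "card P = 39" using rest_card \<open>card rest = 78\<close> by (simp add: P_def)
  have inner: "\<bar>e\<bar> \<le> h - a" if "e \<in> rest" for e
  proof -
    have "\<bar>e\<bar> < h" "e \<in> Er" using rest_inner[OF that] that rest2 by auto
    then have "\<bar>e\<bar> < h - lam" using gap_r[of e] that rest2[of e] by auto
    then show ?thesis using second \<open>e \<in> Er\<close> by blast
  qed
  define b where "b = a - lam"
  have "a \<noteq> 2 * lam" using a(1) no_c by auto
  have b: "0 < b" "a = b + lam" "b \<noteq> lam" using a \<open>a \<noteq> 2 * lam\<close> by (auto simp: b_def)
  have hb: "h - b \<notin> Er" "- (h - b) \<notin> Er"
  proof -
    have "e \<notin> Er" if "\<bar>e\<bar> = h - b" for e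
      using gap_r[of e] second[of e] that a b lam_pos by auto
    then show "h - b \<notin> Er" "- (h - b) \<notin> Er" using a b lam_pos by simp_all
  qed
  have ha: "\<bar>h - a\<bar> \<le> h" "\<bar>h - a\<bar> < h - lam" using a lam_pos by auto
  have in_rest: "e \<in> rest" if "e \<in> Er" "\<bar>e\<bar> = h - a" for e
    using that ha lam_pos rest2[of e] by auto
  have ha_rest: "h - a \<in> rest" "- (h - a) \<in> rest"
  proof -
    from reflection_pairs(1)[OF ha(1) a(1)] have "h - a \<in> rest \<or> - (h - a) \<in> rest"
      using in_rest a(3) by auto
    then have "h - a \<in> Er \<and> - (h - a) \<in> Er"
      using rest_symmetric(3)[of "h - a"] rest_symmetric(3)[of "- (h - a)"] rest2 by auto
    then show "h - a \<in> rest" "- (h - a) \<in> rest" using in_rest[of "h - a"] in_rest[of "- (h - a)"] a(3) by auto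
  qed
  show "h - a \<in> Er" using ha_rest rest2 by blast
  show "- (h - a) \<in> Ec" using rest_symmetric(1)[OF ha_rest(2)] .
  define hi where "hi = h - a - lam"
  define lo where "lo = - (h - a)"
  have hi: "hi \<in> P" using rest_top[OF ha_rest(1)] hb b by (simp add: hi_def P_def)
  have lo: "lo \<in> P"
  proof -
    have "- (h - a) - lam \<notin> RS" using hb b Er_split by (auto simp: algebra_simps)
    then show ?thesis using rest_paired[OF ha_rest(2)] ha_rest(2) by (auto simp: lo_def P_def)
  qed
  have RS_RD: "y \<notin> RD" if "y \<in> RS" for y using that RD_RS_disjoint by blast
  have P_up: "p + lam \<in> rest \<and> p + lam \<in> RD" if "p \<in> P" for p
    using that rest_paired[of p] RS_RD unfolding P_def by blast
  have P_shift: "p + lam \<notin> P" if "p \<in> P" for p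
    using P_up[OF that] RS_RD unfolding P_def by blast
  have RD_P: "y - lam \<in> P" if "y \<in> rest" "y \<in> RD" for y
    using that rest_paired[of y] RS_RD unfolding P_def by blast
  have P_range: "lo \<le> p \<and> p \<le> hi" if "p \<in> P" for p
    using inner[of p] inner[of "p + lam"] P_up[OF that] that by (auto simp: lo_def hi_def P_def)
  have RD_in: "y \<in> rest" if "y \<in> RD" "- h + lam < y" "y < h - lam" for y
    using that rest2[of y] Er_split lam_pos by auto
  have RS_in: "y \<in> rest" if "y \<in> RS" "- h + lam < y" "y < h - lam" for y
    using that rest2[of y] Er_split lam_pos by auto
  have progr: "(p - b \<in> P \<and> p + b \<in> P) \<or> (p - (b + lam) \<in> P \<and> p + (b + lam) \<in> P)"
    if p: "p \<in> P" "p \<noteq> lo" "p \<noteq> hi" for p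
  proof -
    have pr: "lo < p" "p < hi" using P_range[OF p(1)] p by auto
    have p_rest: "p \<in> rest" "p \<in> Er" "p + lam \<in> rest" "p + lam \<in> Er"
      using p(1) P_up[OF p(1)] rest2 by (auto simp: P_def)
    have "p + a \<in> RD \<or> p - a \<in> RS"
      using edge_step[OF a(1) p_rest(2)] inner[OF p_rest(1)] a lam_pos by auto
    then have 1: "p + b \<in> P \<or> p - a \<in> P"
    proof
      assume rd: "p + a \<in> RD"
      then have "p + a \<in> rest" using pr a lam_pos by (intro RD_in) (auto simp: lo_def hi_def)
      then show ?thesis using RD_P[OF _ rd] b by (simp add: algebra_simps)
    next
      assume rs: "p - a \<in> RS"
      have "p \<noteq> lo + lam" using P_shift[OF lo] p(1) by blast
      then have "p - a \<noteq> - h + lam" by (simp add: lo_def)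
      moreover have "p - a \<noteq> - h" using pr by (auto simp: lo_def)
      moreover have "p - a < h - lam" using pr a lam_pos by (auto simp: hi_def)
      ultimately have "p - a \<in> rest" using rs rest2[of "p - a"] Er_split lam_pos by auto
      then show ?thesis using rs by (simp add: P_def)
    qed
    have "p + lam + a \<in> RD \<or> p + lam - a \<in> RS"
      using edge_step[OF a(1) p_rest(4)] inner[OF p_rest(3)] a lam_pos by auto
    then have 2: "p + a \<in> P \<or> p - b \<in> P"
    proof
      assume rd: "p + lam + a \<in> RD"
      have "p + lam \<noteq> hi" using P_shift[OF p(1)] hi by blast
      then have "p + lam + a \<noteq> h - lam" by (simp add: hi_def)
      moreover have "p + lam + a < h" using pr by (auto simp: hi_def)
      moreover have "- h + lam < p + lam + a" using pr a lam_pos by (auto simp: lo_def)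
      ultimately have "p + lam + a \<in> rest" using rd rest2[of "p + lam + a"] Er_split lam_pos by auto
      then show ?thesis using RD_P[OF _ rd] by (simp add: algebra_simps)
    next
      assume rs: "p + lam - a \<in> RS"
      then have "p + lam - a \<in> rest" using pr a b lam_pos by (intro RS_in) (auto simp: lo_def hi_def)
      then show ?thesis using rs b by (simp add: P_def algebra_simps)
    qed
    have "\<not> (p + b \<in> P \<and> p + a \<in> P)" using P_shift[of "p + b"] b(2) by (auto simp: algebra_simps)
    moreover have "\<not> (p - a \<in> P \<and> p - b \<in> P)" using P_shift[of "p - a"] b(2) by (auto simp: algebra_simps)
    ultimately show ?thesis using 1 2 b(2) by auto
  qed
  obtain c where c: "c \<in> P" "c \<noteq> lo" "c \<noteq> hi"
  proof -
    have "\<not> P \<subseteq> {lo, hi}"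
    proof
      assume "P \<subseteq> {lo, hi}"
      then have "card P \<le> card {lo, hi}" by (intro card_mono) auto
      also have "\<dots> \<le> 2" by (simp add: card_insert_if)
      finally show False using card_P by simp
    qed
    then show thesis using that by blast
  qed
  obtain e and N :: nat where e: "e \<in> {b, b + lam}" and PN: "P = (\<lambda>i. lo + e * int i) ` {..N}" and hiN: "hi = lo + e * int N"
    using shift_progression[of b lam lo P hi c] b lam_pos lo hi P_range c P_shift progr by blast
  have e_pos: "0 < e" using e b lam_pos by auto
  have "card P = N + 1" unfolding PN using e_pos by (subst card_image) (auto simp: inj_on_def)
  then have "N = 38" using card_P by simp
  have size: "2 * h - 2 * a - lam = 38 * e" using hiN \<open>N = 38\<close> by (simp add: hi_def lo_def)
  have P_mem: "z \<in> P \<longleftrightarrow> (\<exists>i. 0 \<le> i \<and> i \<le> 38 \<and> z = lo + e * i)" for z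
  proof
    assume "z \<in> P"
    then obtain i where "i \<le> N" "z = lo + e * int i" unfolding PN by auto
    then show "\<exists>i. 0 \<le> i \<and> i \<le> 38 \<and> z = lo + e * i" using \<open>N = 38\<close> by (intro exI[of _ "int i"]) auto
  next
    assume "\<exists>i. 0 \<le> i \<and> i \<le> 38 \<and> z = lo + e * i"
    then obtain i where "0 \<le> i" "i \<le> 38" "z = lo + e * i" by blast
    then show "z \<in> P" unfolding PN \<open>N = 38\<close> by (intro image_eqI[of _ _ "nat i"]) auto
  qed
  have "e \<noteq> b"
  proof
    assume eb: "e = b"
    have s: "2 * h = 40 * b + 3 * lam" using size b(2) eb by simp
    have nodiv: "lo + lam \<noteq> lo + b * i" if "0 \<le> i" "i \<le> 38" for i
      using P_shift[OF lo] P_mem[of "lo + lam"] that eb by blast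
    have "b \<le> 3" using s h_le lam_pos by simp
    then consider "b = 1" | "b = 2" | "b = 3" using b(1) by linarith
    then have both: "(1 \<in> P \<or> 1 - lam \<in> P) \<and> (2 \<in> P \<or> 2 - lam \<in> P) \<and> 2 \<le> lam \<and> lam \<noteq> 3 \<and> 3 < a"
    proof cases
      case 1
      \<comment> \<open>Otherwise P, now an interval, would contain both lo and lo + lam.\<close>
      have "\<not> lam \<le> 38" using nodiv[of lam] 1 lam_pos by auto
      then have "lam = 40" "h = 80" using s 1 h_le by presburger+
      then show ?thesis unfolding P_mem eb using 1 b(2) by (simp add: lo_def)
    next
      case 2
      have "even lam" "lam \<le> 76" using s 2 h_le by presburger+
      then obtain i where "lam = 2 * i" by blast
      then show ?thesis using nodiv[of i] 2 lam_pos \<open>lam \<le> 76\<close> by auto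
    next
      case 3
      have "\<not> 3 dvd lam"
      proof
        assume "3 dvd lam"
        then obtain i where "lam = 3 * i" by blast
        then show False using nodiv[of i] 3 lam_pos s h_le by auto
      qed
      moreover have "even lam" "lam \<le> 14" using s 3 h_le by presburger+
      ultimately have "lam = 2 \<or> lam = 4 \<or> lam = 8 \<or> lam = 10 \<or> lam = 14" using lam_pos by presburger
      then show ?thesis
        unfolding P_mem eb using 3 b(2) s by (elim disjE; simp add: lo_def; presburger)
    qed
    have in_E: "z \<in> rest" if "z \<in> P \<or> z - lam \<in> P" for z
      using that P_up[of "z - lam"] by (auto simp: P_def)
    have "1 \<in> Er" using in_E[of 1] both rest2 by blast
    moreover have "2 \<in> Ec" using in_E[of 2] both rest_symmetric(1) by blast
    ultimately have "- 1 \<in> D \<or> 3 \<in> S" using cover[of 2 1] by simp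
    then have "h - 1 \<in> Er \<or> 1 - h \<in> Er \<or> h - 3 \<in> Er \<or> 3 - h \<in> Er"
      using diagonal_meets_Er(1)[of "- 1"] diagonal_meets_Er(2)[of 3] by auto
    then obtain z where z: "z \<in> Er" "\<bar>z\<bar> = h - 1 \<or> \<bar>z\<bar> = h - 3" using h_ge by fastforce
    then have "\<bar>z\<bar> \<le> h - lam" using gap_r[of z] by auto
    then have "\<bar>z\<bar> < h - lam" using z(2) both by auto
    then show False using second[OF z(1)] z(2) both by auto
  qed
  then have ea: "e = a" using e b(2) by auto
  have s: "2 * h = 40 * a + lam" using size ea by simp
  have "a \<le> 4" using s h_le lam_pos by simp
  moreover have "3 \<le> a" using s h_ge a(2) by simp
  ultimately consider "a = 3" | "a = 4" by linarith
  then have num: "a = 3 \<and> lam = 2 \<and> h = 61"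
  proof cases
    case 1
    then have "2 * h = 120 + lam" "lam = 1 \<or> lam = 2" using s a(2) lam_pos by auto
    then show ?thesis using 1 h_ge by auto
  next
    case 2
    then have "2 * h = 160 + lam" using s by simp
    moreover from this have "even lam" by presburger
    moreover have "lam \<noteq> 2" using \<open>a \<noteq> 2 * lam\<close> 2 by simp
    ultimately have "2 * h = 160 + lam \<and> 3 \<le> lam" using lam_pos by presburger
    then show ?thesis using h_le by simp
  qed
  then show "h = 61" "lam = 2" "a = 3" by auto
  have P3: "\<exists>i. 0 \<le> i \<and> i \<le> 38 \<and> z = - 58 + 3 * i" if "z \<in> P" for z
    using that P_mem[of z] ea num by (simp add: lo_def)
  show "RD \<subseteq> (\<lambda>i. 61 - 3 * int i) ` {..<41} \<union> {59}"
  proof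
    fix y assume y: "y \<in> RD"
    then have yE: "y \<in> Er" using Er_split by blast
    have "y \<noteq> - h" using y minus_h_in_RS RS_RD by blast
    then consider "y \<in> rest" | "y = 61" | "y = 59" | "y = - 59" using yE rest2[of y] num by auto
    then obtain i where "y = 59 \<or> (0 \<le> i \<and> i \<le> 40 \<and> y = 61 - 3 * i)"
    proof cases
      case 1
      from P3[OF RD_P[OF 1 y]] obtain i where "0 \<le> i" "i \<le> 38" "y - lam = - 58 + 3 * i" by blast
      then show ?thesis using num by (intro that[of "39 - i"]) auto
    next
      case 2
      then show ?thesis by (intro that[of 0]) auto
    next
      case 4
      then show ?thesis by (intro that[of 40]) auto
    qed (use that in blast)
    then show "y \<in> (\<lambda>i. 61 - 3 * int i) ` {..<41} \<union> {59}"
      by (elim disjE) (auto intro!: image_eqI[of _ _ "nat i"])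
  qed
  show "RS \<subseteq> (\<lambda>i. - 61 + 3 * int i) ` {..<41} \<union> {- 59}"
  proof
    fix y assume y: "y \<in> RS"
    then have yE: "y \<in> Er" using Er_split by blast
    have "y \<noteq> h" using y h_in_RD RS_RD by blast
    then consider "y \<in> rest" | "y = - 61" | "y = 59" | "y = - 59" using yE rest2[of y] num by auto
    then obtain i where "y = - 59 \<or> (0 \<le> i \<and> i \<le> 40 \<and> y = - 61 + 3 * i)"
    proof cases
      case 1
      then have "y \<in> P" using y by (simp add: P_def)
      from P3[OF this] obtain i where "0 \<le> i" "i \<le> 38" "y = - 58 + 3 * i" by auto
      then show ?thesis by (intro that[of "i + 1"]) auto
    next
      case 2
      then show ?thesis by (intro that[of 0]) auto
    next
      case 3
      then show ?thesis by (intro that[of 40]) auto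
    qed (use that in blast)
    then show "y \<in> (\<lambda>i. - 61 + 3 * int i) ` {..<41} \<union> {- 59}"
      by (elim disjE) (auto intro!: image_eqI[of _ _ "nat i"])
  qed
qed

end

section \<open>Tight boxes do not exist\<close>

context gap_box
begin

text \<open>In the only case left all empty lines lie in the two progressions \<open>X\<close> and \<open>Y\<close> of step 3, and both the
lines and the diagonals are too short for the parallelogram law: the diagonals give at most \<open>4 * 199264\<close>, while
\<open>2 * (721764 - 2 * 103402)\<close> is required.\<close>

lemma no_isolated_ends:
  assumes no_r: "h - 2 * lam \<notin> Er" "- (h - 2 * lam) \<notin> Er"
    and no_c: "h - 2 * lam \<notin> Ec" "- (h - 2 * lam) \<notin> Ec"
    and a: "h - a \<in> Ec" "lam < a" "a \<le> h"
    and second: "\<And>e. e \<in> Er \<union> Ec \<Longrightarrow> \<bar>e\<bar> < h - lam \<Longrightarrow> \<bar>e\<bar> \<le> h - a"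
  shows False
proof -
  define X where "X = (\<lambda>i. 61 - 3 * int i) ` {..<41}"
  define Y where "Y = (\<lambda>i. - 61 + 3 * int i) ` {..<41}"
  have fin: "finite X" "finite Y" by (simp_all add: X_def Y_def)
  have second_r: "\<bar>e\<bar> \<le> h - a" if "e \<in> Er" "\<bar>e\<bar> < h - lam" for e using second that by blast
  note R = isolated_ends[OF no_r no_c a second_r]
  interpret l: gap_box h Er "uminus ` Ec" S D lam by (rule gap_reflected)
  have refl: "h - 2 * lam \<notin> uminus ` Ec" "- (h - 2 * lam) \<notin> uminus ` Ec" "h - a \<in> uminus ` Ec"
    using no_c R(7) by (simp_all add: mem_uminus_image)
  note L = l.isolated_ends[OF no_r refl a(2,3) second_r]
  interpret t: gap_box h Ec Er "uminus ` D" S lam by (rule gap_transposed)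
  have second_c: "\<bar>e\<bar> \<le> h - a" if "e \<in> Ec" "\<bar>e\<bar> < h - lam" for e using second that by blast
  note C = t.isolated_ends[OF no_c no_r R(6) a(2,3) second_c]
  have X_in: "- 59 \<in> X" unfolding X_def by (intro image_eqI[of _ _ 40]) auto
  have Y_in: "59 \<in> Y" unfolding Y_def by (intro image_eqI[of _ _ 40]) auto
  have X_sums: "(\<Sum>y\<in>X. y\<^sup>2) = 51701" "(\<Sum>y\<in>X. (y - 61)\<^sup>2) = 199260"
  proof -
    have "(\<Sum>y\<in>X. f y) = (\<Sum>i<41. f (61 - 3 * int i))" for f :: "int \<Rightarrow> int"
      unfolding X_def by (subst sum.reindex) (auto simp: inj_on_def)
    moreover have "(\<Sum>i<41. (61 - 3 * int i)\<^sup>2) = 51701" "(\<Sum>i<41. (61 - 3 * int i - 61)\<^sup>2) = 199260"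
      by code_simp+
    ultimately show "(\<Sum>y\<in>X. y\<^sup>2) = 51701" "(\<Sum>y\<in>X. (y - 61)\<^sup>2) = 199260" by simp_all
  qed
  have Y_sums: "(\<Sum>y\<in>Y. y\<^sup>2) = 51701" "(\<Sum>y\<in>Y. (y + 61)\<^sup>2) = 199260"
  proof -
    have "(\<Sum>y\<in>Y. f y) = (\<Sum>i<41. f (- 61 + 3 * int i))" for f :: "int \<Rightarrow> int"
      unfolding Y_def by (subst sum.reindex) (auto simp: inj_on_def)
    moreover have "(\<Sum>i<41. (- 61 + 3 * int i)\<^sup>2) = 51701" "(\<Sum>i<41. (- 61 + 3 * int i + 61)\<^sup>2) = 199260"
      by code_simp+
    ultimately show "(\<Sum>y\<in>Y. y\<^sup>2) = 51701" "(\<Sum>y\<in>Y. (y + 61)\<^sup>2) = 199260" by simp_all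
  qed
  have near_X: "(\<Sum>y\<in>A. (y - h)\<^sup>2) \<le> 199264" if "A \<subseteq> X \<union> {59}" for A
  proof -
    have "(\<Sum>y\<in>A. (y - h)\<^sup>2) \<le> (\<Sum>y\<in>insert 59 X. (y - h)\<^sup>2)" using that fin by (intro sum_mono2) auto
    also have "\<dots> \<le> (59 - h)\<^sup>2 + (\<Sum>y\<in>X. (y - h)\<^sup>2)"
      using fin by (cases "59 \<in> X") (simp_all add: insert_absorb)
    finally show ?thesis using X_sums R(1) by simp
  qed
  have near_Y: "(\<Sum>y\<in>A. (y + h)\<^sup>2) \<le> 199264" if "A \<subseteq> Y \<union> {- 59}" for A
  proof -
    have "(\<Sum>y\<in>A. (y + h)\<^sup>2) \<le> (\<Sum>y\<in>insert (- 59) Y. (y + h)\<^sup>2)" using that fin by (intro sum_mono2) auto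
    also have "\<dots> \<le> (- 59 + h)\<^sup>2 + (\<Sum>y\<in>Y. (y + h)\<^sup>2)"
      using fin by (cases "- 59 \<in> Y") (simp_all add: insert_absorb)
    finally show ?thesis using Y_sums R(1) by simp
  qed
  have lines: "(\<Sum>y\<in>E. y\<^sup>2) \<le> 103402" if "E \<subseteq> X \<union> Y" for E
  proof -
    have "(\<Sum>y\<in>E. y\<^sup>2) \<le> (\<Sum>y\<in>X \<union> Y. y\<^sup>2)" using that fin by (intro sum_mono2) auto
    also have "\<dots> \<le> (\<Sum>y\<in>X \<union> Y. y\<^sup>2) + (\<Sum>y\<in>X \<inter> Y. y\<^sup>2)" by (simp add: sum_nonneg)
    also have "\<dots> = (\<Sum>y\<in>X. y\<^sup>2) + (\<Sum>y\<in>Y. y\<^sup>2)" by (rule sum.union_inter[OF fin])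
    finally show ?thesis using X_sums Y_sums by simp
  qed
  have "Er \<subseteq> X \<union> Y" using Er_split R(4,5) X_in Y_in unfolding X_def[symmetric] Y_def[symmetric] by blast
  moreover have "Ec \<subseteq> X \<union> Y" using t.Er_split C(4,5) X_in Y_in unfolding X_def[symmetric] Y_def[symmetric] by blast
  ultimately have "(\<Sum>y\<in>Er. y\<^sup>2) \<le> 103402" "(\<Sum>x\<in>Ec. x\<^sup>2) \<le> 103402" using lines by blast+
  moreover have "(\<Sum>d\<in>D. d\<^sup>2) + (\<Sum>s\<in>S. s\<^sup>2) \<le> 4 * 199264"
    using near_X[OF R(4)[folded X_def]] near_Y[OF R(5)[folded Y_def]]
      near_X[OF L(4)[folded X_def]] near_Y[OF L(5)[folded Y_def]] sum_D sum_S by linarith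
  ultimately show False using moment_ge by simp
qed

text \<open>By \<open>reflection_pairs\<close> an empty line at distance \<open>2 * lam\<close> from its side has a perpendicular partner, and one of the
reflections moves both to \<open>h - 2 * lam\<close>.\<close>

lemma gap_box_absurd: False
proof -
  interpret f: gap_box h "uminus ` Er" Ec "uminus ` S" "uminus ` D" lam by (rule gap_flipped)
  interpret l: gap_box h Er "uminus ` Ec" S D lam by (rule gap_reflected)
  interpret fl: gap_box h "uminus ` Er" "uminus ` Ec" "uminus ` D" "uminus ` S" lam by (rule f.gap_reflected)
  define g where "g = h - 2 * lam"
  have g: "\<bar>g\<bar> \<le> h" "\<bar>- g\<bar> \<le> h" using lam_pos lam_half by (auto simp: g_def)
  show False
  proof (cases "g \<in> Er \<or> - g \<in> Er \<or> g \<in> Ec \<or> - g \<in> Ec")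
    case True
    then have "(g \<in> Er \<or> - g \<in> Er) \<and> (g \<in> Ec \<or> - g \<in> Ec)"
      using reflection_pairs(1,3)[OF g(1)] reflection_pairs(1,3)[OF g(2)] by auto
    then show False
      using no_lines_at_double_gap f.no_lines_at_double_gap l.no_lines_at_double_gap fl.no_lines_at_double_gap
      unfolding g_def[symmetric] mem_uminus_image by blast
  next
    case False
    define M where "M = {\<bar>e\<bar> |e. e \<in> Er \<union> Ec \<and> \<bar>e\<bar> < h - lam}"
    have sub: "M \<subseteq> {0..h}" using Er_bound Ec_bound by (auto simp: M_def)
    have finM: "finite M" using sub by (rule finite_subset) simp
    have neM: "M \<noteq> {}"
    proof
      assume "M = {}"
      then have "\<not> \<bar>e\<bar> < h - lam" if "e \<in> Er" for e using that by (auto simp: M_def)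
      then have "Er \<subseteq> {h, - h, h - lam, - (h - lam)}" using gap_r Er_bound by fastforce
      then have "card Er \<le> card {h, - h, h - lam, - (h - lam)}" by (intro card_mono) auto
      also have "\<dots> \<le> 4" by (simp add: card_insert_if)
      finally show False using card_Er by simp
    qed
    \<comment> \<open>The distance of the next empty line after those at distance lam.\<close>
    define a where "a = h - Max M"
    have "Max M \<in> M" using finM neM by (rule Max_in)
    then obtain e where e: "e \<in> Er \<union> Ec" "\<bar>e\<bar> < h - lam" "Max M = \<bar>e\<bar>" by (auto simp: M_def)
    have second: "\<bar>z\<bar> \<le> h - a" if "z \<in> Er \<union> Ec" "\<bar>z\<bar> < h - lam" for z
      using Max_ge[OF finM, of "\<bar>z\<bar>"] that by (auto simp: M_def a_def)
    have a: "lam < a" "a \<le> h" "\<bar>h - a\<bar> \<le> h" using e lam_pos by (auto simp: a_def)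
    have "\<bar>e\<bar> \<le> h" using Er_bound Ec_bound e(1) by blast
    then have "e \<in> Ec \<or> - e \<in> Ec" using e(1) reflection_pairs(3) by blast
    then have "h - a \<in> Ec \<or> h - a \<in> uminus ` Ec"
      using e(3) by (auto simp: a_def mem_uminus_image abs_if split: if_splits)
    then show False
    proof
      assume "h - a \<in> Ec"
      then show False
        using no_isolated_ends[of a] False a second unfolding g_def by blast
    next
      assume ha: "h - a \<in> uminus ` Ec"
      have "\<bar>z\<bar> \<le> h - a" if "z \<in> Er \<union> uminus ` Ec" "\<bar>z\<bar> < h - lam" for z
        using second[of z] second[of "- z"] that by (auto simp: mem_uminus_image)
      then show False
        using l.no_isolated_ends[of a] False a ha unfolding g_def mem_uminus_image by auto
    qed
  qed
qed

end

lemma (in tight_box) end_gap_absurd: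
  assumes lam: "0 < lam" "lam \<le> h" "h - lam \<in> Ec"
    and gap: "\<And>e. e \<in> Er \<union> Ec \<Longrightarrow> \<bar>e\<bar> < h \<Longrightarrow> \<bar>e\<bar> \<le> h - lam"
  shows False
proof -
  interpret s: side_gap h Er Ec D S lam
    by unfold_locales (use lam gap in auto)
  interpret f: tight_box h "uminus ` Er" Ec "uminus ` S" "uminus ` D" by (rule flipped)
  interpret fs: side_gap h "uminus ` Er" Ec "uminus ` S" "uminus ` D" lam
  proof unfold_locales
    fix y assume "y \<in> uminus ` Er" "\<bar>y\<bar> < h"
    then show "\<bar>y\<bar> \<le> h - lam" using gap[of "- y"] by (simp add: mem_uminus_image)
  qed (use lam in auto)
  have hl: "\<bar>h - lam\<bar> \<le> h" using lam by auto
  have "h - lam \<in> Er \<or> - (h - lam) \<in> Er" by (rule reflection_pairs(1)[OF hl lam(3)])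
  then have r: "h - lam \<in> Er" "- (h - lam) \<in> Er"
    using s.mirror_end fs.mirror_end by (auto simp: mem_uminus_image)
  have c: "- (h - lam) \<in> Ec" using reflection_pairs(4)[OF hl r] by blast
  interpret g: gap_box h Er Ec D S lam
    by unfold_locales (use lam gap r c in auto)
  show False by (rule g.gap_box_absurd)
qed

text \<open>The smallest distance \<open>lam\<close> of an inner empty line from a parallel side is attained by a column, because
\<open>reflection_pairs\<close> turns rows into columns, and after a reflection by the column \<open>h - lam\<close>.\<close>

theorem (in tight_box) no_tight_box: False
proof -
  define M where "M = {\<bar>e\<bar> |e. e \<in> Er \<union> Ec \<and> \<bar>e\<bar> < h}"
  have sub: "M \<subseteq> {0..h}" by (auto simp: M_def)
  have finM: "finite M" using sub by (rule finite_subset) simp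
  have neM: "M \<noteq> {}"
  proof
    assume "M = {}"
    then have "\<not> \<bar>e\<bar> < h" if "e \<in> Er" for e using that by (auto simp: M_def)
    then have "Er \<subseteq> {h, - h}" using Er_bound by fastforce
    then have "card Er \<le> card {h, - h}" by (intro card_mono) auto
    also have "\<dots> \<le> 2" by (simp add: card_insert_if)
    finally show False using card_Er by simp
  qed
  define lam where "lam = h - Max M"
  have "Max M \<in> M" using finM neM by (rule Max_in)
  then obtain e where e: "e \<in> Er \<union> Ec" "\<bar>e\<bar> < h" "Max M = \<bar>e\<bar>" by (auto simp: M_def)
  have gap: "\<bar>z\<bar> \<le> h - lam" if "z \<in> Er \<union> Ec" "\<bar>z\<bar> < h" for z
    using Max_ge[OF finM, of "\<bar>z\<bar>"] that by (auto simp: M_def lam_def)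
  have lam: "0 < lam" "lam \<le> h" using e by (auto simp: lam_def)
  have "\<bar>e\<bar> \<le> h" using e(2) by simp
  then have "e \<in> Ec \<or> - e \<in> Ec" using e(1) reflection_pairs(3) by blast
  then have "h - lam \<in> Ec \<or> h - lam \<in> uminus ` Ec"
    using e(3) by (auto simp: lam_def mem_uminus_image abs_if split: if_splits)
  then show False
  proof
    assume "h - lam \<in> Ec"
    then show False using end_gap_absurd[of lam] lam gap by blast
  next
    assume ec: "h - lam \<in> uminus ` Ec"
    interpret l: tight_box h Er "uminus ` Ec" S D by (rule reflected)
    have "\<bar>z\<bar> \<le> h - lam" if "z \<in> Er \<union> uminus ` Ec" "\<bar>z\<bar> < h" for z
      using gap[of z] gap[of "- z"] that by (auto simp: mem_uminus_image)
    then show False using l.end_gap_absurd[of lam] lam ec by blast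
  qed
qed

section \<open>Spencer's count along the outermost empty lines\<close>

lemma sum_card_fibres:
  assumes "finite Q" "finite A" "inj_on g A"
  shows "(\<Sum>s\<in>A. card {q \<in> Q. f q = g s}) = card {q \<in> Q. f q \<in> g ` A}"
proof -
  have "card {q \<in> Q. f q \<in> g ` A} = card (\<Union>s\<in>A. {q \<in> Q. f q = g s})"
    by (rule arg_cong[of _ _ card]) auto
  also have "\<dots> = (\<Sum>s\<in>A. card {q \<in> Q. f q = g s})"
    using assms by (intro card_UN_disjoint) (auto dest: inj_onD)
  finally show ?thesis by simp
qed

text \<open>Columns \<open>a\<close>, \<open>b\<close> and rows \<open>c\<close>, \<open>d\<close> are the outermost empty ones. The equations for \<open>q\<close> in \<open>covered\<close> also hold
when \<open>q\<close> is the square \<open>(x, y)\<close> itself, so this is domination.\<close>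

locale covered_board =
  fixes Q :: "(int \<times> int) set" and a b c d :: int
  assumes card_Q: "card Q = 81" and Q_board: "Q \<subseteq> {1..163} \<times> {1..163}"
    and a_col: "1 \<le> a" "a \<notin> fst ` Q" and b_col: "b \<le> 163" "b \<notin> fst ` Q"
    and c_row: "1 \<le> c" "c \<notin> snd ` Q" and d_row: "d \<le> 163" "d \<notin> snd ` Q"
    and outer_cols: "{1..163} - {a..b} \<subseteq> fst ` Q"
    and outer_rows: "{1..163} - {c..d} \<subseteq> snd ` Q"
    and covered: "x \<in> {1..163} \<Longrightarrow> y \<in> {1..163} \<Longrightarrow>
      \<exists>q\<in>Q. fst q = x \<or> snd q = y \<or> snd q - fst q = y - x \<or> snd q + fst q = y + x"
begin

lemma transposed: "covered_board (prod.swap ` Q) c d a b"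
proof (rule covered_board.intro)
  show "card (prod.swap ` Q) = 81" using card_Q by (simp add: card_image)
  show "prod.swap ` Q \<subseteq> {1..163} \<times> {1..163}" using Q_board by auto
  have im: "fst ` prod.swap ` Q = snd ` Q" "snd ` prod.swap ` Q = fst ` Q"
    by (simp_all add: image_image)
  show "1 \<le> c" "c \<notin> fst ` prod.swap ` Q" "d \<le> 163" "d \<notin> fst ` prod.swap ` Q"
    "1 \<le> a" "a \<notin> snd ` prod.swap ` Q" "b \<le> 163" "b \<notin> snd ` prod.swap ` Q"
    "{1..163} - {c..d} \<subseteq> fst ` prod.swap ` Q" "{1..163} - {a..b} \<subseteq> snd ` prod.swap ` Q"
    unfolding im using a_col b_col c_row d_row outer_cols outer_rows by auto
  fix x y :: int assume "x \<in> {1..163}" "y \<in> {1..163}"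
  then obtain q where "q \<in> Q"
    "fst q = y \<or> snd q = x \<or> snd q - fst q = x - y \<or> snd q + fst q = x + y"
    using covered[of y x] by blast
  then show "\<exists>q\<in>prod.swap ` Q. fst q = x \<or> snd q = y \<or> snd q - fst q = y - x \<or> snd q + fst q = y + x"
    by (intro bexI[of _ "prod.swap q"]) auto
qed

lemma finite_Q: "finite Q" using card_Q card.infinite by fastforce

lemma box_wide: "81 \<le> b - a"
proof -
  have "82 \<le> card ({1..163} - fst ` Q)"
    using diff_card_le_card_Diff[of "fst ` Q" "{1..163}"] finite_Q card_image_le[OF finite_Q, of fst] card_Q
    by simp
  also have "\<dots> \<le> card {a..b}" by (rule card_mono) (use outer_cols in auto)
  finally show ?thesis by simp
qed

definition row_load where "row_load y = card {q \<in> Q. snd q = y}"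
definition diff_load where "diff_load t = card {q \<in> Q. snd q - fst q = t}"
definition sum_load where "sum_load t = card {q \<in> Q. snd q + fst q = t}"

lemma row_load_pos: "0 < row_load y \<longleftrightarrow> y \<in> snd ` Q"
  and diff_load_pos: "0 < diff_load t \<longleftrightarrow> t \<in> (\<lambda>q. snd q - fst q) ` Q"
  and sum_load_pos: "0 < sum_load t \<longleftrightarrow> t \<in> (\<lambda>q. snd q + fst q) ` Q"
proof -
  have "0 < card {q \<in> Q. f q = t} \<longleftrightarrow> t \<in> f ` Q" for f :: "int \<times> int \<Rightarrow> int" and t
    using finite_Q by (auto simp: card_gt_0_iff)
  from this[of snd y] this[of "\<lambda>q. snd q - fst q" t] this[of "\<lambda>q. snd q + fst q" t]
  show "0 < row_load y \<longleftrightarrow> y \<in> snd ` Q" "0 < diff_load t \<longleftrightarrow> t \<in> (\<lambda>q. snd q - fst q) ` Q"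
    "0 < sum_load t \<longleftrightarrow> t \<in> (\<lambda>q. snd q + fst q) ` Q"
    unfolding row_load_def diff_load_def sum_load_def .
qed

lemma load_pos:
  assumes "x \<in> {a, b}" "y \<in> {1..163}"
  shows "1 \<le> row_load y + diff_load (y - x) + sum_load (y + x)"
proof -
  have "x \<in> {1..163}" "x \<notin> fst ` Q" using assms a_col b_col box_wide by auto
  then obtain q where q: "q \<in> Q" "snd q = y \<or> snd q - fst q = y - x \<or> snd q + fst q = y + x"
    using covered[of x y] assms(2) by blast
  have "y \<in> snd ` Q \<or> y - x \<in> (\<lambda>q. snd q - fst q) ` Q \<or> y + x \<in> (\<lambda>q. snd q + fst q) ` Q"
    using q(2) imageI[OF q(1), of snd] imageI[OF q(1), of "\<lambda>q. snd q - fst q"]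
      imageI[OF q(1), of "\<lambda>q. snd q + fst q"] by presburger
  then show ?thesis unfolding row_load_pos[symmetric] diff_load_pos[symmetric] sum_load_pos[symmetric] by linarith
qed

lemma inj_diff: "inj_on (\<lambda>s. snd s - fst s) ({a, b} \<times> {w..<w + (b - a)})"
  and inj_sum: "inj_on (\<lambda>s. snd s + fst s) ({a, b} \<times> {w..<w + (b - a)})"
  by (auto simp: inj_on_def)

text \<open>Double counting of the covering of the squares of two columns in \<open>b - a\<close> consecutive rows. The window is just short
enough for a diagonal to meet it at most once.\<close>

lemma window_load:
  fixes w defines "A \<equiv> {a, b} \<times> {w..<w + (b - a)}"
  shows "(\<Sum>s\<in>A. row_load (snd s) + diff_load (snd s - fst s) + sum_load (snd s + fst s)) =
    2 * card {q \<in> Q. snd q \<in> {w..<w + (b - a)}} +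
    card {q \<in> Q. snd q - fst q \<in> (\<lambda>s. snd s - fst s) ` A} +
    card {q \<in> Q. snd q + fst q \<in> (\<lambda>s. snd s + fst s) ` A}"
proof -
  have "(\<Sum>s\<in>A. row_load (snd s)) = (\<Sum>x\<in>{a,b}. \<Sum>y\<in>{w..<w + (b - a)}. row_load y)"
    unfolding A_def by (subst sum.cartesian_product) (simp add: case_prod_beta)
  also have "\<dots> = 2 * (\<Sum>y\<in>{w..<w + (b - a)}. row_load y)" using box_wide by simp
  also have "(\<Sum>y\<in>{w..<w + (b - a)}. row_load y) = card {q \<in> Q. snd q \<in> {w..<w + (b - a)}}"
    unfolding row_load_def
    using sum_card_fibres[OF finite_Q, of "{w..<w + (b - a)}" "\<lambda>y. y" snd] by simp
  finally have 1: "(\<Sum>s\<in>A. row_load (snd s)) = 2 * card {q \<in> Q. snd q \<in> {w..<w + (b - a)}}" .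
  have 2: "(\<Sum>s\<in>A. diff_load (snd s - fst s)) = card {q \<in> Q. snd q - fst q \<in> (\<lambda>s. snd s - fst s) ` A}"
    unfolding diff_load_def A_def using inj_diff by (intro sum_card_fibres finite_Q) auto
  have 3: "(\<Sum>s\<in>A. sum_load (snd s + fst s)) = card {q \<in> Q. snd q + fst q \<in> (\<lambda>s. snd s + fst s) ` A}"
    unfolding sum_load_def A_def using inj_sum by (intro sum_card_fibres finite_Q) auto
  show ?thesis unfolding sum.distrib 1 2 3 ..
qed

lemma window_load_ge:
  assumes "1 \<le> w" "w + (b - a) \<le> 164"
  shows "2 * nat (b - a) \<le> (\<Sum>s\<in>{a, b} \<times> {w..<w + (b - a)}.
      row_load (snd s) + diff_load (snd s - fst s) + sum_load (snd s + fst s))"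
proof -
  have "a \<noteq> b" using box_wide by auto
  then have "(\<Sum>s\<in>{a, b} \<times> {w..<w + (b - a)}. 1) = 2 * nat (b - a)"
    by (simp add: card_cartesian_product)
  moreover have "(\<Sum>s\<in>{a, b} \<times> {w..<w + (b - a)}. 1) \<le> (\<Sum>s\<in>{a, b} \<times> {w..<w + (b - a)}.
      row_load (snd s) + diff_load (snd s - fst s) + sum_load (snd s + fst s))"
    by (rule sum_mono) (use load_pos assms in auto)
  ultimately show ?thesis by (simp only:)
qed

lemma queens_in_window:
  assumes "M \<subseteq> snd ` Q" "M \<inter> W = {}"
  shows "card {q \<in> Q. snd q \<in> W} + card M \<le> 81"
proof -
  have "card M \<le> card {q \<in> Q. snd q \<notin> W}"
  proof (rule surj_card_le)
    show "finite {q \<in> Q. snd q \<notin> W}" using finite_Q by simp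
    show "M \<subseteq> snd ` {q \<in> Q. snd q \<notin> W}"
    proof
      fix y assume "y \<in> M"
      then have "y \<in> snd ` Q" "y \<notin> W" using assms by blast+
      then show "y \<in> snd ` {q \<in> Q. snd q \<notin> W}" by blast
    qed
  qed
  moreover have "card {q \<in> Q. snd q \<in> W} + card {q \<in> Q. snd q \<notin> W} = card ({q \<in> Q. snd q \<in> W} \<union> {q \<in> Q. snd q \<notin> W})"
    by (rule card_Un_disjoint[symmetric]) (use finite_Q in auto)
  moreover have "{q \<in> Q. snd q \<in> W} \<union> {q \<in> Q. snd q \<notin> W} = Q" by blast
  ultimately have "card M \<le> card {q \<in> Q. snd q \<notin> W}"
    "card {q \<in> Q. snd q \<in> W} + card {q \<in> Q. snd q \<notin> W} = 81" using card_Q by simp_all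
  then show ?thesis by linarith
qed

lemma card_queens_le: "card {q \<in> Q. P q} \<le> 81"
  unfolding card_Q[symmetric] by (rule card_mono[OF finite_Q]) auto

text \<open>If the box were wider than high, all its rows would fit into the window, and the window together with the occupied
rows outside would require 82 queens.\<close>

lemma box_not_wider: "b - a \<le> d - c"
proof (rule ccontr)
  assume less: "\<not> b - a \<le> d - c"
  \<comment> \<open>The window starts at row c, unless it must be moved down to stay on the board.\<close>
  define w where "w = min c (164 - (b - a))"
  have w: "1 \<le> w" "w + (b - a) \<le> 164" "{c..d} \<subseteq> {w..<w + (b - a)}" "{w..<w + (b - a)} \<subseteq> {1..163}"
    using less a_col b_col c_row d_row unfolding w_def by auto
  have "card ({1..163} - {w..<w + (b - a)}) = 163 - nat (b - a)"
    using w by (subst card_Diff_subset) auto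
  then have "card {q \<in> Q. snd q \<in> {w..<w + (b - a)}} + (163 - nat (b - a)) \<le> 81"
    using queens_in_window[of "{1..163} - {w..<w + (b - a)}" "{w..<w + (b - a)}"] outer_rows w(3) by auto
  moreover have "2 * nat (b - a) \<le> 2 * card {q \<in> Q. snd q \<in> {w..<w + (b - a)}} + 81 + 81"
    by (rule order_trans[OF window_load_ge[OF w(1,2), unfolded window_load]])
      (intro add_mono card_queens_le order_refl)
  moreover have "nat (b - a) \<le> 162" using a_col b_col by linarith
  ultimately show False by linarith
qed

lemma box_square: "d - c = b - a"
  using box_not_wider covered_board.box_not_wider[OF transposed] by linarith

text \<open>For a square box the window misses one of the rows \<open>c\<close>, \<open>d\<close>, which costs exactly the slack used in
\<open>box_not_wider\<close>. Now both sides of the count agree, and every estimate in it is an equality. The two positions of the window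
together contain all rows of the box.\<close>

lemma tight_window:
  assumes w: "w = c \<or> w = c + 1"
  defines "W \<equiv> {w..<w + (b - a)}"
  shows "card {q \<in> Q. snd q \<in> W} = nat (b - a) - 81"
    and "q \<in> Q \<Longrightarrow> snd q - fst q \<in> (\<lambda>s. snd s - fst s) ` ({a, b} \<times> W)"
    and "q \<in> Q \<Longrightarrow> snd q + fst q \<in> (\<lambda>s. snd s + fst s) ` ({a, b} \<times> W)"
    and "x \<in> {a, b} \<Longrightarrow> y \<in> W \<Longrightarrow> row_load y + diff_load (y - x) + sum_load (y + x) = 1"
proof -
  have sub: "W \<subseteq> {c..d}" "{c..d} \<subseteq> {1..163}"
    using w box_square c_row d_row unfolding W_def by auto
  have "card ({1..163} - {c..d}) = 162 - nat (b - a)"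
    using sub(2) box_square box_wide by (subst card_Diff_subset) auto
  then have "card {q \<in> Q. snd q \<in> W} + (162 - nat (b - a)) \<le> 81"
    using queens_in_window[of "{1..163} - {c..d}" W] outer_rows sub by auto
  moreover have "nat (b - a) \<le> 162" "81 \<le> nat (b - a)" using a_col b_col box_wide by linarith+
  ultimately have in_le: "card {q \<in> Q. snd q \<in> W} \<le> nat (b - a) - 81" by linarith
  let ?A = "{a, b} \<times> W"
  let ?l = "\<lambda>s. row_load (snd s) + diff_load (snd s - fst s) + sum_load (snd s + fst s)"
  have ge: "2 * nat (b - a) \<le> sum ?l ?A"
    unfolding W_def by (rule window_load_ge) (use w c_row d_row box_square in linarith)+
  have eq: "sum ?l ?A = 2 * card {q \<in> Q. snd q \<in> W} +
    card {q \<in> Q. snd q - fst q \<in> (\<lambda>s. snd s - fst s) ` ?A} +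
    card {q \<in> Q. snd q + fst q \<in> (\<lambda>s. snd s + fst s) ` ?A}"
    unfolding W_def by (rule window_load)
  have le: "card {q \<in> Q. snd q - fst q \<in> (\<lambda>s. snd s - fst s) ` ?A} \<le> 81"
    "card {q \<in> Q. snd q + fst q \<in> (\<lambda>s. snd s + fst s) ` ?A} \<le> 81" by (rule card_queens_le)+
  show "card {q \<in> Q. snd q \<in> W} = nat (b - a) - 81"
    using in_le ge le \<open>81 \<le> nat (b - a)\<close> unfolding eq by linarith
  have all: "card {q \<in> Q. snd q - fst q \<in> (\<lambda>s. snd s - fst s) ` ?A} = card Q"
    "card {q \<in> Q. snd q + fst q \<in> (\<lambda>s. snd s + fst s) ` ?A} = card Q"
    unfolding card_Q using in_le ge le \<open>81 \<le> nat (b - a)\<close> unfolding eq by linarith+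
  have "{q \<in> Q. snd q - fst q \<in> (\<lambda>s. snd s - fst s) ` ?A} = Q"
    "{q \<in> Q. snd q + fst q \<in> (\<lambda>s. snd s + fst s) ` ?A} = Q"
    using card_subset_eq[OF finite_Q _ all(1)] card_subset_eq[OF finite_Q _ all(2)] by simp_all
  then show "q \<in> Q \<Longrightarrow> snd q - fst q \<in> (\<lambda>s. snd s - fst s) ` ?A"
    "q \<in> Q \<Longrightarrow> snd q + fst q \<in> (\<lambda>s. snd s + fst s) ` ?A" by blast+
  assume xy: "x \<in> {a, b}" "y \<in> W"
  have "sum ?l ?A \<le> 2 * nat (b - a)"
    using in_le le \<open>81 \<le> nat (b - a)\<close> unfolding eq by linarith
  also have "\<dots> = (\<Sum>s\<in>?A. 1)"
    using \<open>81 \<le> nat (b - a)\<close> unfolding W_def by (auto simp: card_cartesian_product card_insert_if)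
  finally have le1: "sum ?l ?A \<le> (\<Sum>s\<in>?A. 1)" .
  have ge1: "1 \<le> ?l s" if "s \<in> ?A" for s
    using that load_pos[of "fst s" "snd s"] sub by auto
  have "(\<Sum>s\<in>?A. 1) = sum ?l ?A"
    by (rule antisym[OF sum_mono[OF ge1] le1])
  then have "1 = ?l (x, y)"
    by (rule sum_mono_inv[OF _ ge1]) (use xy in \<open>auto simp: W_def\<close>)
  then show "row_load y + diff_load (y - x) + sum_load (y + x) = 1" by simp
qed

lemma side_tight:
  assumes "x \<in> {a, b}" "y \<in> {c..d}"
  shows "row_load y + diff_load (y - x) + sum_load (y + x) = 1"
proof (cases "y = d")
  case True
  then show ?thesis using tight_window(4)[of "c + 1" x y] assms box_square box_wide by simp
next
  case False
  then show ?thesis using tight_window(4)[of c x y] assms box_square by simp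
qed

lemma diff_in_window:
  assumes "q \<in> Q"
  obtains x y where "x \<in> {a, b}" "y \<in> {c..<c + (b - a)}" "snd q - fst q = y - x"
  using tight_window(2)[of c q] assms by auto

lemma sum_in_window:
  assumes "q \<in> Q"
  obtains x y where "x \<in> {a, b}" "y \<in> {c..<c + (b - a)}" "snd q + fst q = y + x"
  using tight_window(3)[of c q] assms by auto

lemma diff_bounds:
  assumes "q \<in> Q" shows "c - b \<le> snd q - fst q" "snd q - fst q \<le> d - a"
proof -
  obtain x y where "x \<in> {a, b}" "y \<in> {c..<c + (b - a)}" "snd q - fst q = y - x"
    using diff_in_window[OF assms] .
  then show "c - b \<le> snd q - fst q" "snd q - fst q \<le> d - a" using box_square box_wide by auto
qed

lemma sum_bounds:
  assumes "q \<in> Q" shows "c + a \<le> snd q + fst q" "snd q + fst q \<le> d + b"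
proof -
  obtain x y where "x \<in> {a, b}" "y \<in> {c..<c + (b - a)}" "snd q + fst q = y + x"
    using sum_in_window[OF assms] .
  then show "c + a \<le> snd q + fst q" "snd q + fst q \<le> d + b" using box_square box_wide by auto
qed

lemma diff_load_le: "diff_load t \<le> 1"
proof (cases "t \<in> (\<lambda>q. snd q - fst q) ` Q")
  case True
  then obtain q where q: "q \<in> Q" "t = snd q - fst q" by blast
  obtain x y where "x \<in> {a, b}" "y \<in> {c..<c + (b - a)}" "t = y - x"
    using diff_in_window[OF q(1)] unfolding q(2) .
  then show ?thesis using side_tight[of x y] box_square by auto
next
  case False then show ?thesis using diff_load_pos[of t] by linarith
qed

lemma sum_load_le: "sum_load t \<le> 1"
proof (cases "t \<in> (\<lambda>q. snd q + fst q) ` Q")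
  case True
  then obtain q where q: "q \<in> Q" "t = snd q + fst q" by blast
  obtain x y where "x \<in> {a, b}" "y \<in> {c..<c + (b - a)}" "t = y + x"
    using sum_in_window[OF q(1)] unfolding q(2) .
  then show ?thesis using side_tight[of x y] box_square by auto
next
  case False then show ?thesis using sum_load_pos[of t] by linarith
qed

end

section \<open>A cover by 81 queens yields a tight box\<close>

context covered_board
begin

lemma card_empty_rows: "card ({1..163} - snd ` Q) = 82"
proof -
  let ?W = "{c..<c + (b - a)}"
  have "nat (b - a) - 81 = (\<Sum>y\<in>?W. row_load y)"
    unfolding row_load_def using sum_card_fibres[OF finite_Q, of ?W "\<lambda>y. y" snd] tight_window(1)[of c] by simp
  also have "\<dots> = (\<Sum>y\<in>?W \<inter> snd ` Q. row_load y)"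
    by (rule sum.mono_neutral_right) (use row_load_pos in auto)
  also have "\<dots> \<le> (\<Sum>y\<in>?W \<inter> snd ` Q. 1)"
  proof (rule sum_mono)
    fix y assume "y \<in> ?W \<inter> snd ` Q"
    then show "row_load y \<le> 1" using side_tight[of a y] box_square by simp
  qed
  finally have "nat (b - a) - 81 \<le> card (?W \<inter> snd ` Q)" by simp
  moreover have "card (?W - snd ` Q) + card (?W \<inter> snd ` Q) = card ?W"
    by (metis add.commute card_Int_Diff finite_atLeastLessThan_int)
  ultimately have "card (?W - snd ` Q) \<le> 81" using box_wide by simp
  moreover have "{1..163} - snd ` Q \<subseteq> insert d (?W - snd ` Q)" using outer_rows box_square by auto
  then have "card ({1..163} - snd ` Q) \<le> card (insert d (?W - snd ` Q))" by (intro card_mono) auto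
  moreover have "card (insert d (?W - snd ` Q)) \<le> Suc (card (?W - snd ` Q))" by (rule card_insert_le_m1) auto
  moreover have "82 \<le> card ({1..163} - snd ` Q)"
    using diff_card_le_card_Diff[of "snd ` Q" "{1..163}"] finite_Q card_image_le[OF finite_Q, of snd] card_Q
    by simp
  ultimately show ?thesis by linarith
qed

lemma inj_on_row: "inj_on snd Q"
proof (rule eq_card_imp_inj_on[OF finite_Q])
  have "snd ` Q \<subseteq> {1..163}" using Q_board by auto
  then show "card (snd ` Q) = card Q"
    using card_empty_rows card_Diff_subset[of "snd ` Q" "{1..163}"] finite_Q card_mono[of "{1..163}" "snd ` Q"]
    unfolding card_Q by simp
qed

lemma card_empty_cols: "card ({1..163} - fst ` Q) = 82"
  using covered_board.card_empty_rows[OF transposed] by (simp add: image_image)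

lemma inj_on_load:
  assumes "\<And>t. card {q \<in> Q. f q = t} \<le> 1"
  shows "inj_on f Q"
proof (rule inj_onI)
  fix p q assume pq: "p \<in> Q" "q \<in> Q" "f p = f q"
  have "finite {r \<in> Q. f r = f q}" using finite_Q by simp
  then have "\<forall>r\<in>{r \<in> Q. f r = f q}. \<forall>s\<in>{r \<in> Q. f r = f q}. r = s"
    using assms[of "f q"] by (simp only: card_le_Suc0_iff_eq One_nat_def)
  then show "p = q" using pq by blast
qed

lemma inj_on_diff: "inj_on (\<lambda>q. snd q - fst q) Q"
  using diff_load_le unfolding diff_load_def by (rule inj_on_load)

lemma inj_on_sum: "inj_on (\<lambda>q. snd q + fst q) Q"
  using sum_load_le unfolding sum_load_def by (rule inj_on_load)

text \<open>The rows \<open>c\<close> to \<open>d - 1\<close> contain \<open>b - a - 81\<close> queens by \<open>tight_window\<close>, and row \<open>d\<close> contains none.\<close>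

lemma card_outer_row_queens: "int (card {q \<in> Q. snd q \<notin> {c..d}}) = 162 - (b - a)"
proof -
  have "snd q \<notin> {c..d} \<longleftrightarrow> snd q \<notin> {c..<c + (b - a)}" if "q \<in> Q" for q
  proof -
    have "snd q \<noteq> d" using that d_row by blast
    then show ?thesis using box_square by auto
  qed
  then have "{q \<in> Q. snd q \<notin> {c..d}} = Q - {q \<in> Q. snd q \<in> {c..<c + (b - a)}}" by blast
  moreover have "card (Q - {q \<in> Q. snd q \<in> {c..<c + (b - a)}}) = 81 - (nat (b - a) - 81)"
    using tight_window(1)[of c] finite_Q card_Q by (subst card_Diff_subset) auto
  ultimately show ?thesis using box_wide a_col b_col by simp
qed

text \<open>A queen with neither coordinate in the range of the box lies diagonally off a corner, and then one of its diagonals misses the box.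
So the queens off the box horizontally and those off it vertically are different, and there are
\<open>162 - (b - a)\<close> of each kind among the 81 queens.\<close>

lemma box_large: "122 \<le> b - a"
proof -
  have cols: "int (card {q \<in> Q. fst q \<notin> {a..b}}) = 162 - (d - c)"
  proof -
    have "{q \<in> prod.swap ` Q. snd q \<notin> {a..b}} = prod.swap ` {q \<in> Q. fst q \<notin> {a..b}}" by auto
    then show ?thesis using covered_board.card_outer_row_queens[OF transposed] by (simp add: card_image)
  qed
  have "{q \<in> Q. fst q \<notin> {a..b}} \<inter> {q \<in> Q. snd q \<notin> {c..d}} = {}"
  proof -
    have "fst q \<in> {a..b} \<or> snd q \<in> {c..d}" if "q \<in> Q" for q
      unfolding atLeastAtMost_iff using diff_bounds[OF that] sum_bounds[OF that] box_square by arith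
    then show ?thesis by blast
  qed
  then have "card {q \<in> Q. fst q \<notin> {a..b}} + card {q \<in> Q. snd q \<notin> {c..d}} =
      card ({q \<in> Q. fst q \<notin> {a..b}} \<union> {q \<in> Q. snd q \<notin> {c..d}})"
    by (intro card_Un_disjoint[symmetric]) (use finite_Q in auto)
  also have "\<dots> \<le> card Q" by (rule card_mono[OF finite_Q]) auto
  finally show ?thesis using cols card_outer_row_queens box_square card_Q by linarith
qed

text \<open>If \<open>b - a\<close> is odd, every row of the window contains one square with \<open>x + y\<close> even, in column \<open>a\<close> or \<open>b\<close>.
These squares are covered once each, by \<open>b - a - 81\<close> queens along their rows and otherwise by the diagonals of the queens
with \<open>x + y\<close> even, each of which contributes two. So twice the number of these queens would be 81.\<close>

lemma box_even: "even (b - a)"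
proof (rule ccontr)
  assume odd: "odd (b - a)"
  let ?W = "{c..<c + (b - a)}"
  define x where "x y = (if even (y + a) then a else b)" for y
  define E where "E = {q \<in> Q. even (snd q + fst q)}"
  have x: "x y \<in> {a, b}" "even (y + x y)" "even (y - x y)" for y unfolding x_def using odd by auto
  have x_unique: "v = x y" if "v \<in> {a, b}" "even (y + v)" for v y unfolding x_def using that odd by auto
  have inj: "inj_on (\<lambda>y. y - x y) ?W" "inj_on (\<lambda>y. y + x y) ?W"
    unfolding x_def by (auto simp: inj_on_def split: if_splits)
  have "(\<Sum>y\<in>?W. row_load y + diff_load (y - x y) + sum_load (y + x y)) = (\<Sum>y\<in>?W. 1)"
    by (rule sum.cong[OF refl], rule tight_window(4)) (use x in auto)
  then have "(\<Sum>y\<in>?W. row_load y) + (\<Sum>y\<in>?W. diff_load (y - x y)) + (\<Sum>y\<in>?W. sum_load (y + x y)) = nat (b - a)"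
    by (simp add: sum.distrib)
  moreover have "(\<Sum>y\<in>?W. row_load y) = nat (b - a) - 81"
    unfolding row_load_def using sum_card_fibres[OF finite_Q, of ?W "\<lambda>y. y" snd] tight_window(1)[of c] by simp
  moreover have "(\<Sum>y\<in>?W. diff_load (y - x y)) = card E"
  proof -
    have "snd q - fst q \<in> (\<lambda>y. y - x y) ` ?W \<longleftrightarrow> even (snd q + fst q)" if q: "q \<in> Q" for q
    proof
      assume "snd q - fst q \<in> (\<lambda>y. y - x y) ` ?W"
      then obtain y where "snd q - fst q = y - x y" by blast
      then have "even (snd q - fst q)" using x(3) by simp
      then show "even (snd q + fst q)" by simp
    next
      assume ev: "even (snd q + fst q)"
      obtain v y where v: "v \<in> {a, b}" and y: "y \<in> ?W" and e: "snd q - fst q = y - v"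
        using diff_in_window[OF q] .
      have "even (snd q - fst q)" using ev by simp
      then have "even (y - v)" unfolding e .
      then have "v = x y" using x_unique[OF v, of y] by simp
      then show "snd q - fst q \<in> (\<lambda>y. y - x y) ` ?W" using y e by blast
    qed
    then have "{q \<in> Q. snd q - fst q \<in> (\<lambda>y. y - x y) ` ?W} = E" unfolding E_def by blast
    then show ?thesis unfolding diff_load_def using sum_card_fibres[OF finite_Q _ inj(1)] by simp
  qed
  moreover have "(\<Sum>y\<in>?W. sum_load (y + x y)) = card E"
  proof -
    have "snd q + fst q \<in> (\<lambda>y. y + x y) ` ?W \<longleftrightarrow> even (snd q + fst q)" if q: "q \<in> Q" for q
    proof
      assume "snd q + fst q \<in> (\<lambda>y. y + x y) ` ?W"
      then obtain y where "snd q + fst q = y + x y" by blast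
      then show "even (snd q + fst q)" using x(2) by simp
    next
      assume ev: "even (snd q + fst q)"
      obtain v y where v: "v \<in> {a, b}" and y: "y \<in> ?W" and e: "snd q + fst q = y + v"
        using sum_in_window[OF q] .
      have "v = x y" using x_unique[OF v, of y] ev unfolding e by simp
      then show "snd q + fst q \<in> (\<lambda>y. y + x y) ` ?W" using y e by blast
    qed
    then have "{q \<in> Q. snd q + fst q \<in> (\<lambda>y. y + x y) ` ?W} = E" unfolding E_def by blast
    then show ?thesis unfolding sum_load_def using sum_card_fibres[OF finite_Q _ inj(2)] by simp
  qed
  ultimately have "2 * card E = 81" using box_large by linarith
  then show False by presburger
qed

lemma sum_square_rows:
  "(\<Sum>q\<in>Q. (snd q - m)\<^sup>2) + (\<Sum>y\<in>{1..163} - snd ` Q. (y - m)\<^sup>2) = 360882 + 163 * (82 - m)\<^sup>2"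
proof -
  have "(\<Sum>y\<in>snd ` Q. (y - m)\<^sup>2) = (\<Sum>q\<in>Q. (snd q - m)\<^sup>2)"
    by (simp add: sum.reindex[OF inj_on_row])
  moreover have "(\<Sum>y\<in>{1..163} - snd ` Q. (y - m)\<^sup>2) + (\<Sum>y\<in>snd ` Q. (y - m)\<^sup>2) = (\<Sum>y\<in>{1..163}. (y - m)\<^sup>2)"
    by (rule sum.subset_diff[symmetric]) (use Q_board in auto)
  moreover have "(\<Sum>y\<in>{1..163}. (y - m)\<^sup>2) = 360882 + 163 * (82 - m)\<^sup>2"
  proof -
    have "(\<Sum>y\<in>{1..163}. (y - m)\<^sup>2) =
        (\<Sum>y\<in>{1..163}. (y - 82)\<^sup>2) + (\<Sum>y\<in>{1..163}. 2 * (82 - m) * (y - 82)) + (\<Sum>y\<in>{1..163::int}. (82 - m)\<^sup>2)"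
      unfolding sum.distrib[symmetric] by (rule sum.cong) (auto simp: power2_eq_square algebra_simps)
    also have "(\<Sum>y\<in>{1..163}. 2 * (82 - m) * (y - 82)) = 2 * (82 - m) * (\<Sum>y\<in>{1..163}. y - 82)"
      by (rule sum_distrib_left[symmetric])
    also have "(\<Sum>y\<in>{1..163::int}. y - 82) = 0" by code_simp
    also have "(\<Sum>y\<in>{1..163::int}. (y - 82)\<^sup>2) = 360882" by code_simp
    finally show ?thesis by simp
  qed
  ultimately show ?thesis by linarith
qed

lemma sum_square_cols:
  "(\<Sum>q\<in>Q. (fst q - m)\<^sup>2) + (\<Sum>x\<in>{1..163} - fst ` Q. (x - m)\<^sup>2) = 360882 + 163 * (82 - m)\<^sup>2"
  using covered_board.sum_square_rows[OF transposed, of m]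
  by (simp add: image_image sum.reindex)

lemma box_halves:
  obtains h m k where "a = m - h" "b = m + h" "c = k - h" "d = k + h" "61 \<le> h" "h \<le> 81"
    "h = 81 \<longrightarrow> m = 82 \<and> k = 82"
proof -
  obtain h where h: "b - a = 2 * h" using box_even by (elim evenE)
  show ?thesis
    by (rule that[of "a + h" h "c + h"]) (use h box_square box_large a_col b_col c_row d_row in auto)
qed

text \<open>Centre the coordinates at the box. The parallelogram law, summed over the queens, gives the condition on the sums of
squares.\<close>

theorem no_covered_board: False
proof -
  obtain h m k where ab: "a = m - h" "b = m + h" and cd: "c = k - h" "d = k + h"
    and h: "61 \<le> h" "h \<le> 81" and full: "h = 81 \<longrightarrow> m = 82 \<and> k = 82" by (rule box_halves)
  define Er where "Er = (\<lambda>y. y - k) ` ({1..163} - snd ` Q)"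
  define Ec where "Ec = (\<lambda>x. x - m) ` ({1..163} - fst ` Q)"
  define D where "D = (\<lambda>q. (snd q - k) - (fst q - m)) ` Q"
  define S where "S = (\<lambda>q. (snd q - k) + (fst q - m)) ` Q"
  have inj: "inj_on (\<lambda>q. (snd q - k) - (fst q - m)) Q" "inj_on (\<lambda>q. (snd q - k) + (fst q - m)) Q"
    using inj_on_diff inj_on_sum by (auto simp: inj_on_def)
  have shift: "y \<in> (\<lambda>v. v - k) ` A \<longleftrightarrow> y + k \<in> A" for y k :: int and A
    by force
  have mem_Er: "y \<in> Er \<longleftrightarrow> y + k \<in> {1..163} \<and> y + k \<notin> snd ` Q" for y
    unfolding Er_def shift by blast
  have mem_Ec: "x \<in> Ec \<longleftrightarrow> x + m \<in> {1..163} \<and> x + m \<notin> fst ` Q" for x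
    unfolding Ec_def shift by blast
  have mem_D: "t \<in> D \<longleftrightarrow> 0 < diff_load (t + k - m)" for t
    unfolding D_def diff_load_pos image_iff by (rule bex_cong) auto
  have mem_S: "t \<in> S \<longleftrightarrow> 0 < sum_load (t + k + m)" for t
    unfolding S_def sum_load_pos image_iff by (rule bex_cong) auto
  have row_side: "(y \<in> Er \<longleftrightarrow> y - x \<in> D \<or> y + x \<in> S) \<and> \<not> (y - x \<in> D \<and> y + x \<in> S)"
    if "\<bar>y\<bar> \<le> h" "x = h \<or> x = - h" for x y
  proof -
    have "row_load (y + k) + diff_load (y + k - (x + m)) + sum_load (y + k + (x + m)) = 1"
      by (rule side_tight) (use that ab cd in auto)
    moreover have "y \<in> Er \<longleftrightarrow> row_load (y + k) = 0"
      using row_load_pos[of "y + k"] mem_Er[of y] that cd c_row d_row by auto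
    moreover have "y + k - (x + m) = y - x + k - m" "y + k + (x + m) = y + x + k + m" by simp_all
    ultimately show ?thesis unfolding mem_D mem_S by auto
  qed
  have col_side: "(x \<in> Ec \<longleftrightarrow> y - x \<in> D \<or> y + x \<in> S) \<and> \<not> (y - x \<in> D \<and> y + x \<in> S)"
    if "\<bar>x\<bar> \<le> h" "y = h \<or> y = - h" for x y
  proof -
    interpret t: covered_board "prod.swap ` Q" c d a b by (rule transposed)
    have "t.row_load (x + m) + t.diff_load (x + m - (y + k)) + t.sum_load (x + m + (y + k)) = 1"
      by (rule t.side_tight) (use that ab cd in auto)
    moreover have "x \<in> Ec \<longleftrightarrow> t.row_load (x + m) = 0"
      using t.row_load_pos[of "x + m"] mem_Ec[of x] that ab a_col b_col by (auto simp: image_image)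
    moreover have "0 < t.diff_load (x + m - (y + k)) \<longleftrightarrow> y - x \<in> D"
      unfolding t.diff_load_pos D_def image_image image_iff by (rule bex_cong) auto
    moreover have "0 < t.sum_load (x + m + (y + k)) \<longleftrightarrow> y + x \<in> S"
      unfolding t.sum_load_pos S_def image_image image_iff by (rule bex_cong) auto
    ultimately show ?thesis by auto
  qed
  have moment: "(\<Sum>t\<in>D. t\<^sup>2) + (\<Sum>t\<in>S. t\<^sup>2) =
      2 * (721764 + 163 * (82 - k)\<^sup>2 + 163 * (82 - m)\<^sup>2 - (\<Sum>y\<in>Er. y\<^sup>2) - (\<Sum>x\<in>Ec. x\<^sup>2))"
  proof -
    have "(\<Sum>t\<in>D. t\<^sup>2) + (\<Sum>t\<in>S. t\<^sup>2) = (\<Sum>q\<in>Q. 2 * (snd q - k)\<^sup>2 + 2 * (fst q - m)\<^sup>2)"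
      unfolding D_def S_def
      by (simp add: sum.reindex inj sum.distrib[symmetric]) (simp add: power2_eq_square algebra_simps)
    also have "\<dots> = 2 * (\<Sum>q\<in>Q. (snd q - k)\<^sup>2) + 2 * (\<Sum>q\<in>Q. (fst q - m)\<^sup>2)"
      by (simp add: sum.distrib sum_distrib_left)
    moreover have "(\<Sum>y\<in>Er. y\<^sup>2) = (\<Sum>y\<in>{1..163} - snd ` Q. (y - k)\<^sup>2)"
      unfolding Er_def by (simp add: sum.reindex inj_on_def)
    moreover have "(\<Sum>x\<in>Ec. x\<^sup>2) = (\<Sum>x\<in>{1..163} - fst ` Q. (x - m)\<^sup>2)"
      unfolding Ec_def by (simp add: sum.reindex inj_on_def)
    ultimately show ?thesis using sum_square_rows[of k] sum_square_cols[of m] by simp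
  qed
  have "tight_box h Er Ec D S"
  proof (rule tight_box.intro)
    show "61 \<le> h" "h \<le> 81" by (rule h)+
    show "\<bar>y\<bar> \<le> h" if "y \<in> Er" for y using that outer_rows cd unfolding mem_Er by force
    show "\<bar>x\<bar> \<le> h" if "x \<in> Ec" for x using that outer_cols ab unfolding mem_Ec by force
    show "h \<in> Er" "- h \<in> Er" using c_row d_row h cd unfolding mem_Er by (auto simp: algebra_simps)
    show "h \<in> Ec" "- h \<in> Ec" using a_col b_col h ab unfolding mem_Ec by (auto simp: algebra_simps)
    show "card Er = 82" "card Ec = 82"
      unfolding Er_def Ec_def using card_empty_rows card_empty_cols by (simp_all add: card_image inj_on_def)
    show "\<bar>t\<bar> \<le> 2 * h" if t: "t \<in> D" for t
    proof -
      obtain q where "q \<in> Q" "t = (snd q - k) - (fst q - m)" using t D_def by blast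
      then show ?thesis using diff_bounds[of q] ab cd by linarith
    qed
    show "\<bar>t\<bar> \<le> 2 * h" if t: "t \<in> S" for t
    proof -
      obtain q where "q \<in> Q" "t = (snd q - k) + (fst q - m)" using t S_def by blast
      then show ?thesis using sum_bounds[of q] ab cd by linarith
    qed
    show "card D = 81" "card S = 81" unfolding D_def S_def using card_Q inj by (simp_all add: card_image)
    show "y - x \<in> D \<or> y + x \<in> S" if x: "x \<in> Ec" and y: "y \<in> Er" for x y
    proof -
      have "x + m \<in> {1..163}" "y + k \<in> {1..163}" using x y mem_Er mem_Ec by blast+
      from covered[OF this] obtain q where q: "q \<in> Q" "fst q = x + m \<or> snd q = y + k \<or>
        snd q - fst q = y + k - (x + m) \<or> snd q + fst q = y + k + (x + m)" by blast
      have "fst q \<noteq> x + m" "snd q \<noteq> y + k" using q(1) x y unfolding mem_Er mem_Ec by force+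
      then have "y - x = (snd q - k) - (fst q - m) \<or> y + x = (snd q - k) + (fst q - m)"
        using q(2) by linarith
      then show ?thesis unfolding D_def S_def using q(1) by blast
    qed
    fix y :: int assume y: "\<bar>y\<bar> \<le> h"
    show "(y \<in> Er \<longleftrightarrow> y - h \<in> D \<or> y + h \<in> S) \<and> \<not> (y - h \<in> D \<and> y + h \<in> S)"
      using row_side[OF y, of h] by simp
    show "(y \<in> Er \<longleftrightarrow> y + h \<in> D \<or> y - h \<in> S) \<and> \<not> (y + h \<in> D \<and> y - h \<in> S)"
      using row_side[OF y, of "- h"] by simp
    show "(y \<in> Ec \<longleftrightarrow> h - y \<in> D \<or> h + y \<in> S) \<and> \<not> (h - y \<in> D \<and> h + y \<in> S)"
      using col_side[OF y, of h] by simp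
    show "(y \<in> Ec \<longleftrightarrow> - h - y \<in> D \<or> - h + y \<in> S) \<and> \<not> (- h - y \<in> D \<and> - h + y \<in> S)"
      using col_side[OF y, of "- h"] by simp
  next
    show "(\<Sum>d\<in>D. d\<^sup>2) + (\<Sum>s\<in>S. s\<^sup>2) \<ge> 2 * (721764 - (\<Sum>y\<in>Er. y\<^sup>2) - (\<Sum>x\<in>Ec. x\<^sup>2))"
      unfolding moment by (simp add: algebra_simps)
    show "(\<Sum>d\<in>D. d\<^sup>2) + (\<Sum>s\<in>S. s\<^sup>2) = 2 * (721764 - (\<Sum>y\<in>Er. y\<^sup>2) - (\<Sum>x\<in>Ec. x\<^sup>2))" if "h = 81"
      unfolding moment using full that by simp
  qed
  then show False by (rule tight_box.no_tight_box)
qed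

end

lemma no_cover_by_81_queens:
  fixes Q :: "(int \<times> int) set"
  assumes "Q \<subseteq> {1..163} \<times> {1..163}" "card Q = 81"
    and "\<And>x y. x \<in> {1..163} \<Longrightarrow> y \<in> {1..163} \<Longrightarrow>
      \<exists>q\<in>Q. fst q = x \<or> snd q = y \<or> snd q - fst q = y - x \<or> snd q + fst q = y + x"
  shows False
proof -
  have fin: "finite Q" using assms(2) card.infinite by fastforce
  have extremes: "\<exists>l u. 1 \<le> l \<and> l \<notin> f ` Q \<and> u \<le> 163 \<and> u \<notin> f ` Q \<and> {1..163} - {l..u} \<subseteq> f ` Q"
    for f :: "int \<times> int \<Rightarrow> int"
  proof -
    let ?C = "{1..163} - f ` Q"
    have "163 - card (f ` Q) \<le> card ?C"
      using diff_card_le_card_Diff[of "f ` Q" "{1..163}"] fin by simp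
    then have "card ?C \<noteq> 0" using card_image_le[OF fin, of f] assms(2) by linarith
    then have "?C \<noteq> {}" by (metis card.empty)
    then have "Min ?C \<in> ?C" "Max ?C \<in> ?C" using Min_in[of ?C] Max_in[of ?C] by simp_all
    moreover have "{1..163} - {Min ?C..Max ?C} \<subseteq> f ` Q"
    proof
      fix x assume x: "x \<in> {1..163} - {Min ?C..Max ?C}"
      show "x \<in> f ` Q"
      proof (rule ccontr)
        assume "x \<notin> f ` Q"
        then have "x \<in> ?C" using x by blast
        then show False using x Min_le[of ?C x] Max_ge[of ?C x] by simp
      qed
    qed
    ultimately show ?thesis by (intro exI[of _ "Min ?C"] exI[of _ "Max ?C"]) auto
  qed
  obtain a b where "1 \<le> a" "a \<notin> fst ` Q" "b \<le> 163" "b \<notin> fst ` Q" "{1..163} - {a..b} \<subseteq> fst ` Q"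
    using extremes[of fst] by blast
  moreover obtain c d where "1 \<le> c" "c \<notin> snd ` Q" "d \<le> 163" "d \<notin> snd ` Q" "{1..163} - {c..d} \<subseteq> snd ` Q"
    using extremes[of snd] by blast
  ultimately have "covered_board Q a b c d" using assms by (intro covered_board.intro) blast+
  then show False by (rule covered_board.no_covered_board)
qed

section \<open>Eighty-two queens, and the domination number\<close>

text \<open>Found by computer search, in coordinates with the centre square of the board as origin; the other half is the image under
the half turn. Every odd row and column contains one queen, and the occupied diagonals contain
all differences divisible by 4 up to 124 and other even ones up to 30, all sums divisible by 4 up to 32 and other
even ones up to 126.\<close>

definition half_queens :: "(int \<times> int) list" where
 "half_queens =
 [(1, 57), (3, 21), (5, - 71), (7, 9), (9, - 1), (11, - 11), (13, - 17), (15, 75), (17, 53),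
  (19, 13), (21, 7), (23, - 3), (25, - 67), (27, 51), (29, 81), (31, - 77), (33, - 35), (35, - 29),
  (37, 37), (39, - 49), (41, - 59), (43, 55), (45, - 79), (47, - 69), (49, - 63), (51, 43), (53, 73),
  (55, - 25), (57, 61), (59, 27), (61, 45), (63, 19), (65, - 39), (67, - 5), (69, - 15), (71, 31),
  (73, - 23), (75, 47), (77, - 65), (79, - 41), (81, 33)]"

definition queens :: "(int \<times> int) list" where
  "queens = half_queens @ map (\<lambda>(x, y). (- x, - y)) half_queens"

lemma card_queens: "card (set queens) = 82"
proof -
  have "distinct queens" "length queens = 82" by code_simp+
  then show ?thesis by (simp add: distinct_card)
qed

lemma queens_bound: "\<forall>q\<in>set queens. \<bar>fst q\<bar> \<le> 81 \<and> \<bar>snd q\<bar> \<le> 81"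
  by code_simp

lemma queens_cols: "\<forall>j\<in>{0..81}. 2 * j - 81 \<in> fst ` set queens"
  by code_simp

lemma queens_rows: "\<forall>j\<in>{0..81}. 2 * j - 81 \<in> snd ` set queens"
  by code_simp

lemma queens_diffs:
  "\<forall>j\<in>{-31..31}. 4 * j \<in> (\<lambda>q. snd q - fst q) ` set queens"
  "\<forall>j\<in>{-8..7}. 4 * j + 2 \<in> (\<lambda>q. snd q - fst q) ` set queens"
  by code_simp+

lemma queens_sums:
  "\<forall>j\<in>{-8..8}. 4 * j \<in> (\<lambda>q. snd q + fst q) ` set queens"
  "\<forall>j\<in>{-32..31}. 4 * j + 2 \<in> (\<lambda>q. snd q + fst q) ` set queens"
  by code_simp+

text \<open>For even coordinates \<open>y - x\<close> and \<open>y + x\<close> are both divisible by 4 or both not, and \<open>\<bar>y - x\<bar> + \<bar>y + x\<bar> = 2 * max \<bar>x\<bar> \<bar>y\<bar> \<le> 160\<close>.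
If the sum diagonal is not occupied, the difference is at most \<open>160 - 36 = 124\<close> in the first case and at most
\<open>160 - 130 = 30\<close> in the second.\<close>

lemma queens_cover:
  assumes "\<bar>x\<bar> \<le> 81" "\<bar>y\<bar> \<le> 81"
  shows "x \<in> fst ` set queens \<or> y \<in> snd ` set queens \<or>
    y - x \<in> (\<lambda>q. snd q - fst q) ` set queens \<or> y + x \<in> (\<lambda>q. snd q + fst q) ` set queens"
proof -
  consider "odd x" | "odd y" | "even x" "even y" by blast
  then show ?thesis
  proof cases
    case 1
    then obtain i where i: "x = 2 * i + 1" by (elim oddE)
    then have "2 * (i + 41) - 81 = x" "i + 41 \<in> {0..81}" using assms by auto
    then show ?thesis using queens_cols by metis
  next
    case 2
    then obtain i where i: "y = 2 * i + 1" by (elim oddE)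
    then have "2 * (i + 41) - 81 = y" "i + 41 \<in> {0..81}" using assms by auto
    then show ?thesis using queens_rows by metis
  next
    case 3
    then obtain u v where u: "x = 2 * u" and v: "y = 2 * v" by (elim evenE)
    show ?thesis
    proof (cases "even (u + v)")
      case True
      then obtain i where i: "u + v = 2 * i" by (elim evenE)
      have "y + x = 4 * i" "y - x = 4 * (i - u)" using i u v by simp_all
      moreover have "i \<in> {-8..8} \<or> i - u \<in> {-31..31}"
        unfolding atLeastAtMost_iff using i u v assms by presburger
      ultimately show ?thesis using queens_diffs(1) queens_sums(1) by metis
    next
      case False
      then obtain i where i: "u + v = 2 * i + 1" by (elim oddE)
      have "y + x = 4 * i + 2" "y - x = 4 * (i - u) + 2" using i u v by simp_all
      moreover have "i \<in> {-32..31} \<or> i - u \<in> {-8..7}"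
        unfolding atLeastAtMost_iff using i u v assms by presburger
      ultimately show ?thesis using queens_diffs(2) queens_sums(2) by metis
    qed
  qed
qed

lemma dominating_set_queens_graph_iff:
  "dominating_set (queens_graph n) Q \<longleftrightarrow> Q \<subseteq> {1..int n} \<times> {1..int n} \<and>
    (\<forall>x\<in>{1..int n}. \<forall>y\<in>{1..int n}. \<exists>q\<in>Q.
      fst q = x \<or> snd q = y \<or> snd q - fst q = y - x \<or> snd q + fst q = y + x)"
proof -
  have covers: "(\<exists>q\<in>Q. fst q = x \<or> snd q = y \<or> snd q - fst q = y - x \<or> snd q + fst q = y + x) \<longleftrightarrow>
      (x, y) \<in> Q \<or> (\<exists>q\<in>Q. (q, (x, y)) \<in> parcs (queens_graph n))"
    if "Q \<subseteq> squares n" "(x, y) \<in> squares n" for x y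
  proof -
    have "fst q = x \<or> snd q = y \<or> snd q - fst q = y - x \<or> snd q + fst q = y + x \<longleftrightarrow>
        q = (x, y) \<or> (q, (x, y)) \<in> parcs (queens_graph n)" if "q \<in> Q" for q
      using that \<open>Q \<subseteq> squares n\<close> \<open>(x, y) \<in> squares n\<close>
      by (auto simp: queens_graph_def queen_attacks_def)
    then have "(\<exists>q\<in>Q. fst q = x \<or> snd q = y \<or> snd q - fst q = y - x \<or> snd q + fst q = y + x) \<longleftrightarrow>
        (\<exists>q\<in>Q. q = (x, y) \<or> (q, (x, y)) \<in> parcs (queens_graph n))"
      by (rule bex_cong[OF refl])
    then show ?thesis by blast
  qed
  show ?thesis
  proof (cases "Q \<subseteq> squares n")
    case True
    have "dominating_set (queens_graph n) Q \<longleftrightarrow> (\<forall>x\<in>{1..int n}. \<forall>y\<in>{1..int n}.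
        (x, y) \<in> Q \<or> (\<exists>q\<in>Q. (q, (x, y)) \<in> parcs (queens_graph n)))"
      using True unfolding dominating_set_def by (simp add: queens_graph_def squares_def split_paired_Ball_Sigma)
    also have "\<dots> \<longleftrightarrow> (\<forall>x\<in>{1..int n}. \<forall>y\<in>{1..int n}. \<exists>q\<in>Q.
        fst q = x \<or> snd q = y \<or> snd q - fst q = y - x \<or> snd q + fst q = y + x)"
      using covers[OF True] by (intro ball_cong refl) (simp add: squares_def)
    finally show ?thesis using True by (simp add: squares_def)
  next
    case False
    then show ?thesis by (simp add: dominating_set_def queens_graph_def squares_def)
  qed
qed

lemma dominating_set_82: "\<exists>Q. dominating_set (queens_graph 163) Q \<and> card Q = 82"
proof (intro exI conjI)
  let ?Q = "(\<lambda>q. (fst q + 82, snd q + 82)) ` set queens"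
  show "card ?Q = 82" using card_queens by (subst card_image) (auto simp: inj_on_def prod_eq_iff)
  have "?Q \<subseteq> {1..163} \<times> {1..163}" using queens_bound by force
  moreover have "\<exists>q\<in>?Q. fst q = x \<or> snd q = y \<or> snd q - fst q = y - x \<or> snd q + fst q = y + x"
    if "x \<in> {1..163}" "y \<in> {1..163}" for x y
  proof -
    have "\<bar>x - 82\<bar> \<le> 81" "\<bar>y - 82\<bar> \<le> 81" using that by auto
    from queens_cover[OF this] obtain q where q: "q \<in> set queens"
      "x - 82 = fst q \<or> y - 82 = snd q \<or> (y - 82) - (x - 82) = snd q - fst q \<or>
        (y - 82) + (x - 82) = snd q + fst q" by blast
    then have "fst q + 82 = x \<or> snd q + 82 = y \<or> (snd q + 82) - (fst q + 82) = y - x \<or>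
        (snd q + 82) + (fst q + 82) = y + x" by linarith
    then show ?thesis using q(1) by (intro bexI[OF _ imageI[OF q(1)]]) simp
  qed
  ultimately show "dominating_set (queens_graph 163) ?Q"
    unfolding dominating_set_queens_graph_iff by simp
qed

text \<open>A smaller dominating set stays dominating when it is filled up to exactly 81 squares, and the lower bound argument wants
exactly 81.\<close>

lemma dominating_set_card_ge:
  assumes "dominating_set (queens_graph 163) Q"
  shows "82 \<le> card Q"
proof (rule ccontr)
  assume small: "\<not> 82 \<le> card Q"
  have Q: "Q \<subseteq> {1..163} \<times> {1..163}"
    and cover: "x \<in> {1..163} \<Longrightarrow> y \<in> {1..163} \<Longrightarrow>
      \<exists>q\<in>Q. fst q = x \<or> snd q = y \<or> snd q - fst q = y - x \<or> snd q + fst q = y + x" for x y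
    using assms unfolding dominating_set_queens_graph_iff by auto
  have fin: "finite Q" using Q by (rule finite_subset) simp
  let ?B = "{1..163} \<times> {1..163} :: (int \<times> int) set"
  have "81 - card Q \<le> card (?B - Q)"
    using card_Diff_subset[OF fin Q] by (simp add: card_cartesian_product)
  then obtain P where P: "P \<subseteq> ?B - Q" "card P = 81 - card Q" "finite P"
    by (rule obtain_subset_with_card_n)
  have "card (Q \<union> P) = 81"
    using card_Un_disjoint[OF fin P(3)] P small by auto
  moreover have "Q \<union> P \<subseteq> ?B" using P Q by blast
  ultimately show False using no_cover_by_81_queens[of "Q \<union> P"] cover by (meson UnI1)
qed

theorem theorem2:
  shows "domination_number (queens_graph 163) = 82"
  unfolding domination_number_def
  by (rule Least_equality) (use dominating_set_82 dominating_set_card_ge in auto)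

end
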